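(* Let $(X_i)_{i\ge 1}$ be a Markov chain with values in a measurable space $(E,\Sigma)$ with transition kernel $P$. Assume: (1) the chain is $\psi$-irreducible for some maximal irreducibility measure $\psi$ on $\Sigma$, and there exist an integer $m\ge 1$, $\delta_m>0$ and a probability measure $\mu$ such that $\delta_m\,\mu(D)\le P^m(x,D)$ for all $x\in E$, $D\in\Sigma$; denote by $\pi$ the unique invariant distribution of the chain; (2) there exist $\delta_M>0$ and a probability measure $\nu$ such that $P(x,D)\le \delta_M\,\nu(D)$ for all $x\in E$, $D\in\Sigma$; (3) the chain is stationary, i.e. $X_1$ has law $\pi$. Then there exist two constants $\beta,\kappa>0$, not depending on $n$, on $u$ or on the kernels $h_{i,j}$, such that for every $n\ge 2$, every family $(h_{i,j})_{i,j\in[n]}$ of bounded measurable $\pi$-canonical kernels $h_{i,j}:E^2\to\mathbb R$ and any $u>0$, it holds with probability at least $1-\beta e^{-u}\log n$, $$U_{\mathrm{stat}}(n)\le \kappa\log(n)\Big([C_n+A\log(n)\sqrt n]\sqrt u+[A+B_n\sqrt n]\,u+[2A\sqrt n]\,u^{3/2}+A[u^2+\log n]\Big).$$ If moreover $h_{i,j}\equiv h_{1,j}$ for all $i,j\in[n]$ (the kernels do not depend on $i$), then the term $C_n$ can be removed from this inequality.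
   Context: Notation: $[n]=\{1,\dots,n\}$; $\|\omega\|_{\mathrm{TV}}=\sup_{D\in\Sigma}|\omega(D)|$ for a measure $\omega$ on $(E,\Sigma)$; $P^0(y,\cdot)$ is the Dirac measure at $y$. $\pi$-canonical: $h_{i,j}$ is $\pi$-canonical if for all $x,y\in E$, $\mathbb E_{X\sim\pi}[h_{i,j}(X,x)]=\mathbb E_{X\sim\pi}[h_{i,j}(X,y)]=\mathbb E_{X\sim\pi}[h_{i,j}(x,X)]=\mathbb E_{X\sim\pi}[h_{i,j}(y,X)]$; the common value is denoted $\mathbb E_\pi[h_{i,j}]$. Hypothesis (1) is equivalent to uniform ergodicity: there exist constants $0<\rho<1$ and $L>0$ with $\|P^k(x,\cdot)-\pi\|_{\mathrm{TV}}\le L\rho^k$ for all $k\ge0$ and $\pi$-a.e. $x\in E$. Such $L,\rho$ are fixed, together with a real $r>2(\log(1/\rho))^{-1}$, and $t_n:=\lfloor r\log n\rfloor$. The constants $\beta,\kappa$ may depend on the chain, on the constants attached to the hypotheses on the chain, and on $r$. The U-statistic is $U_{\mathrm{stat}}(n)=\sum_{1\le i<j\le n}\big(h_{i,j}(X_i,X_j)-\mathbb E[h_{i,j}(X_i,X_j)]\big)$. Put $p_{i,j}(x,y)=h_{i,j}(x,y)-\mathbb E_\pi[h_{i,j}]$ and $$A=2\max_{i,j}\|h_{i,j}\|_\infty,\qquad C_n^2=\sum_{j=2}^n\sum_{i=1}^{j-1}\mathbb E\big[\mathbb E_{X'\sim\nu}[p_{i,j}^2(X_i,X')]\big],$$ $$B_n^2=\max\Big[\max_{0\le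 k\le t_n}\max_i\sup_x\sum_{j=i+1}^n\mathbb E_{X'\sim\nu}\big(\mathbb E_{X\sim P^k(X',\cdot)}\,p_{i,j}(x,X)\big)^2,\ \max_{0\le k\le t_n}\max_j\sup_y\sum_{i=1}^{j-1}\mathbb E_{\tilde X\sim\pi}\big(\mathbb E_{X\sim P^k(y,\cdot)}\,p_{i,j}(\tilde X,X)\big)^2\Big],$$ with $A,B_n,C_n\ge0$. *)

theory Defs
  imports "HOL-Probability.Probability"
begin

primrec kernel_pow :: "'a measure \<Rightarrow> ('a \<Rightarrow> 'a measure) \<Rightarrow> nat \<Rightarrow> 'a \<Rightarrow> 'a measure" where
  "kernel_pow E P 0 x = return E x"
| "kernel_pow E P (Suc k) x = kernel_pow E P k x \<bind> P"

definition prob_measure_on :: "'a measure \<Rightarrow> 'a measure \<Rightarrow> bool" where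
  "prob_measure_on E \<mu> \<longleftrightarrow> prob_space \<mu> \<and> sets \<mu> = sets E"

(* Irreducibility measures are nontrivial and sigma-finite, as is usual. *)
definition irreducibility_measure :: "'a measure \<Rightarrow> ('a \<Rightarrow> 'a measure) \<Rightarrow> 'a measure \<Rightarrow> bool" where
  "irreducibility_measure E P \<phi> \<longleftrightarrow>
     sets \<phi> = sets E \<and> sigma_finite_measure \<phi> \<and> emeasure \<phi> (space E) > 0 \<and>
     (\<forall>x\<in>space E. \<forall>D\<in>sets E. emeasure \<phi> D > 0 \<longrightarrow>
        (\<exists>k\<ge>1. measure (kernel_pow E P k x) D > 0))"

definition maximal_irreducibility_measure ::
    "'a measure \<Rightarrow> ('a \<Rightarrow> 'a measure) \<Rightarrow> 'a measure \<Rightarrow> bool" where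
  "maximal_irreducibility_measure E P \<psi> \<longleftrightarrow>
     irreducibility_measure E P \<psi> \<and>
     (\<forall>\<phi>. irreducibility_measure E P \<phi> \<longrightarrow> absolutely_continuous \<psi> \<phi>)"

definition invariant_distribution :: "'a measure \<Rightarrow> ('a \<Rightarrow> 'a measure) \<Rightarrow> 'a measure \<Rightarrow> bool" where
  "invariant_distribution E P \<pi> \<longleftrightarrow> prob_measure_on E \<pi> \<and> \<pi> \<bind> P = \<pi>"

(* The norm of the signed measure \<mu> - \<nu>, without a factor 2 (or 1/2). *)
definition tv_dist :: "'a measure \<Rightarrow> 'a measure \<Rightarrow> real" where
  "tv_dist \<mu> \<nu> = (SUP D\<in>sets \<mu>. \<bar>measure \<mu> D - measure \<nu> D\<bar>)"

(* The sigma-algebra generated by X 1, ..., X i. *)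
definition history :: "'w measure \<Rightarrow> 'a measure \<Rightarrow> (nat \<Rightarrow> 'w \<Rightarrow> 'a) \<Rightarrow> nat \<Rightarrow> 'w measure" where
  "history \<Omega> E X i = sigma (space \<Omega>) {X k -` D \<inter> space \<Omega> | k D. k \<in> {1..i} \<and> D \<in> sets E}"

(* The chain is X 1, X 2, ...; the value X 0 plays no role. *)
definition markov_chain ::
    "'w measure \<Rightarrow> 'a measure \<Rightarrow> ('a \<Rightarrow> 'a measure) \<Rightarrow> (nat \<Rightarrow> 'w \<Rightarrow> 'a) \<Rightarrow> bool" where
  "markov_chain \<Omega> E P X \<longleftrightarrow>
     prob_space \<Omega> \<and> P \<in> E \<rightarrow>\<^sub>M prob_algebra E \<and>
     (\<forall>i\<ge>1. X i \<in> \<Omega> \<rightarrow>\<^sub>M E) \<and>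
     (\<forall>i\<ge>1. \<forall>D\<in>sets E. AE \<omega> in \<Omega>.
        real_cond_exp \<Omega> (history \<Omega> E X i) (\<lambda>\<omega>. indicator D (X (Suc i) \<omega>)) \<omega>
          = measure (P (X i \<omega>)) D)"

definition canonical :: "'a measure \<Rightarrow> 'a measure \<Rightarrow> ('a \<Rightarrow> 'a \<Rightarrow> real) \<Rightarrow> bool" where
  "canonical E \<pi> g \<longleftrightarrow>
     (\<forall>x\<in>space E. \<forall>y\<in>space E.
        (\<integral>z. g z x \<partial>\<pi>) = (\<integral>z. g z y \<partial>\<pi>) \<and>
        (\<integral>z. g z y \<partial>\<pi>) = (\<integral>z. g x z \<partial>\<pi>) \<and>
        (\<integral>z. g x z \<partial>\<pi>) = (\<integral>z. g y z \<partial>\<pi>))"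

(* The common value in the definition of a canonical kernel; meaningful for canonical g only. *)
definition canonical_mean :: "'a measure \<Rightarrow> 'a measure \<Rightarrow> ('a \<Rightarrow> 'a \<Rightarrow> real) \<Rightarrow> real" where
  "canonical_mean E \<pi> g =
     (THE c. \<forall>x\<in>space E. (\<integral>z. g z x \<partial>\<pi>) = c \<and> (\<integral>z. g x z \<partial>\<pi>) = c)"

definition bounded_kernel :: "'a measure \<Rightarrow> ('a \<Rightarrow> 'a \<Rightarrow> real) \<Rightarrow> bool" where
  "bounded_kernel E g \<longleftrightarrow> (\<exists>b. \<forall>x\<in>space E. \<forall>y\<in>space E. \<bar>g x y\<bar> \<le> b)"

(* A kernel family on [n] is a function h of two indices, used for indices in {1..n} only. *)
definition canonical_family ::
    "'a measure \<Rightarrow> 'a measure \<Rightarrow> nat \<Rightarrow> (nat \<Rightarrow> nat \<Rightarrow> 'a \<Rightarrow> 'a \<Rightarrow> real) \<Rightarrow> bool" where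
  "canonical_family E \<pi> n h \<longleftrightarrow>
     (\<forall>i\<in>{1..n}. \<forall>j\<in>{1..n}.
        (\<lambda>(x, y). h i j x y) \<in> borel_measurable (E \<Otimes>\<^sub>M E) \<and>
        bounded_kernel E (h i j) \<and> canonical E \<pi> (h i j))"

definition U_stat ::
    "'w measure \<Rightarrow> (nat \<Rightarrow> 'w \<Rightarrow> 'a) \<Rightarrow> (nat \<Rightarrow> nat \<Rightarrow> 'a \<Rightarrow> 'a \<Rightarrow> real) \<Rightarrow> nat \<Rightarrow> 'w \<Rightarrow> real" where
  "U_stat \<Omega> X h n \<omega> =
     (\<Sum>(i, j)\<in>{(i, j). 1 \<le> i \<and> i < j \<and> j \<le> n}.
        h i j (X i \<omega>) (X j \<omega>) - (\<integral>\<omega>'. h i j (X i \<omega>') (X j \<omega>') \<partial>\<Omega>))"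

definition centred ::
    "'a measure \<Rightarrow> 'a measure \<Rightarrow> (nat \<Rightarrow> nat \<Rightarrow> 'a \<Rightarrow> 'a \<Rightarrow> real) \<Rightarrow> nat \<Rightarrow> nat \<Rightarrow> 'a \<Rightarrow> 'a \<Rightarrow> real" where
  "centred E \<pi> h i j x y = h i j x y - canonical_mean E \<pi> (h i j)"

definition sup_norm :: "'a measure \<Rightarrow> ('a \<Rightarrow> 'a \<Rightarrow> real) \<Rightarrow> real" where
  "sup_norm E g = (SUP (x, y)\<in>space E \<times> space E. \<bar>g x y\<bar>)"

definition A_const :: "'a measure \<Rightarrow> (nat \<Rightarrow> nat \<Rightarrow> 'a \<Rightarrow> 'a \<Rightarrow> real) \<Rightarrow> nat \<Rightarrow> real" where
  "A_const E h n = 2 * (MAX (i, j)\<in>{1..n} \<times> {1..n}. sup_norm E (h i j))"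

definition C_const ::
    "'w measure \<Rightarrow> 'a measure \<Rightarrow> (nat \<Rightarrow> 'w \<Rightarrow> 'a) \<Rightarrow> 'a measure \<Rightarrow> 'a measure \<Rightarrow>
      (nat \<Rightarrow> nat \<Rightarrow> 'a \<Rightarrow> 'a \<Rightarrow> real) \<Rightarrow> nat \<Rightarrow> real" where
  "C_const \<Omega> E X \<pi> \<nu> h n =
     sqrt (\<Sum>j=2..n. \<Sum>i=1..j-1.
       (\<integral>\<omega>. (\<integral>x'. (centred E \<pi> h i j (X i \<omega>) x')\<^sup>2 \<partial>\<nu>) \<partial>\<Omega>))"

definition t_bound :: "real \<Rightarrow> nat \<Rightarrow> nat" where
  "t_bound r n = nat \<lfloor>r * ln (real n)\<rfloor>"

definition B_const ::
    "'a measure \<Rightarrow> ('a \<Rightarrow> 'a measure) \<Rightarrow> 'a measure \<Rightarrow> 'a measure \<Rightarrow> real \<Rightarrow>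
      (nat \<Rightarrow> nat \<Rightarrow> 'a \<Rightarrow> 'a \<Rightarrow> real) \<Rightarrow> nat \<Rightarrow> real" where
  "B_const E P \<pi> \<nu> r h n =
     sqrt (max
       (MAX k\<in>{0..t_bound r n}. MAX i\<in>{1..n}. SUP x\<in>space E.
          \<Sum>j=i+1..n. \<integral>x'. (\<integral>z. centred E \<pi> h i j x z \<partial>kernel_pow E P k x')\<^sup>2 \<partial>\<nu>)
       (MAX k\<in>{0..t_bound r n}. MAX j\<in>{1..n}. SUP y\<in>space E.
          \<Sum>i=1..j-1. \<integral>x'. (\<integral>z. centred E \<pi> h i j x' z \<partial>kernel_pow E P k y)\<^sup>2 \<partial>\<pi>))"

(* Parenthesised part of the bound, with C in the place of C_n: taking C = 0 removes that term. *)
definition U_bound :: "real \<Rightarrow> real \<Rightarrow> real \<Rightarrow> nat \<Rightarrow> real \<Rightarrow> real" where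
  "U_bound A B C n u =
     (C + A * ln (real n) * sqrt (real n)) * sqrt u
     + (A + B * sqrt (real n)) * u
     + (2 * A * sqrt (real n)) * u powr (3/2)
     + A * (u\<^sup>2 + ln (real n))"

end

theory Submission
  imports Defs
begin

text \<open>The idea is to replace the statistic by a martingale and to measure that martingale by its own
  quadratic variation.

  Let \<open>p\<close> denote the centred kernels, \<open>T k\<close> the \<open>k\<close>-step transition operator, and
  \<open>G i j x = \<Sum>k\<le>t. T k (p i (j + k) x)\<close> with \<open>t = t_bound r n\<close>.  The function \<open>G\<close> solves the Poisson equation
  in its second argument up to an error \<open>T (t + 1) p\<close> (\<open>poisson_equation\<close>).  Summing that equation over all pairs
  of times telescopes (\<open>decomposition\<close>) and leaves three parts:
  a sum of martingale increments \<open>S\<^sub>j(X\<^sub>j) - T 1 S\<^sub>j (X\<^sub>j\<^sub>-\<^sub>1)\<close>, where \<open>S\<^sub>j(y) = \<Sum>i<j. G i j (X\<^sub>i) y\<close>;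
  a sum of functions of one state \<open>X\<^sub>i\<close>, coming from the boundary \<open>j = i\<close> of the telescoping;
  and a remainder made of the errors.  Uniform ergodicity and the lower bound on \<open>r\<close> make each error at most a
  constant times \<open>A / n\<^sup>2\<close>, so the remainder is of order \<open>A\<close>.

  The other two parts rest on Bernstein's inequality for the stationary chain (\<open>bernstein\<close>), with the stationary
  variance as variance proxy and without a logarithmic loss.  It comes from the operator norm
  of \<open>F \<mapsto> exp g \<sqdot> T m F\<close> on the square integrable functions: the Doeblin condition makes \<open>T m\<close> a strict contraction on
  centred functions (\<open>mean_square_contraction\<close>), and the margin absorbs the factor \<open>exp g\<close> up to
  \<open>1 + O(\<pi>(g\<^sup>2))\<close> (\<open>exp_step\<close>).  This settles the sum of functions of one state.

  For the martingale, \<open>exp (c - c\<^sup>2 / 2) \<le> 1 + c + c\<^sup>2 / 2\<close> shows that the exponential of the martingale,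
  compensated by half its square variation and half its predicted square variation, has mean at most 1
  (\<open>exponential_supermartingale\<close>); no bound on the increments is involved.  Both variations are
  bounded by sums over \<open>j\<close> of the squares \<open>(S\<^sub>j(X\<^sub>j))\<^sup>2\<close> and of their predictions.  A convex function of these
  squares, comparable to \<open>exp \<bar>S\<^sub>j(X\<^sub>j)\<bar>\<close>, controls the average over \<open>j\<close> by Jensen's inequality (\<open>exp_sqrt_quadratic_variation\<close>).  Since the conditional law of \<open>X\<^sub>j\<close> is dominated by \<open>\<delta>\<^sub>M \<nu>\<close>, it suffices
  to bound \<open>exp \<bar>S\<^sub>j(y)\<bar>\<close> for each fixed \<open>y\<close> (\<open>decoupling\<close>), and there Bernstein's inequality applies:
  the variance of \<open>S\<^sub>j(y)\<close> is at most \<open>(t + 1)\<^sup>2 B\<^sup>2\<close> by the second maximum in the definition of \<open>B\<close>.  The outcome is a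
  martingale bound of order \<open>t (A \<surd>n u\<^sup>3\<^sup>/\<^sup>2 + B \<surd>n u)\<close>, and \<open>t + 1 = O(ln n)\<close>.

  In total this proves the inequality with \<open>0\<close> in the place of \<open>C_const\<close>, which gives both claims because
  \<open>C_const\<close> is nonnegative.\<close>

section \<open>Bounded measurable functions and integration against kernels\<close>

text \<open>Every function integrated below is bounded, so that integrability reduces to closure properties
  of the following class.\<close>

definition bounded_borel :: "'a measure \<Rightarrow> ('a \<Rightarrow> real) set" where
  "bounded_borel M = {f \<in> borel_measurable M. \<exists>b. \<forall>x\<in>space M. \<bar>f x\<bar> \<le> b}"

lemma bounded_borelI:
  assumes "f \<in> borel_measurable M" "\<And>x. x \<in> space M \<Longrightarrow> \<bar>f x\<bar> \<le> b"
  shows "f \<in> bounded_borel M"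
  using assms unfolding bounded_borel_def by auto

lemma bounded_borelE:
  assumes "f \<in> bounded_borel M"
  obtains b where "b \<ge> 0" "\<And>x. x \<in> space M \<Longrightarrow> \<bar>f x\<bar> \<le> b"
proof -
  from assms obtain b where b: "\<And>x. x \<in> space M \<Longrightarrow> \<bar>f x\<bar> \<le> b"
    unfolding bounded_borel_def by auto
  show ?thesis using b by (intro that[of "max b 0"]) (auto intro: order_trans max.cobounded1)
qed

lemma bounded_borel_measurable [measurable_dest]:
  "f \<in> bounded_borel M \<Longrightarrow> f \<in> borel_measurable M"
  unfolding bounded_borel_def by simp

lemma bounded_borel_const [simp]: "(\<lambda>_. c) \<in> bounded_borel M"
  by (rule bounded_borelI[of _ _ "\<bar>c\<bar>"]) auto

lemma bounded_borel_add:
  assumes "f \<in> bounded_borel M" "g \<in> bounded_borel M"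
  shows "(\<lambda>x. f x + g x) \<in> bounded_borel M"
proof -
  note [measurable] = assms
  obtain a where a: "\<And>x. x \<in> space M \<Longrightarrow> \<bar>f x\<bar> \<le> a" using bounded_borelE[OF assms(1)] by metis
  obtain b where b: "\<And>x. x \<in> space M \<Longrightarrow> \<bar>g x\<bar> \<le> b" using bounded_borelE[OF assms(2)] by metis
  show ?thesis
  proof (rule bounded_borelI[of _ _ "a + b"])
    show "(\<lambda>x. f x + g x) \<in> borel_measurable M" by measurable
  qed (use a b in \<open>smt (verit)\<close>)
qed

lemma bounded_borel_mult:
  assumes "f \<in> bounded_borel M" "g \<in> bounded_borel M"
  shows "(\<lambda>x. f x * g x) \<in> bounded_borel M"
proof -
  note [measurable] = assms
  obtain a where a: "a \<ge> 0" "\<And>x. x \<in> space M \<Longrightarrow> \<bar>f x\<bar> \<le> a" using bounded_borelE[OF assms(1)] by metis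
  obtain b where b: "\<And>x. x \<in> space M \<Longrightarrow> \<bar>g x\<bar> \<le> b" using bounded_borelE[OF assms(2)] by metis
  show ?thesis
  proof (rule bounded_borelI[of _ _ "a * b"])
    show "(\<lambda>x. f x * g x) \<in> borel_measurable M" by measurable
  qed (use a b in \<open>auto simp: abs_mult intro!: mult_mono\<close>)
qed

lemma bounded_borel_uminus:
  "f \<in> bounded_borel M \<Longrightarrow> (\<lambda>x. - f x) \<in> bounded_borel M"
  using bounded_borel_mult[of "\<lambda>_. -1" M f] by simp

lemma bounded_borel_diff:
  "f \<in> bounded_borel M \<Longrightarrow> g \<in> bounded_borel M \<Longrightarrow> (\<lambda>x. f x - g x) \<in> bounded_borel M"
  using bounded_borel_add[OF _ bounded_borel_uminus, of f M g] by simp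

lemma bounded_borel_divide:
  "f \<in> bounded_borel M \<Longrightarrow> (\<lambda>x. f x / c) \<in> bounded_borel M"
  using bounded_borel_mult[of f M "\<lambda>_. 1 / c"] by simp

lemma bounded_borel_power:
  "f \<in> bounded_borel M \<Longrightarrow> (\<lambda>x. f x ^ k) \<in> bounded_borel M"
  by (induction k) (simp_all add: bounded_borel_mult)

lemma bounded_borel_sum:
  "(\<And>i. i \<in> I \<Longrightarrow> f i \<in> bounded_borel M) \<Longrightarrow> (\<lambda>x. \<Sum>i\<in>I. f i x) \<in> bounded_borel M"
  by (induction I rule: infinite_finite_induct) (simp_all add: bounded_borel_add)

lemma bounded_borel_mono_image:
  fixes \<phi> :: "real \<Rightarrow> real"
  assumes f: "f \<in> bounded_borel M" and [measurable]: "\<phi> \<in> borel_measurable borel" and "mono \<phi>"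
  shows "(\<lambda>x. \<phi> (f x)) \<in> bounded_borel M"
proof -
  note [measurable] = f
  obtain b where b: "\<And>x. x \<in> space M \<Longrightarrow> \<bar>f x\<bar> \<le> b" using bounded_borelE[OF f] by metis
  have "\<bar>\<phi> (f x)\<bar> \<le> \<bar>\<phi> b\<bar> + \<bar>\<phi> (- b)\<bar>" if "x \<in> space M" for x
  proof -
    have "\<phi> (- b) \<le> \<phi> (f x)" "\<phi> (f x) \<le> \<phi> b"
      using b[OF that] \<open>mono \<phi>\<close> by (auto intro!: monoD[of \<phi>])
    then show ?thesis by linarith
  qed
  then show ?thesis by (intro bounded_borelI) auto
qed

lemma bounded_borel_exp:
  "f \<in> bounded_borel M \<Longrightarrow> (\<lambda>x. exp (f x) :: real) \<in> bounded_borel M"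
  by (rule bounded_borel_mono_image) (auto intro: monoI)

lemma bounded_borel_sqrt:
  "f \<in> bounded_borel M \<Longrightarrow> (\<lambda>x. sqrt (f x)) \<in> bounded_borel M"
  by (rule bounded_borel_mono_image) (auto intro: monoI)

lemma bounded_borel_abs:
  "f \<in> bounded_borel M \<Longrightarrow> (\<lambda>x. \<bar>f x\<bar>) \<in> bounded_borel M"
  unfolding bounded_borel_def by auto

lemmas bounded_borel_intros = bounded_borel_const bounded_borel_add bounded_borel_diff
  bounded_borel_uminus bounded_borel_mult bounded_borel_divide bounded_borel_power
  bounded_borel_sum bounded_borel_exp bounded_borel_sqrt bounded_borel_abs

lemma bounded_borel_compose:
  assumes "f \<in> bounded_borel N" and [measurable]: "g \<in> M \<rightarrow>\<^sub>M N"
  shows "(\<lambda>x. f (g x)) \<in> bounded_borel M"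
proof -
  note [measurable] = assms(1)
  obtain b where b: "\<And>x. x \<in> space N \<Longrightarrow> \<bar>f x\<bar> \<le> b" using bounded_borelE[OF assms(1)] by metis
  show ?thesis
  proof (rule bounded_borelI[of _ _ b])
    show "(\<lambda>x. f (g x)) \<in> borel_measurable M"
      by (rule measurable_compose[OF assms(2) bounded_borel_measurable[OF assms(1)]])
  qed (use b measurable_space[OF assms(2)] in auto)
qed

lemma bounded_borel_section:
  assumes "(\<lambda>(x, y). f x y) \<in> bounded_borel (M \<Otimes>\<^sub>M N)" "x \<in> space M"
  shows "f x \<in> bounded_borel N"
  using bounded_borel_compose[OF assms(1), of "\<lambda>y. (x, y)" N] assms(2) by simp

lemma bounded_borel_section':
  assumes "(\<lambda>(x, y). f x y) \<in> bounded_borel (M \<Otimes>\<^sub>M N)" "y \<in> space N"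
  shows "(\<lambda>x. f x y) \<in> bounded_borel M"
  using bounded_borel_compose[OF assms(1), of "\<lambda>x. (x, y)" M] assms(2) by simp

lemma bounded_borel_cong_sets:
  "sets M = sets N \<Longrightarrow> bounded_borel M = bounded_borel N"
  unfolding bounded_borel_def using sets_eq_imp_space_eq[of M N] measurable_cong_sets[of M N borel borel]
  by auto

lemma (in finite_measure) integrable_bounded_borel:
  assumes "f \<in> bounded_borel M" shows "integrable M f"
proof -
  obtain b where "\<And>x. x \<in> space M \<Longrightarrow> \<bar>f x\<bar> \<le> b" using bounded_borelE[OF assms] by metis
  then show ?thesis
    using assms by (intro integrable_const_bound[of f b]) (auto dest: bounded_borel_measurable)
qed

lemma (in prob_space) abs_integral_le_bound:
  assumes "f \<in> borel_measurable M" "AE x in M. \<bar>f x\<bar> \<le> b"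
  shows "\<bar>\<integral>x. f x \<partial>M\<bar> \<le> (b :: real)"
proof -
  have i: "integrable M f"
    using assms by (intro integrable_const_bound[of f b]) auto
  have "(\<integral>x. f x \<partial>M) \<le> b"
    by (rule integral_le_const[OF i]) (use assms(2) in auto)
  moreover have "(\<integral>x. - f x \<partial>M) \<le> b"
    by (rule integral_le_const) (use i assms(2) in auto)
  ultimately show ?thesis by simp
qed

text \<open>Both the Doeblin minorization and the domination of the kernel by a fixed measure are used through
  this comparison of integrals.\<close>

lemma integral_le_of_measure_le:
  fixes f :: "'a \<Rightarrow> real"
  assumes M: "finite_measure M" and N: "finite_measure N" and s: "sets M = sets N" and c: "c \<ge> 0"
    and le: "\<And>D. D \<in> sets N \<Longrightarrow> measure M D \<le> c * measure N D"
    and f: "f \<in> bounded_borel N" and nn: "\<And>x. x \<in> space N \<Longrightarrow> f x \<ge> 0"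
  shows "(\<integral>x. f x \<partial>M) \<le> c * (\<integral>x. f x \<partial>N)"
proof -
  interpret M: finite_measure M by fact
  interpret N: finite_measure N by fact
  have sp: "space M = space N" using s by (rule sets_eq_imp_space_eq)
  have fM: "f \<in> bounded_borel M" using f bounded_borel_cong_sets[OF s] by simp
  have "emeasure M D \<le> emeasure (scale_measure (ennreal c) N) D" for D
  proof (cases "D \<in> sets N")
    case True
    then show ?thesis
      using le[OF True] c s
      by (simp add: M.emeasure_eq_measure N.emeasure_eq_measure ennreal_mult'[symmetric])
  qed (use s in \<open>simp add: emeasure_notin_sets\<close>)
  then have "M \<le> scale_measure (ennreal c) N"
    using s by (intro le_measure[THEN iffD2] le_funI) auto
  then have "(\<integral>\<^sup>+x. ennreal (f x) \<partial>M) \<le> (\<integral>\<^sup>+x. ennreal (f x) \<partial>scale_measure (ennreal c) N)"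
    using s by (intro nn_integral_mono_measure) auto
  also have "\<dots> = ennreal c * (\<integral>\<^sup>+x. ennreal (f x) \<partial>N)"
    using f by (intro nn_integral_scale_measure) (auto dest: bounded_borel_measurable)
  finally show ?thesis
    using nn sp c M.integrable_bounded_borel[OF fM] N.integrable_bounded_borel[OF f]
    by (subst (asm) (1 2) nn_integral_eq_integral)
      (auto simp: ennreal_mult'[symmetric] intro!: mult_nonneg_nonneg Bochner_Integration.integral_nonneg)
qed

lemma bounded_borel_kernel_integral:
  assumes f: "(\<lambda>(x, y). f x y) \<in> bounded_borel (M \<Otimes>\<^sub>M N)" and K: "K \<in> M \<rightarrow>\<^sub>M prob_algebra N"
  shows "(\<lambda>x. \<integral>y. f x y \<partial>K x) \<in> bounded_borel M"
proof -
  note [measurable] = f and K' = measurable_prob_algebraD[OF K]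
  obtain b where b: "b \<ge> 0" "\<And>z. z \<in> space (M \<Otimes>\<^sub>M N) \<Longrightarrow> \<bar>(\<lambda>(x, y). f x y) z\<bar> \<le> b"
    using bounded_borelE[OF f] by metis
  have Kx: "prob_space (K x)" "sets (K x) = sets N" if "x \<in> space M" for x
    using measurable_space[OF K that] by (auto simp: space_prob_algebra)
  show ?thesis
  proof (rule bounded_borelI[of _ _ b])
    have "(\<lambda>x. distr (K x) (M \<Otimes>\<^sub>M N) (Pair x)) \<in> M \<rightarrow>\<^sub>M subprob_algebra (M \<Otimes>\<^sub>M N)"
      by (rule measurable_distr2[OF _ K']) simp
    from measurable_compose[OF this integral_measurable_subprob_algebra[OF bounded_borel_measurable[OF f]]]
    have "(\<lambda>x. \<integral>z. (\<lambda>(x, y). f x y) z \<partial>distr (K x) (M \<Otimes>\<^sub>M N) (Pair x)) \<in> borel_measurable M" .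
    moreover have "(\<integral>z. (\<lambda>(x, y). f x y) z \<partial>distr (K x) (M \<Otimes>\<^sub>M N) (Pair x)) = (\<integral>y. f x y \<partial>K x)"
      if x: "x \<in> space M" for x
    proof -
      have "Pair x \<in> K x \<rightarrow>\<^sub>M M \<Otimes>\<^sub>M N"
        using x by (subst measurable_cong_sets[OF Kx(2)[OF x] refl]) simp
      then show ?thesis by (subst integral_distr) (auto simp: f bounded_borel_measurable)
    qed
    ultimately show "(\<lambda>x. \<integral>y. f x y \<partial>K x) \<in> borel_measurable M"
      by (simp cong: measurable_cong)
    fix x assume x: "x \<in> space M"
    interpret prob_space "K x" by (rule Kx[OF x])
    have sp: "space (K x) = space N" using sets_eq_imp_space_eq[OF Kx(2)[OF x]] .
    have "f x \<in> borel_measurable (K x)"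
      using bounded_borel_section[OF f x]
      by (simp add: measurable_cong_sets[OF Kx(2)[OF x] refl] bounded_borel_measurable)
    then show "\<bar>\<integral>y. f x y \<partial>K x\<bar> \<le> b"
      by (rule abs_integral_le_bound) (use b(2) x sp in \<open>auto simp: space_pair_measure intro!: AE_I2\<close>)
  qed
qed

lemma integral_kernel_bind:
  assumes M: "prob_space M" "sets M = sets S" and K: "K \<in> S \<rightarrow>\<^sub>M prob_algebra N"
    and f: "f \<in> bounded_borel N"
  shows "(\<integral>y. f y \<partial>(M \<bind> K)) = (\<integral>x. \<integral>y. f y \<partial>K x \<partial>M)"
proof -
  interpret M: prob_space M by fact
  obtain b where b: "\<And>x. x \<in> space N \<Longrightarrow> \<bar>f x\<bar> \<le> b" using bounded_borelE[OF f] by metis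
  have KM: "K \<in> M \<rightarrow>\<^sub>M subprob_algebra N"
    using measurable_prob_algebraD[OF K] by (simp add: measurable_cong_sets[OF M(2) refl])
  have "AE x in M. emeasure (K x) (space (K x)) \<le> ennreal 1"
  proof (rule AE_I2)
    fix x assume "x \<in> space M"
    then have "prob_space (K x)"
      using measurable_space[OF K, of x] sets_eq_imp_space_eq[OF M(2)] by (auto simp: space_prob_algebra)
    then show "emeasure (K x) (space (K x)) \<le> ennreal 1" by (simp add: prob_space.emeasure_space_1)
  qed
  then show ?thesis
    by (intro integral_bind[OF bounded_borel_measurable[OF f] b KM M.finite_measure_axioms])
qed

lemma bounded_borel_subalgebra:
  assumes "subalgebra M F" "f \<in> bounded_borel F"
  shows "f \<in> bounded_borel M"
proof -
  obtain b where b: "\<And>x. x \<in> space F \<Longrightarrow> \<bar>f x\<bar> \<le> b" using bounded_borelE[OF assms(2)] by metis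
  have "space M = space F" using assms(1) by (simp add: subalgebra_def)
  with b show ?thesis
    by (intro bounded_borelI[OF measurable_from_subalg[OF assms(1) bounded_borel_measurable[OF assms(2)]]]) simp
qed

section \<open>The stationary chain and its transition operators\<close>

locale stationary_chain =
  fixes \<Omega> :: "'w measure" and E :: "'a measure" and P :: "'a \<Rightarrow> 'a measure"
    and X :: "nat \<Rightarrow> 'w \<Rightarrow> 'a" and \<pi> :: "'a measure"
  assumes chain: "markov_chain \<Omega> E P X"
    and invariant: "invariant_distribution E P \<pi>"
    and stationary: "distr \<Omega> E (X 1) = \<pi>"
begin

sublocale prob_space \<Omega>
  using chain by (simp add: markov_chain_def)

sublocale \<pi>: prob_space \<pi>
  using invariant by (simp add: invariant_distribution_def prob_measure_on_def)

abbreviation H :: "nat \<Rightarrow> 'w measure" where "H \<equiv> history \<Omega> E X"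

definition T :: "nat \<Rightarrow> ('a \<Rightarrow> real) \<Rightarrow> 'a \<Rightarrow> real" where
  "T k f y = (\<integral>z. f z \<partial>kernel_pow E P k y)"

lemma sets_\<pi> [simp]: "sets \<pi> = sets E"
  using invariant by (simp add: invariant_distribution_def prob_measure_on_def)

lemma space_\<pi> [simp]: "space \<pi> = space E"
  by (rule sets_eq_imp_space_eq) simp

lemma bounded_borel_\<pi> [simp]: "bounded_borel \<pi> = bounded_borel E"
  by (rule bounded_borel_cong_sets) simp

lemma space_E_nonempty: "space E \<noteq> {}"
  using \<pi>.not_empty by simp

lemma P_measurable: "P \<in> E \<rightarrow>\<^sub>M prob_algebra E"
  using chain by (simp add: markov_chain_def)

lemma X_measurable: "i \<ge> 1 \<Longrightarrow> X i \<in> \<Omega> \<rightarrow>\<^sub>M E"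
  using chain by (simp add: markov_chain_def)

lemma X_in_space: "i \<ge> 1 \<Longrightarrow> \<omega> \<in> space \<Omega> \<Longrightarrow> X i \<omega> \<in> space E"
  using measurable_space[OF X_measurable] .

lemma space_H [simp]: "space (H i) = space \<Omega>"
  unfolding history_def by (subst space_measure_of) auto

lemma sets_H: "sets (H i) = sigma_sets (space \<Omega>)
    {X k -` D \<inter> space \<Omega> | k D. k \<in> {1..i} \<and> D \<in> sets E}"
  unfolding history_def by (subst sets_measure_of) auto

lemma subalgebra_H: "subalgebra \<Omega> (H i)"
proof -
  have "{X k -` D \<inter> space \<Omega> | k D. k \<in> {1..i} \<and> D \<in> sets E} \<subseteq> sets \<Omega>"
    using measurable_sets[OF X_measurable] by auto
  then show ?thesis
    unfolding subalgebra_def sets_H by (intro conjI sets.sigma_sets_subset) (simp only: space_H)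
qed

lemma sets_H_mono:
  assumes "i \<le> j" shows "sets (H i) \<subseteq> sets (H j)"
  unfolding sets_H
proof (rule sigma_sets_mono', rule subsetI)
  fix A assume "A \<in> {X k -` D \<inter> space \<Omega> | k D. k \<in> {1..i} \<and> D \<in> sets E}"
  then obtain k D where "A = X k -` D \<inter> space \<Omega>" "k \<in> {1..i}" "D \<in> sets E" by blast
  moreover from this have "k \<in> {1..j}" using assms by simp
  ultimately show "A \<in> {X k -` D \<inter> space \<Omega> | k D. k \<in> {1..j} \<and> D \<in> sets E}" by blast
qed

lemma X_measurable_H:
  assumes k: "1 \<le> k" "k \<le> i" shows "X k \<in> H i \<rightarrow>\<^sub>M E"
proof (rule measurableI)
  fix D assume D: "D \<in> sets E"
  have "k \<in> {1..i}" using k by simp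
  with D have "X k -` D \<inter> space \<Omega> \<in> {X k -` D \<inter> space \<Omega> | k D. k \<in> {1..i} \<and> D \<in> sets E}"
    by blast
  then show "X k -` D \<inter> space (H i) \<in> sets (H i)"
    unfolding sets_H space_H by (rule sigma_sets.Basic)
next
  fix \<omega> assume "\<omega> \<in> space (H i)"
  then show "X k \<omega> \<in> space E" using X_in_space[OF k(1)] by simp
qed

lemma bounded_borel_H: "f \<in> bounded_borel (H i) \<Longrightarrow> f \<in> bounded_borel \<Omega>"
  by (rule bounded_borel_subalgebra[OF subalgebra_H])

lemma bounded_borel_H_mono: "i \<le> j \<Longrightarrow> f \<in> bounded_borel (H i) \<Longrightarrow> f \<in> bounded_borel (H j)"
  by (rule bounded_borel_subalgebra) (simp_all only: subalgebra_def space_H sets_H_mono simp_thms)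

lemma bounded_borel_X: "1 \<le> k \<Longrightarrow> k \<le> i \<Longrightarrow> f \<in> bounded_borel E \<Longrightarrow> (\<lambda>\<omega>. f (X k \<omega>)) \<in> bounded_borel (H i)"
  by (rule bounded_borel_compose[OF _ X_measurable_H])

lemma kernel_pow_measurable: "kernel_pow E P k \<in> E \<rightarrow>\<^sub>M prob_algebra E"
proof (induction k)
  case 0
  have "kernel_pow E P 0 = return E" by (rule ext) simp
  then show ?case by simp
next
  case (Suc k)
  have "kernel_pow E P (Suc k) = (\<lambda>x. kernel_pow E P k x \<bind> P)" by (rule ext) simp
  then show ?case using measurable_bind_prob_space[OF Suc P_measurable] by simp
qed

lemma kernel_pow_1: "x \<in> space E \<Longrightarrow> kernel_pow E P 1 x = P x"
  using bind_return[OF measurable_prob_algebraD[OF P_measurable]] by simp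

lemma kernel_powD:
  assumes "x \<in> space E"
  shows "prob_space (kernel_pow E P k x)" "sets (kernel_pow E P k x) = sets E"
    "space (kernel_pow E P k x) = space E" "bounded_borel (kernel_pow E P k x) = bounded_borel E"
proof -
  show 1: "prob_space (kernel_pow E P k x)" "sets (kernel_pow E P k x) = sets E"
    using measurable_space[OF kernel_pow_measurable assms] by (auto simp: space_prob_algebra)
  show "space (kernel_pow E P k x) = space E" by (rule sets_eq_imp_space_eq[OF 1(2)])
  show "bounded_borel (kernel_pow E P k x) = bounded_borel E" by (rule bounded_borel_cong_sets[OF 1(2)])
qed

lemma T_1: "x \<in> space E \<Longrightarrow> T 1 f x = (\<integral>z. f z \<partial>P x)"
  unfolding T_def using kernel_pow_1 by simp

text \<open>The simplifier rewrites \<open>1\<close> to \<open>Suc 0\<close>.\<close>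

lemmas T_Suc_0 = T_1[unfolded One_nat_def]

lemma T_0: "x \<in> space E \<Longrightarrow> f \<in> bounded_borel E \<Longrightarrow> T 0 f x = f x"
  unfolding T_def by (simp add: integral_return bounded_borel_measurable)

lemma T_kernel_bounded_borel:
  assumes "(\<lambda>(x, y). f x y) \<in> bounded_borel (M \<Otimes>\<^sub>M E)" "g \<in> M \<rightarrow>\<^sub>M E"
  shows "(\<lambda>x. T k (f x) (g x)) \<in> bounded_borel M"
  unfolding T_def
  by (rule bounded_borel_kernel_integral[OF assms(1) measurable_compose[OF assms(2) kernel_pow_measurable]])

lemma T_bounded_borel: "f \<in> bounded_borel E \<Longrightarrow> T k f \<in> bounded_borel E"
  using T_kernel_bounded_borel[of "\<lambda>_. f" E "\<lambda>x. x" k] bounded_borel_compose[of f E snd "E \<Otimes>\<^sub>M E"]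
  by (simp add: case_prod_beta')

lemma integrable_T: "x \<in> space E \<Longrightarrow> f \<in> bounded_borel E \<Longrightarrow> integrable (kernel_pow E P k x) f"
  using kernel_powD[of x k] by (intro finite_measure.integrable_bounded_borel)
    (auto simp: prob_space.finite_measure)

lemma T_add: "x \<in> space E \<Longrightarrow> f \<in> bounded_borel E \<Longrightarrow> g \<in> bounded_borel E \<Longrightarrow>
    T k (\<lambda>z. f z + g z) x = T k f x + T k g x"
  unfolding T_def by (intro Bochner_Integration.integral_add integrable_T)

lemma T_diff: "x \<in> space E \<Longrightarrow> f \<in> bounded_borel E \<Longrightarrow> g \<in> bounded_borel E \<Longrightarrow>
    T k (\<lambda>z. f z - g z) x = T k f x - T k g x"
  unfolding T_def by (intro Bochner_Integration.integral_diff integrable_T)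

lemma T_cmult: "T k (\<lambda>z. c * f z) x = c * T k f x"
  unfolding T_def by simp

lemma T_const: "x \<in> space E \<Longrightarrow> T k (\<lambda>_. c) x = c"
  unfolding T_def using prob_space.prob_space[OF kernel_powD(1)[of x k]] by simp

lemma T_sum: "x \<in> space E \<Longrightarrow> (\<And>i. i \<in> I \<Longrightarrow> f i \<in> bounded_borel E) \<Longrightarrow>
    T k (\<lambda>z. \<Sum>i\<in>I. f i z) x = (\<Sum>i\<in>I. T k (f i) x)"
  unfolding T_def by (intro Bochner_Integration.integral_sum integrable_T)

lemma T_mono: "x \<in> space E \<Longrightarrow> f \<in> bounded_borel E \<Longrightarrow> g \<in> bounded_borel E \<Longrightarrow>
    (\<And>z. z \<in> space E \<Longrightarrow> f z \<le> g z) \<Longrightarrow> T k f x \<le> T k g x"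
  unfolding T_def by (intro integral_mono integrable_T) (auto simp: kernel_powD)

lemma T_cong: "x \<in> space E \<Longrightarrow> (\<And>z. z \<in> space E \<Longrightarrow> f z = g z) \<Longrightarrow> T k f x = T k g x"
  unfolding T_def by (intro Bochner_Integration.integral_cong) (auto simp: kernel_powD)

lemma T_abs_le:
  assumes "x \<in> space E" "f \<in> bounded_borel E" "\<And>z. z \<in> space E \<Longrightarrow> \<bar>f z\<bar> \<le> b"
  shows "\<bar>T k f x\<bar> \<le> b"
  unfolding T_def using assms kernel_powD[OF assms(1), of k]
  by (intro prob_space.abs_integral_le_bound) (auto simp: bounded_borel_measurable intro!: AE_I2)

lemma T_square_le:
  assumes x: "x \<in> space E" and f: "f \<in> bounded_borel E"
  shows "(T k f x)\<^sup>2 \<le> T k (\<lambda>z. (f z)\<^sup>2) x"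
proof -
  let ?c = "T k f x"
  have "0 \<le> T k (\<lambda>z. (f z - ?c)\<^sup>2) x"
    unfolding T_def by (rule Bochner_Integration.integral_nonneg) simp
  also have "\<dots> = T k (\<lambda>z. (f z)\<^sup>2 + ((- 2 * ?c) * f z + ?c\<^sup>2)) x"
    by (rule T_cong[OF x]) (simp add: power2_eq_square algebra_simps)
  also have "\<dots> = T k (\<lambda>z. (f z)\<^sup>2) x + ((- 2 * ?c) * ?c + ?c\<^sup>2)"
  proof -
    have "T k (\<lambda>z. (- 2 * ?c) * f z + ?c\<^sup>2) x = (- 2 * ?c) * ?c + ?c\<^sup>2"
      using f x bounded_borel_mult[OF bounded_borel_const f, of "- 2 * ?c"]
      by (subst T_add) (simp_all only: T_cmult T_const bounded_borel_const)
    moreover have "T k (\<lambda>z. (f z)\<^sup>2 + ((- 2 * ?c) * f z + ?c\<^sup>2)) x =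
        T k (\<lambda>z. (f z)\<^sup>2) x + T k (\<lambda>z. (- 2 * ?c) * f z + ?c\<^sup>2) x"
      using f x bounded_borel_add[OF bounded_borel_mult[OF bounded_borel_const f, of "- 2 * ?c"] bounded_borel_const]
      by (intro T_add bounded_borel_power) assumption+
    ultimately show ?thesis by simp
  qed
  finally show ?thesis by (simp add: power2_eq_square)
qed

text \<open>Powers of the kernel are defined by appending a step; prepending one is the same.\<close>

lemma kernel_pow_Suc':
  assumes x: "x \<in> space E"
  shows "kernel_pow E P (Suc k) x = P x \<bind> kernel_pow E P k"
proof (induction k)
  case 0
  have "P x \<bind> return E = P x"
    using measurable_space[OF P_measurable x] by (intro bind_return'') (auto simp: space_prob_algebra)
  moreover have "kernel_pow E P 0 = return E" by (rule ext) simp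
  ultimately show ?case using kernel_pow_1[OF x] by simp
next
  case (Suc k)
  have "kernel_pow E P (Suc (Suc k)) x = (P x \<bind> kernel_pow E P k) \<bind> P"
    using Suc by simp
  also have "\<dots> = P x \<bind> (\<lambda>y. kernel_pow E P k y \<bind> P)"
  proof (rule bind_assoc[where N = E and R = E])
    show "kernel_pow E P k \<in> P x \<rightarrow>\<^sub>M subprob_algebra E"
      using measurable_prob_algebraD[OF kernel_pow_measurable, of k] measurable_space[OF P_measurable x]
      by (subst measurable_cong_sets[where M' = E and N' = "subprob_algebra E"]) (auto simp: space_prob_algebra)
    show "P \<in> E \<rightarrow>\<^sub>M subprob_algebra E" by (rule measurable_prob_algebraD[OF P_measurable])
  qed
  finally show ?case by (simp add: kernel_pow.simps(2)[abs_def])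
qed

lemma T_Suc: "x \<in> space E \<Longrightarrow> f \<in> bounded_borel E \<Longrightarrow> T (Suc k) f x = T k (T 1 f) x"
proof -
  assume x: "x \<in> space E" and f: "f \<in> bounded_borel E"
  have "T (Suc k) f x = (\<integral>y. (\<integral>z. f z \<partial>P y) \<partial>kernel_pow E P k x)"
    unfolding T_def kernel_pow.simps
    by (rule integral_kernel_bind[OF kernel_powD(1,2)[OF x] P_measurable f])
  also have "\<dots> = T k (T 1 f) x"
    unfolding T_def[of k] using x
    by (intro Bochner_Integration.integral_cong) (simp_all add: T_Suc_0 kernel_powD)
  finally show ?thesis .
qed

lemma T_Suc': "x \<in> space E \<Longrightarrow> f \<in> bounded_borel E \<Longrightarrow> T (Suc k) f x = T 1 (T k f) x"
proof -
  assume x: "x \<in> space E" and f: "f \<in> bounded_borel E"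
  have "prob_space (P x)" "sets (P x) = sets E"
    using kernel_powD[OF x, of 1] kernel_pow_1[OF x] by auto
  then have "T (Suc k) f x = (\<integral>y. (\<integral>z. f z \<partial>kernel_pow E P k y) \<partial>P x)"
    unfolding T_def kernel_pow_Suc'[OF x]
    by (intro integral_kernel_bind[OF _ _ kernel_pow_measurable f])
  also have "\<dots> = T 1 (T k f) x" using T_1[OF x] by (simp add: T_def)
  finally show ?thesis .
qed

lemma integral_\<pi>_T: "f \<in> bounded_borel E \<Longrightarrow> (\<integral>x. T k f x \<partial>\<pi>) = (\<integral>x. f x \<partial>\<pi>)"
proof (induction k arbitrary: f)
  case 0
  then show ?case by (intro Bochner_Integration.integral_cong) (auto simp: T_0)
next
  case (Suc k)
  have "(\<integral>x. T (Suc k) f x \<partial>\<pi>) = (\<integral>x. T k (T 1 f) x \<partial>\<pi>)"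
    by (intro Bochner_Integration.integral_cong refl) (simp only: T_Suc[OF _ Suc.prems] space_\<pi>)
  also have "\<dots> = (\<integral>x. T 1 f x \<partial>\<pi>)" by (rule Suc.IH[OF T_bounded_borel[OF Suc.prems]])
  also have "\<dots> = (\<integral>x. (\<integral>z. f z \<partial>P x) \<partial>\<pi>)"
    by (intro Bochner_Integration.integral_cong) (simp_all add: T_Suc_0)
  also have "\<dots> = (\<integral>x. f x \<partial>(\<pi> \<bind> P))"
    by (rule integral_kernel_bind[symmetric, OF \<pi>.prob_space_axioms sets_\<pi> P_measurable Suc.prems])
  also have "\<pi> \<bind> P = \<pi>" using invariant by (simp add: invariant_distribution_def)
  finally show ?case .
qed

section \<open>The Markov property for functions of the past and the next state\<close>

text \<open>The defining conditional expectations determine the joint law of the past and the next state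
  on rectangles; two finite measures that agree on rectangles are equal.\<close>

lemma markov_joint_law:
  assumes i: "i \<ge> 1"
  shows "distr \<Omega> (H i \<Otimes>\<^sub>M E) (\<lambda>\<omega>. (\<omega>, X (Suc i) \<omega>)) =
    restr_to_subalg \<Omega> (H i) \<bind> (\<lambda>\<omega>. distr (P (X i \<omega>)) (H i \<Otimes>\<^sub>M E) (Pair \<omega>))"
    (is "?N1 = Giry_Monad.bind ?R ?K")
proof -
  note sub = subalgebra_H[of i]
  have id: "(\<lambda>\<omega>. \<omega>) \<in> \<Omega> \<rightarrow>\<^sub>M H i"
    by (rule measurable_from_subalg[OF sub]) simp
  have pair: "(\<lambda>\<omega>. (\<omega>, X (Suc i) \<omega>)) \<in> \<Omega> \<rightarrow>\<^sub>M H i \<Otimes>\<^sub>M E"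
    using id X_measurable[of "Suc i"] by (intro measurable_Pair) auto
  interpret R: prob_space ?R by (rule prob_space_restr_to_subalg[OF sub prob_space_axioms])
  have sR: "sets ?R = sets (H i)" by (rule sets_restr_to_subalg[OF sub])
  have PX: "(\<lambda>\<omega>. P (X i \<omega>)) \<in> H i \<rightarrow>\<^sub>M prob_algebra E"
    by (rule measurable_compose[OF X_measurable_H[OF i order_refl] P_measurable])
  have "?K \<in> H i \<rightarrow>\<^sub>M prob_algebra (H i \<Otimes>\<^sub>M E)"
    using PX by (intro measurable_distr_prob_space2) auto
  then have K: "?K \<in> ?R \<rightarrow>\<^sub>M prob_algebra (H i \<Otimes>\<^sub>M E)"
    by (simp add: measurable_cong_sets[OF sR refl])
  have sN: "sets (?R \<bind> ?K) = sets (H i \<Otimes>\<^sub>M E)"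
    by (rule sets_bind[OF _ R.not_empty]) simp
  have eq: "emeasure ?N1 (A \<times> D) = emeasure (?R \<bind> ?K) (A \<times> D)"
    if A: "A \<in> sets (H i)" and D: "D \<in> sets E" for A D
  proof -
    note [measurable] = D
    have A': "A \<in> sets \<Omega>" using A sub by (auto simp: subalgebra_def)
    have XA: "(\<lambda>\<omega>. indicator D (X (Suc i) \<omega>) :: real) \<in> borel_measurable \<Omega>"
      using X_measurable[of "Suc i"] by measurable
    have int: "integrable \<Omega> (\<lambda>\<omega>. indicator A \<omega> * indicator D (X (Suc i) \<omega>) :: real)"
      using A' XA by (intro integrable_const_bound[of _ 1]) (auto split: split_indicator)
    interpret S: finite_measure_subalgebra \<Omega> "H i" by unfold_locales (rule sub)
    have mP: "(\<lambda>\<omega>. measure (P (X i \<omega>)) D) \<in> borel_measurable (H i)"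
      using measurable_compose[OF measurable_prob_algebraD[OF PX] measurable_measure_subprob_algebra[OF D]] .
    have "emeasure ?N1 (A \<times> D) = emeasure \<Omega> {\<omega> \<in> space \<Omega>. \<omega> \<in> A \<and> X (Suc i) \<omega> \<in> D}"
      using A D by (subst emeasure_distr[OF pair]) (auto intro!: arg_cong[where f = "emeasure \<Omega>"])
    also have "{\<omega> \<in> space \<Omega>. \<omega> \<in> A \<and> X (Suc i) \<omega> \<in> D} = A \<inter> (X (Suc i) -` D \<inter> space \<Omega>)"
      using sets.sets_into_space[OF A'] by auto
    also have "emeasure \<Omega> \<dots> = ennreal (\<integral>\<omega>. indicator A \<omega> * indicator D (X (Suc i) \<omega>) \<partial>\<Omega>)"
    proof -
      have m: "A \<inter> (X (Suc i) -` D \<inter> space \<Omega>) \<in> sets \<Omega>"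
        using A' measurable_sets[OF X_measurable D, of "Suc i"] by auto
      have "(\<integral>\<omega>. indicator A \<omega> * indicator D (X (Suc i) \<omega>) \<partial>\<Omega>) =
          (\<integral>\<omega>. (indicator :: 'w set \<Rightarrow> 'w \<Rightarrow> real) (A \<inter> (X (Suc i) -` D \<inter> space \<Omega>)) \<omega> \<partial>\<Omega>)"
        by (intro Bochner_Integration.integral_cong) (auto split: split_indicator)
      then show ?thesis using m by (simp add: emeasure_eq_measure)
    qed
    also have "(\<integral>\<omega>. indicator A \<omega> * indicator D (X (Suc i) \<omega>) \<partial>\<Omega>) =
        (\<integral>\<omega>. indicator A \<omega> * real_cond_exp \<Omega> (H i) (\<lambda>\<omega>. indicator D (X (Suc i) \<omega>)) \<omega> \<partial>\<Omega>)"
      using A int XA by (intro S.real_cond_exp_intg(2)[symmetric]) auto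
    also have "\<dots> = (\<integral>\<omega>. indicator A \<omega> * measure (P (X i \<omega>)) D \<partial>\<Omega>)"
    proof (rule integral_cong_AE)
      have "AE \<omega> in \<Omega>. real_cond_exp \<Omega> (H i) (\<lambda>\<omega>. indicator D (X (Suc i) \<omega>)) \<omega> = measure (P (X i \<omega>)) D"
        using chain i D by (simp add: markov_chain_def)
      then show "AE \<omega> in \<Omega>. indicator A \<omega> * real_cond_exp \<Omega> (H i) (\<lambda>\<omega>. indicator D (X (Suc i) \<omega>)) \<omega> =
          indicator A \<omega> * measure (P (X i \<omega>)) D" by eventually_elim simp
      show "(\<lambda>\<omega>. indicator A \<omega> * measure (P (X i \<omega>)) D) \<in> borel_measurable \<Omega>"
        using A' measurable_from_subalg[OF sub mP] by simp
      show "(\<lambda>\<omega>. indicator A \<omega> * real_cond_exp \<Omega> (H i) (\<lambda>\<omega>. indicator D (X (Suc i) \<omega>)) \<omega>) \<in> borel_measurable \<Omega>"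
        using A' by simp
    qed
    also have "\<dots> = (\<integral>\<omega>. indicator A \<omega> * measure (P (X i \<omega>)) D \<partial>?R)"
      using A mP by (intro integral_subalgebra2[symmetric, OF sub]) auto
    also have "ennreal \<dots> = (\<integral>\<^sup>+\<omega>. ennreal (indicator A \<omega> * measure (P (X i \<omega>)) D) \<partial>?R)"
    proof (rule nn_integral_eq_integral[symmetric])
      have "prob_space (P (X i \<omega>))" if "\<omega> \<in> space \<Omega>" for \<omega>
        using measurable_space[OF PX, of \<omega>] that by (auto simp: space_prob_algebra)
      then show "integrable ?R (\<lambda>\<omega>. indicator A \<omega> * measure (P (X i \<omega>)) D)"
        using A mP sR
        by (intro R.integrable_const_bound[of _ 1])
          (auto simp: space_restr_to_subalg measurable_cong_sets[OF sR refl] prob_space.prob_le_1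
            split: split_indicator intro!: AE_I2)
    qed simp
    also have "\<dots> = (\<integral>\<^sup>+\<omega>. emeasure (?K \<omega>) (A \<times> D) \<partial>?R)"
    proof (rule nn_integral_cong)
      fix \<omega> assume "\<omega> \<in> space ?R"
      then have \<omega>: "\<omega> \<in> space \<Omega>" by (simp add: space_restr_to_subalg)
      have p: "prob_space (P (X i \<omega>))" "sets (P (X i \<omega>)) = sets E"
        using measurable_space[OF PX, of \<omega>] \<omega> by (auto simp: space_prob_algebra)
      have "Pair \<omega> \<in> P (X i \<omega>) \<rightarrow>\<^sub>M H i \<Otimes>\<^sub>M E"
        using \<omega> by (subst measurable_cong_sets[OF p(2) refl]) simp
      then have "emeasure (?K \<omega>) (A \<times> D) = emeasure (P (X i \<omega>)) (Pair \<omega> -` (A \<times> D) \<inter> space (P (X i \<omega>)))"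
        using A D by (intro emeasure_distr) auto
      also have "Pair \<omega> -` (A \<times> D) \<inter> space (P (X i \<omega>)) = (if \<omega> \<in> A then D else {})"
        using sets.sets_into_space[OF D] sets_eq_imp_space_eq[OF p(2)] by auto
      finally show "ennreal (indicator A \<omega> * measure (P (X i \<omega>)) D) = emeasure (?K \<omega>) (A \<times> D)"
        using p by (auto simp: finite_measure.emeasure_eq_measure prob_space.finite_measure)
    qed
    also have "\<dots> = emeasure (?R \<bind> ?K) (A \<times> D)"
      using A D by (intro emeasure_bind[symmetric, OF R.not_empty measurable_prob_algebraD[OF K]]) auto
    finally show ?thesis .
  qed
  show ?thesis
  proof (rule measure_eqI_generator_eq[where \<Omega> = "space (H i) \<times> space E"
        and E = "{a \<times> b | a b. a \<in> sets (H i) \<and> b \<in> sets E}" and A = "\<lambda>_. space (H i) \<times> space E"])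
    show "Int_stable {a \<times> b | a b. a \<in> sets (H i) \<and> b \<in> sets E}"
      by (rule Int_stable_pair_measure_generator)
    show "{a \<times> b | a b. a \<in> sets (H i) \<and> b \<in> sets E} \<subseteq> Pow (space (H i) \<times> space E)"
      by (rule pair_measure_closed)
    show "sets ?N1 = sigma_sets (space (H i) \<times> space E) {a \<times> b | a b. a \<in> sets (H i) \<and> b \<in> sets E}"
      by (simp add: sets_pair_measure)
    show "sets (?R \<bind> ?K) = sigma_sets (space (H i) \<times> space E) {a \<times> b | a b. a \<in> sets (H i) \<and> b \<in> sets E}"
      unfolding sN by (simp add: sets_pair_measure)
    interpret N1: prob_space ?N1 by (rule prob_space_distr[OF pair])
    show "emeasure ?N1 (space (H i) \<times> space E) \<noteq> \<infinity>" by simp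
    show "range (\<lambda>_. space (H i) \<times> space E) \<subseteq> {a \<times> b | a b. a \<in> sets (H i) \<and> b \<in> sets E}"
      by blast
  qed (use eq in auto)
qed

lemma markov_property:
  assumes i: "i \<ge> 1" and F: "(\<lambda>(\<omega>, y). F \<omega> y) \<in> bounded_borel (H i \<Otimes>\<^sub>M E)"
  shows "(\<integral>\<omega>. F \<omega> (X (Suc i) \<omega>) \<partial>\<Omega>) = (\<integral>\<omega>. T 1 (F \<omega>) (X i \<omega>) \<partial>\<Omega>)"
proof -
  let ?K = "\<lambda>\<omega>. distr (P (X i \<omega>)) (H i \<Otimes>\<^sub>M E) (Pair \<omega>)"
  let ?R = "restr_to_subalg \<Omega> (H i)"
  let ?F = "\<lambda>(\<omega>, y). F \<omega> y"
  note sub = subalgebra_H[of i]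
  note [measurable] = bounded_borel_measurable[OF F]
  have PX: "(\<lambda>\<omega>. P (X i \<omega>)) \<in> H i \<rightarrow>\<^sub>M prob_algebra E"
    by (rule measurable_compose[OF X_measurable_H[OF i order_refl] P_measurable])
  have K: "?K \<in> H i \<rightarrow>\<^sub>M prob_algebra (H i \<Otimes>\<^sub>M E)"
    using PX by (intro measurable_distr_prob_space2) auto
  have pair: "(\<lambda>\<omega>. (\<omega>, X (Suc i) \<omega>)) \<in> \<Omega> \<rightarrow>\<^sub>M H i \<Otimes>\<^sub>M E"
    using X_measurable[of "Suc i"] measurable_from_subalg[OF sub, of "\<lambda>\<omega>. \<omega>" "H i"]
    by (intro measurable_Pair) auto
  have inner: "(\<integral>z. ?F z \<partial>?K \<omega>) = T 1 (F \<omega>) (X i \<omega>)" if \<omega>: "\<omega> \<in> space \<Omega>" for \<omega>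
  proof -
    have p: "sets (P (X i \<omega>)) = sets E"
      using measurable_space[OF PX, of \<omega>] \<omega> by (auto simp: space_prob_algebra)
    have "Pair \<omega> \<in> P (X i \<omega>) \<rightarrow>\<^sub>M H i \<Otimes>\<^sub>M E"
      using \<omega> by (subst measurable_cong_sets[OF p refl]) simp
    from integral_distr[OF this bounded_borel_measurable[OF F]]
    show ?thesis using X_in_space[OF i \<omega>] by (simp add: T_Suc_0)
  qed
  have "(\<integral>\<omega>. F \<omega> (X (Suc i) \<omega>) \<partial>\<Omega>) =
      (\<integral>z. ?F z \<partial>distr \<Omega> (H i \<Otimes>\<^sub>M E) (\<lambda>\<omega>. (\<omega>, X (Suc i) \<omega>)))"
    using integral_distr[OF pair bounded_borel_measurable[OF F]] by simp
  also have "\<dots> = (\<integral>z. ?F z \<partial>(?R \<bind> ?K))"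
    by (rule arg_cong[where f = "\<lambda>M. integral\<^sup>L M ?F", OF markov_joint_law[OF i]])
  also have "\<dots> = (\<integral>\<omega>. (\<integral>z. ?F z \<partial>?K \<omega>) \<partial>?R)"
    by (rule integral_kernel_bind[OF prob_space_restr_to_subalg[OF sub prob_space_axioms]
          sets_restr_to_subalg[OF sub] K F])
  also have "\<dots> = (\<integral>\<omega>. T 1 (F \<omega>) (X i \<omega>) \<partial>?R)"
    by (intro Bochner_Integration.integral_cong) (simp_all add: inner space_restr_to_subalg)
  also have "\<dots> = (\<integral>\<omega>. T 1 (F \<omega>) (X i \<omega>) \<partial>\<Omega>)"
    using T_kernel_bounded_borel[OF F X_measurable_H[OF i order_refl], of 1]
    by (intro integral_subalgebra2[OF sub]) (rule bounded_borel_measurable)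
  finally show ?thesis .
qed

lemma markov_steps:
  assumes i: "i \<ge> 1" and W: "W \<in> bounded_borel (H i)" and f: "f \<in> bounded_borel E"
  shows "(\<integral>\<omega>. W \<omega> * f (X (i + k) \<omega>) \<partial>\<Omega>) = (\<integral>\<omega>. W \<omega> * T k f (X i \<omega>) \<partial>\<Omega>)"
  using f
proof (induction k arbitrary: f)
  case 0
  then show ?case using i by (intro Bochner_Integration.integral_cong) (auto simp: T_0 X_in_space)
next
  case (Suc k)
  have "W \<in> bounded_borel (H (i + k))" by (rule bounded_borel_H_mono[OF _ W]) simp
  then have F: "(\<lambda>(\<omega>, y). W \<omega> * f y) \<in> bounded_borel (H (i + k) \<Otimes>\<^sub>M E)"
    using Suc.prems unfolding case_prod_beta
    by (intro bounded_borel_mult bounded_borel_compose[of W "H (i + k)" fst]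
        bounded_borel_compose[of f E snd]) auto
  have "(\<integral>\<omega>. W \<omega> * f (X (i + Suc k) \<omega>) \<partial>\<Omega>) = (\<integral>\<omega>. W \<omega> * T 1 f (X (i + k) \<omega>) \<partial>\<Omega>)"
    using markov_property[OF _ F] i by (simp add: T_cmult)
  also have "\<dots> = (\<integral>\<omega>. W \<omega> * T k (T 1 f) (X i \<omega>) \<partial>\<Omega>)"
    by (rule Suc.IH[OF T_bounded_borel[OF Suc.prems]])
  also have "\<dots> = (\<integral>\<omega>. W \<omega> * T (Suc k) f (X i \<omega>) \<partial>\<Omega>)"
    by (intro Bochner_Integration.integral_cong refl)
      (simp only: T_Suc[OF X_in_space[OF i] Suc.prems])
  finally show ?case .
qed

lemma integral_X:
  assumes i: "i \<ge> 1" and f: "f \<in> bounded_borel E"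
  shows "(\<integral>\<omega>. f (X i \<omega>) \<partial>\<Omega>) = (\<integral>x. f x \<partial>\<pi>)"
proof -
  have "(\<integral>\<omega>. f (X i \<omega>) \<partial>\<Omega>) = (\<integral>\<omega>. T (i - 1) f (X 1 \<omega>) \<partial>\<Omega>)"
  proof -
    have "1 + (i - 1) = i" using i by linarith
    with markov_steps[OF order_refl bounded_borel_const[of 1] f, of "i - 1"] show ?thesis
      by (simp only: mult_1)
  qed
  also have "\<dots> = (\<integral>x. T (i - 1) f x \<partial>distr \<Omega> E (X 1))"
    by (rule integral_distr[symmetric, OF X_measurable[OF order_refl]
          bounded_borel_measurable[OF T_bounded_borel[OF f]]])
  also have "\<dots> = (\<integral>x. f x \<partial>\<pi>)" unfolding stationary by (rule integral_\<pi>_T[OF f])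
  finally show ?thesis .
qed

lemma distr_X:
  assumes i: "i \<ge> 1" shows "distr \<Omega> E (X i) = \<pi>"
proof (rule measure_eqI)
  fix D assume "D \<in> sets (distr \<Omega> E (X i))"
  then have D: "D \<in> sets E" by simp
  have "measure (distr \<Omega> E (X i)) D = (\<integral>x. indicator D x \<partial>distr \<Omega> E (X i))"
    using D by simp
  also have "\<dots> = (\<integral>\<omega>. indicator D (X i \<omega>) \<partial>\<Omega>)"
    using D X_measurable[OF i] by (intro integral_distr) auto
  also have "\<dots> = (\<integral>x. indicator D x \<partial>\<pi>)"
    using D by (intro integral_X[OF i] bounded_borelI[of _ _ 1]) auto
  also have "\<dots> = measure \<pi> D"
    using D by simp
  finally show "emeasure (distr \<Omega> E (X i)) D = emeasure \<pi> D"
    using finite_measure.emeasure_eq_measure[OF finite_measure_distr[OF X_measurable[OF i]]]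
    by (simp add: \<pi>.emeasure_eq_measure)
qed simp

lemma AE_X:
  assumes i: "i \<ge> 1" and Q: "AE x in \<pi>. Q x" shows "AE \<omega> in \<Omega>. Q (X i \<omega>)"
  by (rule AE_distrD[OF X_measurable[OF i]]) (simp only: distr_X[OF i] Q)

end

section \<open>Contraction in mean square and Bernstein's inequality\<close>

lemma exp_le_quadratic: "(x::real) \<le> 1 \<Longrightarrow> exp x \<le> 1 + x + x\<^sup>2"
proof (cases "x \<ge> 0")
  case True
  then show "x \<le> 1 \<Longrightarrow> exp x \<le> 1 + x + x\<^sup>2" using exp_bound[of x] by simp
next
  case False
  have "1 \<le> (1 - x) * (1 + x + x\<^sup>2)" 
    using False by (simp add: algebra_simps power2_eq_square mult_nonneg_nonpos2)
  also have "\<dots> \<le> exp (- x) * (1 + x + x\<^sup>2)"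
  proof (rule mult_right_mono)
    show "1 - x \<le> exp (- x)" using exp_ge_add_one_self[of "- x"] by simp
    have "0 \<le> (1 + x / 2)\<^sup>2 + 3 / 4 * x\<^sup>2" by simp
    then show "0 \<le> 1 + x + x\<^sup>2" by (simp add: power2_eq_square field_simps)
  qed
  finally show "exp x \<le> 1 + x + x\<^sup>2" by (simp add: exp_minus field_simps)
qed

lemma abs_exp_minus_one_le: "\<bar>x::real\<bar> \<le> 1 \<Longrightarrow> \<bar>exp x - 1\<bar> \<le> 2 * \<bar>x\<bar>"
proof -
  assume x: "\<bar>x\<bar> \<le> 1"
  have "exp x \<le> 1 + x + x\<^sup>2" using x by (intro exp_le_quadratic) simp
  moreover have "x\<^sup>2 \<le> \<bar>x\<bar>" using mult_left_mono[OF x, of "\<bar>x\<bar>"] by (simp add: power2_eq_square abs_mult_self_eq)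
  moreover have "1 + x \<le> exp x" by simp
  ultimately show ?thesis by linarith
qed

text \<open>A minorization constant may always be decreased; \<open>\<delta> < 1\<close> lets one divide by the mass \<open>1 - \<delta>\<close> of what
  the minorization leaves of the kernel.\<close>

locale doeblin_chain = stationary_chain \<Omega> E P X \<pi>
  for \<Omega> :: "'w measure" and E :: "'a measure" and P X \<pi> +
  fixes \<mu> :: "'a measure" and \<delta> :: real and m :: nat
  assumes \<mu>: "prob_measure_on E \<mu>" and \<delta>: "0 < \<delta>" "\<delta> < 1" and m: "m \<ge> 1"
    and minorization: "\<And>x D. x \<in> space E \<Longrightarrow> D \<in> sets E \<Longrightarrow>
      \<delta> * measure \<mu> D \<le> measure (kernel_pow E P m x) D"
begin

sublocale \<mu>: prob_space \<mu>
  using \<mu> by (simp add: prob_measure_on_def)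

lemma sets_\<mu>: "sets \<mu> = sets E"
  using \<mu> by (simp add: prob_measure_on_def)

lemma integrable_\<pi>: "f \<in> bounded_borel E \<Longrightarrow> integrable \<pi> f"
  by (rule \<pi>.integrable_bounded_borel) simp

lemma prob_\<pi>_space [simp]: "measure \<pi> (space E) = 1"
  using \<pi>.prob_space by simp

lemma integrable_\<mu>: "f \<in> bounded_borel E \<Longrightarrow> integrable \<mu> f"
  by (rule \<mu>.integrable_bounded_borel) (simp add: bounded_borel_cong_sets[OF sets_\<mu>])

text \<open>\<open>\<Lambda>\<close> is what remains of \<open>m\<close> steps of the chain after removing the part that forgets the starting point;
  it is a positive functional of mass \<open>1 - \<delta>\<close>.\<close>

definition \<Lambda> :: "('a \<Rightarrow> real) \<Rightarrow> 'a \<Rightarrow> real" where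
  "\<Lambda> f x = T m f x - \<delta> * (\<integral>z. f z \<partial>\<mu>)"

lemma \<Lambda>_nonneg:
  assumes x: "x \<in> space E" and f: "f \<in> bounded_borel E" and nn: "\<And>z. z \<in> space E \<Longrightarrow> f z \<ge> 0"
  shows "\<Lambda> f x \<ge> 0"
proof -
  have "(\<integral>z. f z \<partial>\<mu>) \<le> 1 / \<delta> * (\<integral>z. f z \<partial>kernel_pow E P m x)"
  proof (rule integral_le_of_measure_le)
    show "finite_measure (kernel_pow E P m x)" using kernel_powD[OF x] by (simp add: prob_space.finite_measure)
    fix D assume "D \<in> sets (kernel_pow E P m x)"
    then show "measure \<mu> D \<le> 1 / \<delta> * measure (kernel_pow E P m x) D"
      using minorization[OF x, of D] \<delta> kernel_powD[OF x] by (simp add: field_simps)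
  qed (use kernel_powD[OF x] sets_\<mu> f nn \<delta> \<mu>.finite_measure_axioms in simp_all)
  then show ?thesis using \<delta> unfolding \<Lambda>_def T_def by (simp add: field_simps)
qed

text \<open>The Cauchy-Schwarz inequality of \<open>f\<close> with the constant 1, from the positivity of \<open>\<Lambda>\<close> on \<open>(f - c)\<^sup>2\<close> with the
  best \<open>c\<close>.\<close>

lemma \<Lambda>_square_le:
  assumes x: "x \<in> space E" and f: "f \<in> bounded_borel E"
  shows "(\<Lambda> f x)\<^sup>2 \<le> (1 - \<delta>) * \<Lambda> (\<lambda>z. (f z)\<^sup>2) x"
proof -
  define c where "c = \<Lambda> f x / (1 - \<delta>)"
  note f2 = bounded_borel_power[OF f, of 2]
  note fc = bounded_borel_mult[OF bounded_borel_const f, of "2 * c"]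
  have e: "(\<lambda>z. (f z - c)\<^sup>2) = (\<lambda>z. ((f z)\<^sup>2 - (2 * c) * f z) + c\<^sup>2)"
    by (rule ext) (simp add: power2_eq_square algebra_simps)
  have "0 \<le> \<Lambda> (\<lambda>z. (f z - c)\<^sup>2) x"
    by (intro \<Lambda>_nonneg[OF x] bounded_borel_intros f) simp
  also have "\<dots> = \<Lambda> (\<lambda>z. (f z)\<^sup>2) x - 2 * c * \<Lambda> f x + c\<^sup>2 * (1 - \<delta>)"
  proof -
    have "T m (\<lambda>z. (f z - c)\<^sup>2) x = T m (\<lambda>z. (f z)\<^sup>2) x - (2 * c) * T m f x + c\<^sup>2"
      unfolding e by (simp only: T_add[OF x bounded_borel_diff[OF f2 fc] bounded_borel_const]
          T_diff[OF x f2 fc] T_cmult T_const[OF x])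
    moreover have "(\<integral>z. (f z - c)\<^sup>2 \<partial>\<mu>) = (\<integral>z. (f z)\<^sup>2 \<partial>\<mu>) - (2 * c) * (\<integral>z. f z \<partial>\<mu>) + c\<^sup>2"
      unfolding e using integrable_\<mu>[OF f] integrable_\<mu>[OF f2] by (simp add: \<mu>.prob_space)
    ultimately have "\<Lambda> (\<lambda>z. (f z - c)\<^sup>2) x = (T m (\<lambda>z. (f z)\<^sup>2) x - (2 * c) * T m f x + c\<^sup>2) -
        \<delta> * ((\<integral>z. (f z)\<^sup>2 \<partial>\<mu>) - (2 * c) * (\<integral>z. f z \<partial>\<mu>) + c\<^sup>2)"
      unfolding \<Lambda>_def by (simp only:)
    then show ?thesis unfolding \<Lambda>_def by (simp only: algebra_simps)
  qed
  also have "\<dots> = \<Lambda> (\<lambda>z. (f z)\<^sup>2) x - (\<Lambda> f x)\<^sup>2 / (1 - \<delta>)"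
  proof -
    have "c * (1 - \<delta>) = \<Lambda> f x" unfolding c_def using \<delta> by simp
    moreover have "(\<Lambda> f x)\<^sup>2 / (1 - \<delta>) = c * \<Lambda> f x"
      unfolding c_def by (simp add: power2_eq_square)
    ultimately show ?thesis by (simp add: power2_eq_square mult.assoc)
  qed
  finally show ?thesis using \<delta> by (simp add: field_simps)
qed

text \<open>Subtracting the constant \<open>\<delta> \<mu>(f)\<close> from \<open>T m f\<close> can only increase its mean square when \<open>f\<close>, and hence
  \<open>T m f\<close>, is centred; what is left is \<open>\<Lambda> f\<close>, and the Cauchy-Schwarz inequality for \<open>\<Lambda>\<close> gains its mass.\<close>

lemma mean_square_contraction:
  assumes f: "f \<in> bounded_borel E" and centred: "(\<integral>x. f x \<partial>\<pi>) = 0"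
  shows "(\<integral>x. (T m f x)\<^sup>2 \<partial>\<pi>) \<le> (1 - \<delta>) * (\<integral>x. (f x)\<^sup>2 \<partial>\<pi>)"
proof -
  define d where "d = \<delta> * (\<integral>z. f z \<partial>\<mu>)"
  define e where "e = \<delta> * (\<integral>z. (f z)\<^sup>2 \<partial>\<mu>)"
  note f2 = bounded_borel_power[OF f, of 2]
  note Tf = T_bounded_borel[OF f, of m] and Tf2 = T_bounded_borel[OF f2, of m]
  note int = integrable_\<pi>[OF Tf] integrable_\<pi>[OF Tf2] integrable_\<pi>[OF bounded_borel_power[OF Tf, of 2]]
  have c0: "(\<integral>x. T m f x \<partial>\<pi>) = 0" using integral_\<pi>_T[OF f] centred by simp
  have e0: "e \<ge> 0" unfolding e_def using \<delta> by (intro mult_nonneg_nonneg Bochner_Integration.integral_nonneg) auto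
  have "(\<integral>x. (T m f x)\<^sup>2 \<partial>\<pi>) \<le> (\<integral>x. (T m f x)\<^sup>2 - (2 * d) * T m f x + d\<^sup>2 \<partial>\<pi>)"
    using int c0 by (simp add: \<pi>.prob_space)
  also have "\<dots> \<le> (\<integral>x. (1 - \<delta>) * (T m (\<lambda>z. (f z)\<^sup>2) x - e) \<partial>\<pi>)"
  proof (rule integral_mono)
    fix x assume "x \<in> space \<pi>"
    then have x: "x \<in> space E" by simp
    have "(T m f x)\<^sup>2 - (2 * d) * T m f x + d\<^sup>2 = (\<Lambda> f x)\<^sup>2"
      unfolding \<Lambda>_def d_def by (simp add: power2_eq_square algebra_simps)
    then show "(T m f x)\<^sup>2 - (2 * d) * T m f x + d\<^sup>2 \<le> (1 - \<delta>) * (T m (\<lambda>z. (f z)\<^sup>2) x - e)"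
      using \<Lambda>_square_le[OF x f] unfolding \<Lambda>_def e_def by simp
  qed (use int in simp_all)
  also have "\<dots> = (1 - \<delta>) * ((\<integral>x. (f x)\<^sup>2 \<partial>\<pi>) - e)"
    using int integral_\<pi>_T[OF f2] by (simp add: \<pi>.prob_space)
  also have "\<dots> \<le> (1 - \<delta>) * (\<integral>x. (f x)\<^sup>2 \<partial>\<pi>)"
    using e0 \<delta> by (intro mult_left_mono) auto
  finally show ?thesis .
qed

text \<open>The growth rate of the exponential functional per unit of variance.\<close>

definition K :: real where "K = 4 + 32 / \<delta>"

lemma K_pos: "K > 0"
  unfolding K_def using \<delta> by (simp add: add_pos_nonneg)

text \<open>One step of the exponential functional.  Split \<open>T m F\<close> into its mean \<open>a\<close> and a centred part \<open>w\<close>: in the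
  square of \<open>exp g \<sqdot> (a + w)\<close> the term of first order in \<open>g\<close> without \<open>w\<close> vanishes on average, so the mean part grows only by
  a factor \<open>1 + O(\<pi>(g\<^sup>2))\<close>, while the contraction of \<open>w\<close> leaves a margin \<open>\<delta>\<close> that absorbs the factor \<open>exp (2 g)\<close>
  and the cross terms, split by \<open>2 a b \<le> a\<^sup>2 / \<eta> + \<eta> b\<^sup>2\<close> with \<open>\<eta> = \<delta> / 2\<close>.\<close>

lemma exp_step:
  assumes F: "F \<in> bounded_borel E" and g: "g \<in> bounded_borel E"
    and small: "\<And>x. x \<in> space E \<Longrightarrow> \<bar>g x\<bar> \<le> \<delta> / 8" and centred: "(\<integral>x. g x \<partial>\<pi>) = 0"
  shows "(\<integral>x. (exp (g x) * T m F x)\<^sup>2 \<partial>\<pi>) \<le> (1 + K * (\<integral>x. (g x)\<^sup>2 \<partial>\<pi>)) * (\<integral>x. (F x)\<^sup>2 \<partial>\<pi>)"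
proof -
  define a where "a = (\<integral>x. F x \<partial>\<pi>)"
  define w where "w = (\<lambda>x. T m F x - a)"
  define s where "s = (\<integral>x. (g x)\<^sup>2 \<partial>\<pi>)"
  have w: "w \<in> bounded_borel E" unfolding w_def by (intro bounded_borel_diff T_bounded_borel F bounded_borel_const)
  have w0: "(\<integral>x. w x \<partial>\<pi>) = 0"
    unfolding w_def using integrable_\<pi>[OF T_bounded_borel[OF F]] integral_\<pi>_T[OF F]
    by (simp add: a_def \<pi>.prob_space)
  note int = integrable_\<pi>[OF w] integrable_\<pi>[OF g] integrable_\<pi>[OF bounded_borel_power[OF w, of 2]]
    integrable_\<pi>[OF bounded_borel_power[OF g, of 2]] integrable_\<pi>[OF F]
    integrable_\<pi>[OF bounded_borel_power[OF F, of 2]]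
  have Fa: "(\<lambda>x. F x - a) \<in> bounded_borel E" by (intro bounded_borel_intros F)
  have ww: "(\<integral>x. (w x)\<^sup>2 \<partial>\<pi>) \<le> (1 - \<delta>) * ((\<integral>x. (F x)\<^sup>2 \<partial>\<pi>) - a\<^sup>2)"
  proof -
    have "(\<integral>x. (T m (\<lambda>x. F x - a) x)\<^sup>2 \<partial>\<pi>) \<le> (1 - \<delta>) * (\<integral>x. (F x - a)\<^sup>2 \<partial>\<pi>)"
      using int by (intro mean_square_contraction[OF Fa]) (simp add: a_def \<pi>.prob_space)
    moreover have "(\<integral>x. (T m (\<lambda>x. F x - a) x)\<^sup>2 \<partial>\<pi>) = (\<integral>x. (w x)\<^sup>2 \<partial>\<pi>)"
      unfolding w_def using F
      by (intro Bochner_Integration.integral_cong refl) (simp add: T_diff T_const)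
    moreover have "(\<integral>x. (F x - a)\<^sup>2 \<partial>\<pi>) = (\<integral>x. (F x)\<^sup>2 - (2 * a) * F x + a\<^sup>2 \<partial>\<pi>)"
      by (intro Bochner_Integration.integral_cong refl) (simp add: power2_eq_square algebra_simps)
    moreover have "\<dots> = (\<integral>x. (F x)\<^sup>2 \<partial>\<pi>) - a\<^sup>2"
      using int by (simp add: \<pi>.prob_space a_def[symmetric] power2_eq_square)
    ultimately show ?thesis by simp
  qed
  have a2: "a\<^sup>2 \<le> (\<integral>x. (F x)\<^sup>2 \<partial>\<pi>)"
  proof -
    have "0 \<le> (\<integral>x. (w x)\<^sup>2 \<partial>\<pi>)" by simp
    then have "0 \<le> (1 - \<delta>) * ((\<integral>x. (F x)\<^sup>2 \<partial>\<pi>) - a\<^sup>2)" using ww by linarith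
    then show ?thesis using \<delta> by (simp add: zero_le_mult_iff)
  qed
  have pointwise: "(exp (g x) * T m F x)\<^sup>2 \<le>
      a\<^sup>2 + (2 * a\<^sup>2) * g x + (K * a\<^sup>2) * (g x)\<^sup>2 + (2 * a) * w x + (1 + \<delta>) * (w x)\<^sup>2"
    if x: "x \<in> space E" for x
  proof -
    define h where "h = 2 * g x"
    have h: "\<bar>h\<bar> \<le> \<delta> / 4" "\<bar>h\<bar> \<le> 1" using small[OF x] \<delta> by (auto simp: h_def)
    have e1: "exp h \<le> 1 + h + h\<^sup>2" using h by (intro exp_le_quadratic) simp
    have e2: "\<bar>exp h - 1\<bar> \<le> 2 * \<bar>h\<bar>" using h by (intro abs_exp_minus_one_le)
    have e3: "(exp h - 1)\<^sup>2 \<le> 4 * h\<^sup>2"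
      using power_mono[OF e2, of 2] by (simp add: power_mult_distrib)
    have "(exp (g x) * T m F x)\<^sup>2 = exp h * (a + w x)\<^sup>2"
      unfolding h_def w_def by (simp add: power_mult_distrib exp_double)
    also have "\<dots> = a\<^sup>2 * exp h + (2 * a) * w x + 2 * (a * (exp h - 1)) * w x + exp h * (w x)\<^sup>2"
      by (simp add: power2_eq_square algebra_simps)
    also have "2 * (a * (exp h - 1)) * w x \<le> (2 / \<delta>) * (a * (exp h - 1))\<^sup>2 + (\<delta> / 2) * (w x)\<^sup>2"
    proof -
      have "0 \<le> (2 / \<delta>) * (a * (exp h - 1) - (\<delta> / 2) * w x)\<^sup>2" using \<delta> by simp
      also have "\<dots> = (2 / \<delta>) * (a * (exp h - 1))\<^sup>2 + (\<delta> / 2) * (w x)\<^sup>2 - 2 * (a * (exp h - 1)) * w x"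
        using \<delta> by (simp add: power2_eq_square field_simps)
      finally show ?thesis by simp
    qed
    also have "(2 / \<delta>) * (a * (exp h - 1))\<^sup>2 \<le> (2 / \<delta>) * (a\<^sup>2 * (4 * h\<^sup>2))"
      using \<delta> e3 unfolding power_mult_distrib by (intro mult_left_mono) auto
    also have "a\<^sup>2 * exp h \<le> a\<^sup>2 * (1 + h + h\<^sup>2)" using e1 by (intro mult_left_mono) auto
    also have "exp h * (w x)\<^sup>2 \<le> (1 + \<delta> / 2) * (w x)\<^sup>2"
      using e2 h by (intro mult_right_mono) auto
    finally have "(exp (g x) * T m F x)\<^sup>2 \<le> a\<^sup>2 * (1 + h + h\<^sup>2) + 2 * a * w x +
        (2 / \<delta> * (a\<^sup>2 * (4 * h\<^sup>2)) + \<delta> / 2 * (w x)\<^sup>2) + (1 + \<delta> / 2) * (w x)\<^sup>2" by simp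
    also have "\<dots> = a\<^sup>2 + (2 * a\<^sup>2) * g x + (K * a\<^sup>2) * (g x)\<^sup>2 + (2 * a) * w x + (1 + \<delta>) * (w x)\<^sup>2"
      unfolding h_def K_def using \<delta> by (simp add: power2_eq_square field_simps)
    finally show ?thesis .
  qed
  have TF: "(\<lambda>x. (exp (g x) * T m F x)\<^sup>2) \<in> bounded_borel E"
    by (intro bounded_borel_power bounded_borel_mult bounded_borel_exp T_bounded_borel F g)
  have "(\<integral>x. (exp (g x) * T m F x)\<^sup>2 \<partial>\<pi>) \<le>
      (\<integral>x. a\<^sup>2 + (2 * a\<^sup>2) * g x + (K * a\<^sup>2) * (g x)\<^sup>2 + (2 * a) * w x + (1 + \<delta>) * (w x)\<^sup>2 \<partial>\<pi>)"
    by (rule integral_mono) (use int integrable_\<pi>[OF TF] pointwise in simp_all)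
  also have "\<dots> = a\<^sup>2 + K * a\<^sup>2 * s + (1 + \<delta>) * (\<integral>x. (w x)\<^sup>2 \<partial>\<pi>)"
    using int centred w0 by (simp add: \<pi>.prob_space s_def)
  also have "\<dots> \<le> a\<^sup>2 + K * a\<^sup>2 * s + (1 + \<delta>) * ((1 - \<delta>) * ((\<integral>x. (F x)\<^sup>2 \<partial>\<pi>) - a\<^sup>2))"
    using ww \<delta> by (intro add_left_mono mult_left_mono) auto
  also have "(1 + \<delta>) * ((1 - \<delta>) * ((\<integral>x. (F x)\<^sup>2 \<partial>\<pi>) - a\<^sup>2)) \<le> 1 * ((\<integral>x. (F x)\<^sup>2 \<partial>\<pi>) - a\<^sup>2)"
    unfolding mult.assoc[symmetric] using a2 \<delta> by (intro mult_right_mono) (auto simp: algebra_simps)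
  also have "a\<^sup>2 + K * a\<^sup>2 * s + 1 * ((\<integral>x. (F x)\<^sup>2 \<partial>\<pi>) - a\<^sup>2) = (K * s) * a\<^sup>2 + (\<integral>x. (F x)\<^sup>2 \<partial>\<pi>)"
    by simp
  also have "(K * s) * a\<^sup>2 \<le> (K * s) * (\<integral>x. (F x)\<^sup>2 \<partial>\<pi>)"
    using a2 K_pos by (intro mult_left_mono) (auto simp: s_def)
  finally show ?thesis by (simp add: s_def algebra_simps)
qed

text \<open>The exponential functional of the chain observed at times \<open>i, i + m, i + 2 m, \<dots>\<close>, computed backwards.\<close>

primrec exp_functional :: "(nat \<Rightarrow> 'a \<Rightarrow> real) \<Rightarrow> nat \<Rightarrow> nat \<Rightarrow> 'a \<Rightarrow> real" where
  "exp_functional g 0 i = (\<lambda>_. 1)"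
| "exp_functional g (Suc d) i = (\<lambda>x. exp (g i x) * T m (exp_functional g d (i + m)) x)"

lemma exp_functional_bounded_borel:
  assumes g: "\<And>i. g i \<in> bounded_borel E"
  shows "exp_functional g d i \<in> bounded_borel E"
proof (induction d arbitrary: i)
  case 0
  show ?case by simp
next
  case (Suc d)
  show ?case
    unfolding exp_functional.simps by (intro bounded_borel_intros T_bounded_borel g Suc)
qed

lemma exp_functional_mean_square:
  assumes g: "\<And>i. g i \<in> bounded_borel E" "\<And>i x. x \<in> space E \<Longrightarrow> \<bar>g i x\<bar> \<le> \<delta> / 8"
    "\<And>i. (\<integral>x. g i x \<partial>\<pi>) = 0"
  shows "(\<integral>x. (exp_functional g d i x)\<^sup>2 \<partial>\<pi>) \<le> exp (K * (\<Sum>l<d. \<integral>x. (g (i + l * m) x)\<^sup>2 \<partial>\<pi>))"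
proof (induction d arbitrary: i)
  case 0
  show ?case by (simp add: \<pi>.prob_space)
next
  case (Suc d)
  let ?s = "\<integral>x. (g i x)\<^sup>2 \<partial>\<pi>"
  have "(\<integral>x. (exp_functional g (Suc d) i x)\<^sup>2 \<partial>\<pi>) \<le>
      (1 + K * ?s) * (\<integral>x. (exp_functional g d (i + m) x)\<^sup>2 \<partial>\<pi>)"
    unfolding exp_functional.simps
    by (rule exp_step[OF exp_functional_bounded_borel[OF g(1)] g(1) g(2) g(3)])
  also have "\<dots> \<le> exp (K * ?s) * exp (K * (\<Sum>l<d. \<integral>x. (g (i + m + l * m) x)\<^sup>2 \<partial>\<pi>))"
    using Suc[of "i + m"] by (intro mult_mono) auto
  also have "\<dots> = exp (K * (\<Sum>l<Suc d. \<integral>x. (g (i + l * m) x)\<^sup>2 \<partial>\<pi>))"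
    by (simp add: exp_add[symmetric] distrib_left[symmetric] sum.lessThan_Suc_shift add.assoc del: sum.lessThan_Suc)
  finally show ?case .
qed

lemma exp_functional_eq:
  assumes i: "i \<ge> 1" and W: "W \<in> bounded_borel (H i)" and g: "\<And>i. g i \<in> bounded_borel E"
  shows "(\<integral>\<omega>. W \<omega> * exp (\<Sum>l<d. g (i + l * m) (X (i + l * m) \<omega>)) \<partial>\<Omega>) =
    (\<integral>\<omega>. W \<omega> * exp_functional g d i (X i \<omega>) \<partial>\<Omega>)"
  using i W
proof (induction d arbitrary: i W)
  case 0
  show ?case by simp
next
  case (Suc d)
  let ?W = "\<lambda>\<omega>. W \<omega> * exp (g i (X i \<omega>))"
  have W: "?W \<in> bounded_borel (H i)"
    by (intro bounded_borel_intros Suc.prems(2) bounded_borel_X[OF Suc.prems(1) order_refl g])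
  then have W': "?W \<in> bounded_borel (H (i + m))" by (rule bounded_borel_H_mono[rotated]) simp
  have "(\<integral>\<omega>. W \<omega> * exp (\<Sum>l<Suc d. g (i + l * m) (X (i + l * m) \<omega>)) \<partial>\<Omega>) =
      (\<integral>\<omega>. ?W \<omega> * exp (\<Sum>l<d. g (i + m + l * m) (X (i + m + l * m) \<omega>)) \<partial>\<Omega>)"
    by (intro Bochner_Integration.integral_cong refl)
      (simp add: sum.lessThan_Suc_shift exp_add add.assoc del: sum.lessThan_Suc)
  also have "\<dots> = (\<integral>\<omega>. ?W \<omega> * exp_functional g d (i + m) (X (i + m) \<omega>) \<partial>\<Omega>)"
    by (rule Suc.IH[OF _ W']) (use Suc.prems(1) in simp)
  also have "\<dots> = (\<integral>\<omega>. ?W \<omega> * T m (exp_functional g d (i + m)) (X i \<omega>) \<partial>\<Omega>)"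
    by (rule markov_steps[OF Suc.prems(1) W exp_functional_bounded_borel[OF g]])
  finally show ?case by (simp add: mult.assoc)
qed

text \<open>The mean of the functional is at most the root of its mean square.  The bound is nevertheless
  stated without the resulting factor 1/2 in the exponent, which is nonnegative.\<close>

lemma bernstein_progression:
  assumes g: "\<And>i. g i \<in> bounded_borel E" "\<And>i x. x \<in> space E \<Longrightarrow> \<bar>g i x\<bar> \<le> \<delta> / 8"
    "\<And>i. (\<integral>x. g i x \<partial>\<pi>) = 0" and i: "i \<ge> 1"
  shows "(\<integral>\<omega>. exp (\<Sum>l<d. g (i + l * m) (X (i + l * m) \<omega>)) \<partial>\<Omega>) \<le>
    exp (K * (\<Sum>l<d. \<integral>x. (g (i + l * m) x)\<^sup>2 \<partial>\<pi>))" (is "?L \<le> exp ?R")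
proof -
  let ?F = "exp_functional g d i"
  have F: "?F \<in> bounded_borel E" by (rule exp_functional_bounded_borel[OF g(1)])
  have R: "?R \<ge> 0" using K_pos by (intro mult_nonneg_nonneg sum_nonneg) auto
  have L: "?L = (\<integral>x. ?F x \<partial>\<pi>)"
    using exp_functional_eq[OF i bounded_borel_const[of 1], of g d] integral_X[OF i F] g(1) by simp
  have "0 \<le> (\<integral>x. (?F x - ?L)\<^sup>2 \<partial>\<pi>)" by simp
  also have "\<dots> = (\<integral>x. (?F x)\<^sup>2 - (2 * ?L) * ?F x + ?L\<^sup>2 \<partial>\<pi>)"
    by (intro Bochner_Integration.integral_cong refl) (simp add: power2_eq_square algebra_simps)
  also have "\<dots> = (\<integral>x. (?F x)\<^sup>2 \<partial>\<pi>) - ?L\<^sup>2"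
    using integrable_\<pi>[OF F] integrable_\<pi>[OF bounded_borel_power[OF F, of 2]]
    by (simp add: L[symmetric] power2_eq_square)
  also have "\<dots> \<le> exp ?R - ?L\<^sup>2"
    using exp_functional_mean_square[OF g, where d = d and i = i] by simp
  also have "\<dots> \<le> (exp ?R)\<^sup>2 - ?L\<^sup>2"
    using R by (simp add: power2_eq_square)
  finally have "?L\<^sup>2 \<le> (exp ?R)\<^sup>2" by linarith
  then show ?thesis by (rule power2_le_imp_le) simp
qed

text \<open>Bernstein's inequality without a logarithmic loss: the times are split into \<open>m\<close> arithmetic progressions of
  step \<open>m\<close>, and the exponential of an average is at most the average of the exponentials.\<close>

lemma bernstein:
  assumes g: "\<And>i. i \<in> {1..N} \<Longrightarrow> g i \<in> bounded_borel E"
    "\<And>i x. i \<in> {1..N} \<Longrightarrow> x \<in> space E \<Longrightarrow> \<bar>g i x\<bar> \<le> \<delta> / (8 * m)"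
    "\<And>i. i \<in> {1..N} \<Longrightarrow> (\<integral>x. g i x \<partial>\<pi>) = 0"
  shows "(\<integral>\<omega>. exp (\<Sum>i=1..N. g i (X i \<omega>)) \<partial>\<Omega>) \<le> exp (K * m\<^sup>2 * (\<Sum>i=1..N. \<integral>x. (g i x)\<^sup>2 \<partial>\<pi>))"
proof -
  define f where "f = (\<lambda>i x. if i \<in> {1..N} then real m * g i x else 0)"
  have f1: "f i \<in> bounded_borel E" for i
    unfolding f_def
    by (cases "i \<in> {1..N}")
      (simp_all only: if_True if_False bounded_borel_const bounded_borel_mult[OF bounded_borel_const g(1)])
  have f2: "\<bar>f i x\<bar> \<le> \<delta> / 8" if "x \<in> space E" for i x
  proof (cases "i \<in> {1..N}")
    case True
    have "\<bar>f i x\<bar> = real m * \<bar>g i x\<bar>" using True by (simp add: f_def abs_mult)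
    also have "\<dots> \<le> real m * (\<delta> / (8 * m))" using g(2)[OF True that] by (rule mult_left_mono) simp
    finally show ?thesis using m by simp
  next
    case False
    then have "f i x = 0" unfolding f_def by (simp only: if_False)
    then show ?thesis using \<delta> by simp
  qed
  have f3: "(\<integral>x. f i x \<partial>\<pi>) = 0" for i
    unfolding f_def by (cases "i \<in> {1..N}") (simp_all only: if_True if_False integral_mult_right_zero
        Bochner_Integration.integral_zero g(3) mult_zero_right)
  have regroup: "(\<Sum>i=1..N. \<phi> i) = (\<Sum>c<m. \<Sum>l<N. \<phi> (1 + c + l * m))"
    if "\<And>i. i > N \<Longrightarrow> \<phi> i = 0" for \<phi> :: "nat \<Rightarrow> real"
  proof -
    have "(\<Sum>c<m. \<Sum>l<N. \<phi> (1 + c + l * m)) = (\<Sum>l<N. \<Sum>c<m. \<phi> (1 + c + l * m))"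
      by (rule sum.swap)
    also have "\<dots> = (\<Sum>l<N. sum (\<lambda>i. \<phi> (1 + i)) {l * m..<l * m + m})"
    proof (rule sum.cong[OF refl])
      fix l
      show "(\<Sum>c<m. \<phi> (1 + c + l * m)) = (\<Sum>i=l * m..<l * m + m. \<phi> (1 + i))"
        by (rule sum.reindex_bij_witness[of _ "\<lambda>j. j - l * m" "\<lambda>c. c + l * m"]) (auto simp: add_ac)
    qed
    also have "\<dots> = (\<Sum>i<N * m. \<phi> (1 + i))" by (rule sum.nat_group)
    also have "\<dots> = (\<Sum>i<N. \<phi> (1 + i))"
      using m that by (intro sum.mono_neutral_right) auto
    also have "\<dots> = (\<Sum>i=1..N. \<phi> i)"
      by (rule sum.reindex_bij_witness[of _ "\<lambda>i. i - 1" Suc]) auto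
    finally show ?thesis by simp
  qed
  let ?S = "\<lambda>c \<omega>. \<Sum>l<N. f (1 + c + l * m) (X (1 + c + l * m) \<omega>)"
  let ?R = "\<Sum>i=1..N. \<integral>x. (f i x)\<^sup>2 \<partial>\<pi>"
  have S: "?S c \<in> bounded_borel \<Omega>" for c
    by (intro bounded_borel_sum bounded_borel_H[OF bounded_borel_X[OF _ order_refl f1]]) simp
  have int: "integrable \<Omega> (\<lambda>\<omega>. exp (?S c \<omega>))" for c
    by (rule integrable_bounded_borel[OF bounded_borel_exp[OF S]])
  have Rc: "(\<Sum>l<N. \<integral>x. (f (1 + c + l * m) x)\<^sup>2 \<partial>\<pi>) \<le> ?R" if "c < m" for c
  proof -
    have "(\<Sum>l<N. \<integral>x. (f (1 + c + l * m) x)\<^sup>2 \<partial>\<pi>) \<le> (\<Sum>c<m. \<Sum>l<N. \<integral>x. (f (1 + c + l * m) x)\<^sup>2 \<partial>\<pi>)"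
      using that by (intro member_le_sum[of c "{..<m}" "\<lambda>c. \<Sum>l<N. \<integral>x. (f (1 + c + l * m) x)\<^sup>2 \<partial>\<pi>"]) (auto intro!: sum_nonneg)
    also have "\<dots> = ?R" by (rule regroup[symmetric]) (simp add: f_def)
    finally show ?thesis .
  qed
  have "(\<integral>\<omega>. exp (\<Sum>i=1..N. g i (X i \<omega>)) \<partial>\<Omega>) \<le> (\<integral>\<omega>. (\<Sum>c<m. (1 / m) * exp (?S c \<omega>)) \<partial>\<Omega>)"
  proof (rule integral_mono)
    fix \<omega> assume \<omega>: "\<omega> \<in> space \<Omega>"
    have "real m * (\<Sum>i=1..N. g i (X i \<omega>)) = (\<Sum>i=1..N. f i (X i \<omega>))"
      unfolding sum_distrib_left f_def by (intro sum.cong) auto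
    also have "\<dots> = (\<Sum>c<m. ?S c \<omega>)" by (rule regroup) (simp add: f_def)
    finally have scaled: "real m * (\<Sum>i=1..N. g i (X i \<omega>)) = (\<Sum>c<m. ?S c \<omega>)" .
    have "a = (1 / m) * (real m * a)" for a using m by simp
    then have "(\<Sum>i=1..N. g i (X i \<omega>)) = (1 / m) * (real m * (\<Sum>i=1..N. g i (X i \<omega>)))" .
    then have average: "(\<Sum>i=1..N. g i (X i \<omega>)) = (\<Sum>c<m. (1 / m) *\<^sub>R ?S c \<omega>)"
      unfolding scaled by (simp only: real_scaleR_def sum_distrib_left)
    have "exp (\<Sum>c<m. (1 / m) *\<^sub>R ?S c \<omega>) \<le> (\<Sum>c<m. (1 / m) * exp (?S c \<omega>))"
    proof (rule convex_on_sum[OF _ _ exp_convex])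
      show "{..<m} \<noteq> {}" using m by (simp add: lessThan_empty_iff)
      show "(\<Sum>c<m. 1 / real m) = 1" using m by simp
    qed simp_all
    then show "exp (\<Sum>i=1..N. g i (X i \<omega>)) \<le> (\<Sum>c<m. (1 / m) * exp (?S c \<omega>))"
      by (simp only: average)
  next
    show "integrable \<Omega> (\<lambda>\<omega>. exp (\<Sum>i=1..N. g i (X i \<omega>)))"
    proof (intro integrable_bounded_borel bounded_borel_exp bounded_borel_sum)
      fix i assume i: "i \<in> {1..N}"
      then have "1 \<le> i" by simp
      then show "(\<lambda>\<omega>. g i (X i \<omega>)) \<in> bounded_borel \<Omega>"
        by (rule bounded_borel_H[OF bounded_borel_X[OF _ order_refl g(1)[OF i]]])
    qed
    show "integrable \<Omega> (\<lambda>\<omega>. \<Sum>c<m. (1 / m) * exp (?S c \<omega>))"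
      by (intro Bochner_Integration.integrable_sum integrable_mult_right int)
  qed
  also have "\<dots> = (\<Sum>c<m. (1 / m) * (\<integral>\<omega>. exp (?S c \<omega>) \<partial>\<Omega>))"
    by (simp only: Bochner_Integration.integral_sum[OF integrable_mult_right[OF int]] integral_mult_right_zero)
  also have "\<dots> \<le> (\<Sum>c<m. (1 / m) * exp (K * ?R))"
  proof (intro sum_mono mult_left_mono)
    fix c assume c: "c \<in> {..<m}"
    have "(\<integral>\<omega>. exp (?S c \<omega>) \<partial>\<Omega>) \<le> exp (K * (\<Sum>l<N. \<integral>x. (f (1 + c + l * m) x)\<^sup>2 \<partial>\<pi>))"
      by (rule bernstein_progression[OF f1 f2 f3]) simp_all
    also have "\<dots> \<le> exp (K * ?R)" using Rc c K_pos by simp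
    finally show "(\<integral>\<omega>. exp (?S c \<omega>) \<partial>\<Omega>) \<le> exp (K * ?R)" .
  qed simp
  also have "\<dots> = exp (K * ?R)" using m by simp
  also have "?R = m\<^sup>2 * (\<Sum>i=1..N. \<integral>x. (g i x)\<^sup>2 \<partial>\<pi>)"
    unfolding sum_distrib_left f_def by (intro sum.cong refl) (simp add: power_mult_distrib)
  finally show ?thesis by (simp add: mult.assoc)
qed

end

section \<open>A self-normalized martingale inequality\<close>

lemma exp_minus_half_square_le: "exp (x - x\<^sup>2 / 2) \<le> 1 + x + x\<^sup>2 / 2" for x :: real
proof -
  define f where "f = (\<lambda>x::real. (1 + x + x\<^sup>2 / 2) * exp (x\<^sup>2 / 2 - x))"
  have deriv: "(f has_real_derivative exp (y\<^sup>2 / 2 - y) * (y * (((y + 1 / 2)\<^sup>2 + 7 / 4) / 2))) (at y)" for y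
  proof -
    have "(f has_real_derivative (1 + y) * exp (y\<^sup>2 / 2 - y) + (1 + y + y\<^sup>2 / 2) * (exp (y\<^sup>2 / 2 - y) * (y - 1))) (at y)"
      unfolding f_def by (auto intro!: derivative_eq_intros)
    also have "(1 + y) * exp (y\<^sup>2 / 2 - y) + (1 + y + y\<^sup>2 / 2) * (exp (y\<^sup>2 / 2 - y) * (y - 1)) =
        exp (y\<^sup>2 / 2 - y) * ((1 + y) + (1 + y + y\<^sup>2 / 2) * (y - 1))"
    proof -
      have "(1 + y) * e + q * (e * (y - 1)) = e * ((1 + y) + q * (y - 1))" for e q :: real
        by (simp add: algebra_simps)
      then show ?thesis .
    qed
    also have "(1 + y) + (1 + y + y\<^sup>2 / 2) * (y - 1) = y * (((y + 1 / 2)\<^sup>2 + 7 / 4) / 2)"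
      by (simp add: power2_eq_square field_simps)
    finally show ?thesis .
  qed
  have pos: "((y + 1 / 2)\<^sup>2 + 7 / 4) / 2 \<ge> 0" for y :: real by simp
  have "1 \<le> f x"
  proof (cases "x \<ge> 0")
    case True
    have "f 0 \<le> f x"
    proof (rule DERIV_nonneg_imp_nondecreasing[OF True])
      fix y :: real assume "0 \<le> y" "y \<le> x"
      then show "\<exists>d. (f has_real_derivative d) (at y) \<and> 0 \<le> d"
        by (intro exI[of _ "exp (y\<^sup>2 / 2 - y) * (y * (((y + 1 / 2)\<^sup>2 + 7 / 4) / 2))"] conjI deriv
            mult_nonneg_nonneg pos) simp_all
    qed
    then show ?thesis by (simp add: f_def)
  next
    case False
    then have "x \<le> 0" by simp
    then have "f 0 \<le> f x"
    proof (rule DERIV_nonpos_imp_nonincreasing)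
      fix y :: real assume "x \<le> y" "y \<le> 0"
      then show "\<exists>d. (f has_real_derivative d) (at y) \<and> d \<le> 0"
        by (intro exI[of _ "exp (y\<^sup>2 / 2 - y) * (y * (((y + 1 / 2)\<^sup>2 + 7 / 4) / 2))"] conjI deriv
            mult_nonneg_nonpos mult_nonpos_nonneg pos) simp_all
    qed
    then show ?thesis by (simp add: f_def)
  qed
  then have "exp (x - x\<^sup>2 / 2) * 1 \<le> exp (x - x\<^sup>2 / 2) * f x" by (intro mult_left_mono) auto
  also have "\<dots> = 1 + x + x\<^sup>2 / 2"
  proof -
    have "exp (x - x\<^sup>2 / 2) * exp (x\<^sup>2 / 2 - x) = 1" by (simp add: exp_add[symmetric])
    then show ?thesis unfolding f_def by (simp add: mult.left_commute)
  qed
  finally show ?thesis by simp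
qed

text \<open>\<open>exp_sqrt\<close> turns exponential moments of \<open>s\<close> into a convex functional of \<open>s\<^sup>2\<close>; the 2 keeps the square root
  above 1, where \<open>exp r / r\<close> is increasing.\<close>

definition exp_sqrt :: "real \<Rightarrow> real" where "exp_sqrt x = exp (sqrt (2 + x))"

lemma exp_sqrt_convex: "convex_on {-1<..} exp_sqrt"
proof (rule convex_on_realI)
  fix x :: real assume "x \<in> {-1<..}"
  then have x: "0 < 2 + x" by simp
  have "((\<lambda>x. exp (sqrt (2 + x))) has_real_derivative exp (sqrt (2 + x)) * (inverse (sqrt (2 + x)) / 2 * (0 + 1))) (at x)"
    by (rule DERIV_chain'[OF DERIV_chain'[OF DERIV_add[OF DERIV_const DERIV_ident] DERIV_real_sqrt[OF x]] DERIV_exp])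
  then show "(exp_sqrt has_real_derivative exp (sqrt (2 + x)) / sqrt (2 + x) / 2) (at x)"
    unfolding exp_sqrt_def[abs_def] by (simp only: divide_inverse mult.assoc add_0 mult_1_right)
next
  fix x y :: real assume xy: "x \<in> {-1<..}" "y \<in> {-1<..}" "x \<le> y"
  define r where "r = sqrt (2 + x)"
  define s where "s = sqrt (2 + y)"
  have r: "1 \<le> r" "r \<le> s" using xy by (auto simp: r_def s_def)
  have "s \<le> r * (1 + (s - r))"
    using mult_mono[of 1 r 0 "s - r"] mult_right_mono[of 1 r "s - r"] r by (simp add: algebra_simps)
  also have "\<dots> \<le> r * exp (s - r)" using r by (intro mult_left_mono) auto
  finally have "s * exp r \<le> r * (exp (s - r) * exp r)" by (simp add: mult.assoc[symmetric])
  then have "s * exp r \<le> r * exp s" by (simp add: exp_add[symmetric])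
  then show "exp (sqrt (2 + x)) / sqrt (2 + x) / 2 \<le> exp (sqrt (2 + y)) / sqrt (2 + y) / 2"
    using r unfolding r_def[symmetric] s_def[symmetric] by (simp add: field_simps)
qed simp

lemma exp_sqrt_square_le: "exp_sqrt (x\<^sup>2) \<le> exp 2 * (exp x + exp (- x))"
proof -
  have "sqrt (2 + x\<^sup>2) \<le> 2 + \<bar>x\<bar>"
  proof (rule real_le_lsqrt)
    have "(2 + \<bar>x\<bar>)\<^sup>2 = 4 + 4 * \<bar>x\<bar> + x\<^sup>2" by (simp add: power2_sum)
    then show "2 + x\<^sup>2 \<le> (2 + \<bar>x\<bar>)\<^sup>2" by simp
  qed simp
  then have "exp_sqrt (x\<^sup>2) \<le> exp (2 + \<bar>x\<bar>)" unfolding exp_sqrt_def by simp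
  also have "\<dots> = exp 2 * exp \<bar>x\<bar>" by (rule exp_add)
  also have "\<dots> \<le> exp 2 * (exp x + exp (- x))" by (intro mult_left_mono) (auto simp: abs_if)
  finally show ?thesis .
qed

lemma bounded_borel_exp_sqrt: "f \<in> bounded_borel M \<Longrightarrow> (\<lambda>x. exp_sqrt (f x)) \<in> bounded_borel M"
  unfolding exp_sqrt_def by (intro bounded_borel_intros)

context stationary_chain
begin

text \<open>Here \<open>s \<omega>\<close> is a function of the state whose coefficients depend on the past up to time \<open>i\<close>: its value at
  the next state minus the prediction of that value is a martingale increment.\<close>

definition increment :: "('w \<Rightarrow> 'a \<Rightarrow> real) \<Rightarrow> nat \<Rightarrow> 'w \<Rightarrow> real" where
  "increment s i \<omega> = s \<omega> (X (Suc i) \<omega>) - T 1 (s \<omega>) (X i \<omega>)"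

definition predicted_square :: "('w \<Rightarrow> 'a \<Rightarrow> real) \<Rightarrow> nat \<Rightarrow> 'w \<Rightarrow> real" where
  "predicted_square s i \<omega> = T 1 (\<lambda>y. (s \<omega> y)\<^sup>2) (X i \<omega>)"

lemma history_next_bounded_borel:
  assumes i: "i \<ge> 1" and s: "(\<lambda>(\<omega>, y). s \<omega> y) \<in> bounded_borel (H i \<Otimes>\<^sub>M E)"
  shows "(\<lambda>\<omega>. s \<omega> (X (Suc i) \<omega>)) \<in> bounded_borel (H (Suc i))"
proof -
  have "(\<lambda>\<omega>. \<omega>) \<in> H (Suc i) \<rightarrow>\<^sub>M H i"
    using sets_H_mono[of i "Suc i"]
    by (intro measurable_from_subalg[of "H (Suc i)" "H i"]) (simp_all add: subalgebra_def)
  then have "(\<lambda>\<omega>. (\<omega>, X (Suc i) \<omega>)) \<in> H (Suc i) \<rightarrow>\<^sub>M H i \<Otimes>\<^sub>M E"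
    by (rule measurable_Pair) (rule X_measurable_H, simp_all)
  from bounded_borel_compose[OF s this] show ?thesis by simp
qed

lemma history_T_bounded_borel:
  assumes i: "i \<ge> 1" and s: "(\<lambda>(\<omega>, y). s \<omega> y) \<in> bounded_borel (H i \<Otimes>\<^sub>M E)"
  shows "(\<lambda>\<omega>. T k (s \<omega>) (X i \<omega>)) \<in> bounded_borel (H i)"
  by (rule T_kernel_bounded_borel[OF s X_measurable_H[OF i order_refl]])

lemma history_square_bounded_borel:
  "(\<lambda>(\<omega>, y). s \<omega> y) \<in> bounded_borel M \<Longrightarrow> (\<lambda>(\<omega>, y). (s \<omega> y)\<^sup>2) \<in> bounded_borel M"
  unfolding case_prod_beta by (rule bounded_borel_power)

lemma increment_bounded_borel:
  assumes i: "i \<ge> 1" and s: "(\<lambda>(\<omega>, y). s \<omega> y) \<in> bounded_borel (H i \<Otimes>\<^sub>M E)"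
  shows "increment s i \<in> bounded_borel (H (Suc i))"
  unfolding increment_def[abs_def]
  by (intro bounded_borel_diff history_next_bounded_borel[OF i s]
      bounded_borel_H_mono[OF _ history_T_bounded_borel[OF i s]]) simp

lemma predicted_square_bounded_borel:
  assumes i: "i \<ge> 1" and s: "(\<lambda>(\<omega>, y). s \<omega> y) \<in> bounded_borel (H i \<Otimes>\<^sub>M E)"
  shows "predicted_square s i \<in> bounded_borel (H i)"
  unfolding predicted_square_def[abs_def]
  by (rule history_T_bounded_borel[OF i history_square_bounded_borel[OF s]])

lemma predicted_square_nonneg: "predicted_square s i \<omega> \<ge> 0"
  unfolding predicted_square_def T_def by (rule Bochner_Integration.integral_nonneg) simp

text \<open>Compensating by both the square of the increment and its conditional expectation gives a
  supermartingale without any bound on the increments: \<open>exp (c - c\<^sup>2 / 2) \<le> 1 + c + c\<^sup>2 / 2\<close> and \<open>c\<close> is centred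
  given the past.\<close>

lemma exponential_supermartingale:
  assumes s: "\<And>i. i \<ge> 1 \<Longrightarrow> (\<lambda>(\<omega>, y). s i \<omega> y) \<in> bounded_borel (H i \<Otimes>\<^sub>M E)"
  shows "(\<integral>\<omega>. exp (\<Sum>i=1..<n. increment (s i) i \<omega> - (increment (s i) i \<omega>)\<^sup>2 / 2
      - predicted_square (s i) i \<omega> / 2) \<partial>\<Omega>) \<le> 1"
proof (induction n)
  case 0
  show ?case by (simp add: prob_space)
next
  case (Suc n)
  let ?Z = "\<lambda>i \<omega>. increment (s i) i \<omega> - (increment (s i) i \<omega>)\<^sup>2 / 2 - predicted_square (s i) i \<omega> / 2"
  define W where "W = (\<lambda>\<omega>. exp (\<Sum>i=1..<n. ?Z i \<omega>))"
  show ?case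
  proof (cases "n = 0")
    case True
    then show ?thesis by (simp add: prob_space)
  next
    case False
    then have n: "n \<ge> 1" by simp
    have W: "W \<in> bounded_borel (H n)"
      unfolding W_def
    proof (intro bounded_borel_exp bounded_borel_sum)
      fix i assume "i \<in> {1..<n}"
      then have i: "i \<ge> 1" "i \<le> n" "Suc i \<le> n" by auto
      show "?Z i \<in> bounded_borel (H n)"
        by (intro bounded_borel_intros bounded_borel_H_mono[OF i(3) increment_bounded_borel[OF i(1) s[OF i(1)]]]
            bounded_borel_H_mono[OF i(2) predicted_square_bounded_borel[OF i(1) s[OF i(1)]]])
    qed
    let ?s = "s n"
    define t where "t = (\<lambda>\<omega>. T 1 (?s \<omega>) (X n \<omega>))"
    define b where "b = predicted_square ?s n"
    have t: "t \<in> bounded_borel (H n)"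
      unfolding t_def by (rule history_T_bounded_borel[OF n s[OF n]])
    have b: "b \<in> bounded_borel (H n)"
      unfolding b_def by (rule predicted_square_bounded_borel[OF n s[OF n]])
    define F where "F = (\<lambda>\<omega> y. W \<omega> * exp ((?s \<omega> y - t \<omega>) - (?s \<omega> y - t \<omega>)\<^sup>2 / 2 - b \<omega> / 2))"
    have F: "(\<lambda>(\<omega>, y). F \<omega> y) \<in> bounded_borel (H n \<Otimes>\<^sub>M E)"
    proof -
      have last: "(\<lambda>z. ?s (fst z) (snd z)) \<in> bounded_borel (H n \<Otimes>\<^sub>M E)"
        using s[OF n] by (simp only: case_prod_beta')
      have past: "(\<lambda>z. f (fst z)) \<in> bounded_borel (H n \<Otimes>\<^sub>M E)" if "f \<in> bounded_borel (H n)" for f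
        by (rule bounded_borel_compose[OF that measurable_fst])
      show ?thesis
        unfolding F_def case_prod_beta'
        by (intro bounded_borel_intros last past[OF W] past[OF t] past[OF b])
    qed
    have "(\<integral>\<omega>. exp (\<Sum>i=1..<Suc n. ?Z i \<omega>) \<partial>\<Omega>) = (\<integral>\<omega>. F \<omega> (X (Suc n) \<omega>) \<partial>\<Omega>)"
      using n unfolding F_def W_def t_def b_def increment_def exp_add[symmetric]
      by (intro Bochner_Integration.integral_cong refl) simp
    also have "\<dots> = (\<integral>\<omega>. T 1 (F \<omega>) (X n \<omega>) \<partial>\<Omega>)"
      by (rule markov_property[OF n F])
    also have "\<dots> \<le> (\<integral>\<omega>. W \<omega> \<partial>\<Omega>)"
    proof (rule integral_mono)
      show "integrable \<Omega> W" by (rule integrable_bounded_borel[OF bounded_borel_H[OF W]])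
      show "integrable \<Omega> (\<lambda>\<omega>. T 1 (F \<omega>) (X n \<omega>))"
        by (rule integrable_bounded_borel[OF bounded_borel_H[OF history_T_bounded_borel[OF n F]]])
      fix \<omega> assume \<omega>: "\<omega> \<in> space \<Omega>"
      have x: "X n \<omega> \<in> space E" by (rule X_in_space[OF n \<omega>])
      have \<omega>H: "\<omega> \<in> space (H n)" using \<omega> by simp
      have s\<omega>: "?s \<omega> \<in> bounded_borel E" by (rule bounded_borel_section[OF s[OF n] \<omega>H])
      have c: "(\<lambda>y. ?s \<omega> y - t \<omega>) \<in> bounded_borel E" by (intro bounded_borel_intros s\<omega>)
      have c0: "T 1 (\<lambda>y. ?s \<omega> y - t \<omega>) (X n \<omega>) = 0"
        using x by (subst T_diff[OF x s\<omega> bounded_borel_const]) (simp only: T_const t_def diff_self)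
      have c2: "T 1 (\<lambda>y. (?s \<omega> y - t \<omega>)\<^sup>2) (X n \<omega>) \<le> b \<omega>"
      proof -
        have "(\<lambda>y. (?s \<omega> y - t \<omega>)\<^sup>2) = (\<lambda>y. (?s \<omega> y)\<^sup>2 - ((2 * t \<omega>) * ?s \<omega> y - (t \<omega>)\<^sup>2))"
          by (rule ext) (simp add: power2_eq_square algebra_simps)
        then have "T 1 (\<lambda>y. (?s \<omega> y - t \<omega>)\<^sup>2) (X n \<omega>) =
            T 1 (\<lambda>y. (?s \<omega> y)\<^sup>2 - ((2 * t \<omega>) * ?s \<omega> y - (t \<omega>)\<^sup>2)) (X n \<omega>)" by simp
        also have "\<dots> = T 1 (\<lambda>y. (?s \<omega> y)\<^sup>2) (X n \<omega>) - T 1 (\<lambda>y. (2 * t \<omega>) * ?s \<omega> y - (t \<omega>)\<^sup>2) (X n \<omega>)"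
          by (intro T_diff x bounded_borel_intros s\<omega>)
        also have "T 1 (\<lambda>y. (2 * t \<omega>) * ?s \<omega> y - (t \<omega>)\<^sup>2) (X n \<omega>) =
            T 1 (\<lambda>y. (2 * t \<omega>) * ?s \<omega> y) (X n \<omega>) - T 1 (\<lambda>y. (t \<omega>)\<^sup>2) (X n \<omega>)"
          by (intro T_diff x bounded_borel_intros s\<omega>)
        also have "\<dots> = (t \<omega>)\<^sup>2"
          unfolding T_cmult T_const[OF x] by (simp add: t_def power2_eq_square)
        finally show ?thesis unfolding b_def predicted_square_def by simp
      qed
      have b0: "b \<omega> \<ge> 0" unfolding b_def by (rule predicted_square_nonneg)
      have W0: "W \<omega> \<ge> 0" unfolding W_def by simp
      have "T 1 (F \<omega>) (X n \<omega>) \<le>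
          T 1 (\<lambda>y. (W \<omega> * exp (- (b \<omega> / 2))) * (1 + (?s \<omega> y - t \<omega>) + (?s \<omega> y - t \<omega>)\<^sup>2 / 2)) (X n \<omega>)"
      proof (rule T_mono[OF x bounded_borel_section[OF F \<omega>H]])
        show "(\<lambda>y. (W \<omega> * exp (- (b \<omega> / 2))) * (1 + (?s \<omega> y - t \<omega>) + (?s \<omega> y - t \<omega>)\<^sup>2 / 2)) \<in> bounded_borel E"
          by (intro bounded_borel_intros s\<omega>)
        fix y
        let ?c = "?s \<omega> y - t \<omega>"
        have "F \<omega> y = (W \<omega> * exp (- (b \<omega> / 2))) * exp (?c - ?c\<^sup>2 / 2)"
          unfolding F_def mult.assoc exp_add[symmetric] by simp
        also have "\<dots> \<le> (W \<omega> * exp (- (b \<omega> / 2))) * (1 + ?c + ?c\<^sup>2 / 2)"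
          using W0 by (intro mult_left_mono exp_minus_half_square_le) simp
        finally show "F \<omega> y \<le> (W \<omega> * exp (- (b \<omega> / 2))) * (1 + ?c + ?c\<^sup>2 / 2)" .
      qed
      also have "\<dots> = (W \<omega> * exp (- (b \<omega> / 2))) * (1 + T 1 (\<lambda>y. (?s \<omega> y - t \<omega>)\<^sup>2) (X n \<omega>) / 2)"
      proof -
        have "T 1 (\<lambda>y. (1 + (?s \<omega> y - t \<omega>)) + (?s \<omega> y - t \<omega>)\<^sup>2 / 2) (X n \<omega>) =
            T 1 (\<lambda>y. 1 + (?s \<omega> y - t \<omega>)) (X n \<omega>) + T 1 (\<lambda>y. (?s \<omega> y - t \<omega>)\<^sup>2 / 2) (X n \<omega>)"
          by (intro T_add x bounded_borel_intros s\<omega>)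
        also have "T 1 (\<lambda>y. 1 + (?s \<omega> y - t \<omega>)) (X n \<omega>) = T 1 (\<lambda>y. 1) (X n \<omega>) + T 1 (\<lambda>y. ?s \<omega> y - t \<omega>) (X n \<omega>)"
          by (intro T_add x bounded_borel_intros s\<omega>)
        also have "T 1 (\<lambda>y. (?s \<omega> y - t \<omega>)\<^sup>2 / 2) (X n \<omega>) = T 1 (\<lambda>y. (?s \<omega> y - t \<omega>)\<^sup>2) (X n \<omega>) / 2"
          using T_cmult[of 1 "1 / 2" "\<lambda>y. (?s \<omega> y - t \<omega>)\<^sup>2" "X n \<omega>"] by simp
        finally have "T 1 (\<lambda>y. (1 + (?s \<omega> y - t \<omega>)) + (?s \<omega> y - t \<omega>)\<^sup>2 / 2) (X n \<omega>) =
            1 + T 1 (\<lambda>y. (?s \<omega> y - t \<omega>)\<^sup>2) (X n \<omega>) / 2"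
          unfolding c0 T_const[OF x] by simp
        then show ?thesis by (simp only: T_cmult)
      qed
      also have "\<dots> \<le> (W \<omega> * exp (- (b \<omega> / 2))) * exp (b \<omega> / 2)"
      proof (rule mult_left_mono)
        have "1 + T 1 (\<lambda>y. (?s \<omega> y - t \<omega>)\<^sup>2) (X n \<omega>) / 2 \<le> 1 + b \<omega> / 2" using c2 by simp
        also have "\<dots> \<le> exp (b \<omega> / 2)" by simp
        finally show "1 + T 1 (\<lambda>y. (?s \<omega> y - t \<omega>)\<^sup>2) (X n \<omega>) / 2 \<le> exp (b \<omega> / 2)" .
      qed (use W0 in simp)
      also have "\<dots> = W \<omega>" by (simp add: mult.assoc exp_add[symmetric])
      finally show "T 1 (F \<omega>) (X n \<omega>) \<le> W \<omega>" .
    qed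
    also have "\<dots> \<le> 1" using Suc unfolding W_def .
    finally show ?thesis .
  qed
qed

lemma increment_square_le:
  assumes i: "i \<ge> 1" and s: "(\<lambda>(\<omega>, y). s \<omega> y) \<in> bounded_borel (H i \<Otimes>\<^sub>M E)" and \<omega>: "\<omega> \<in> space \<Omega>"
  shows "(increment s i \<omega>)\<^sup>2 \<le> 2 * (s \<omega> (X (Suc i) \<omega>))\<^sup>2 + 2 * predicted_square s i \<omega>"
proof -
  have "s \<omega> \<in> bounded_borel E" by (rule bounded_borel_section[OF s]) (simp add: \<omega>)
  then have "(T 1 (s \<omega>) (X i \<omega>))\<^sup>2 \<le> predicted_square s i \<omega>"
    unfolding predicted_square_def by (rule T_square_le[OF X_in_space[OF i \<omega>]])
  moreover have "(a - c)\<^sup>2 \<le> 2 * a\<^sup>2 + 2 * c\<^sup>2" for a c :: real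
    using zero_le_power2[of "a + c"] by (simp add: power2_eq_square algebra_simps)
  ultimately show ?thesis unfolding increment_def by (smt (verit))
qed

lemma exp_sqrt_predicted_square_le:
  assumes i: "i \<ge> 1" and s: "(\<lambda>(\<omega>, y). s \<omega> y) \<in> bounded_borel (H i \<Otimes>\<^sub>M E)" and \<omega>: "\<omega> \<in> space \<Omega>"
  shows "exp_sqrt (predicted_square s i \<omega>) \<le> T 1 (\<lambda>y. exp_sqrt ((s \<omega> y)\<^sup>2)) (X i \<omega>)"
proof -
  have s\<omega>: "s \<omega> \<in> bounded_borel E" by (rule bounded_borel_section[OF s]) (simp add: \<omega>)
  have x: "X i \<omega> \<in> space E" by (rule X_in_space[OF i \<omega>])
  interpret P: prob_space "kernel_pow E P 1 (X i \<omega>)" by (rule kernel_powD(1)[OF x])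
  show ?thesis
    unfolding predicted_square_def T_def
  proof (rule P.jensens_inequality[OF integrable_T[OF x] _ _ integrable_T[OF x] exp_sqrt_convex])
    show "(\<lambda>y. (s \<omega> y)\<^sup>2) \<in> bounded_borel E" by (rule bounded_borel_power[OF s\<omega>])
    then show "(\<lambda>y. exp_sqrt ((s \<omega> y)\<^sup>2)) \<in> bounded_borel E" by (rule bounded_borel_exp_sqrt)
    have "-1 < c\<^sup>2" for c :: real by (rule less_le_trans[of _ 0]) simp_all
    then show "AE y in kernel_pow E P 1 (X i \<omega>). (s \<omega> y)\<^sup>2 \<in> {-1<..}" by simp
    show "{-1<..} = {-1<..<0} \<or> {-1<..} = {-1::real<..} \<or> {-1<..} = {..<0} \<or> {-1<..} = UNIV"
      by (rule disjI2, rule disjI1, rule refl)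
  qed
qed

text \<open>Convexity of \<open>exp_sqrt\<close> lets the average over time be controlled by the worst single time, with no union bound.\<close>

lemma exp_sqrt_quadratic_variation:
  assumes s: "\<And>i. i \<ge> 1 \<Longrightarrow> (\<lambda>(\<omega>, y). s i \<omega> y) \<in> bounded_borel (H i \<Otimes>\<^sub>M E)" and n: "n \<ge> 2"
    and M: "\<And>i. i \<in> {1..<n} \<Longrightarrow> (\<integral>\<omega>. exp_sqrt ((s i \<omega> (X (Suc i) \<omega>))\<^sup>2) \<partial>\<Omega>) \<le> M"
  shows "(\<integral>\<omega>. exp_sqrt ((\<Sum>i=1..<n. (increment (s i) i \<omega>)\<^sup>2 + predicted_square (s i) i \<omega>) / (5 * (n - 1))) \<partial>\<Omega>) \<le> M"
proof -
  define a where "a = (\<lambda>i \<omega>. (s i \<omega> (X (Suc i) \<omega>))\<^sup>2)"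
  define b where "b = (\<lambda>i. predicted_square (s i) i)"
  define N where "N = real (n - 1)"
  have N: "N > 0" using n by (simp add: N_def)
  define w where "w = 1 / N"
  have w: "w > 0" "(\<Sum>i=1..<n. w) = 1" using N n by (auto simp: w_def N_def)
  have a: "a i \<in> bounded_borel \<Omega>" if "i \<ge> 1" for i
    unfolding a_def by (intro bounded_borel_power bounded_borel_H[OF history_next_bounded_borel[OF that s[OF that]]])
  have b: "b i \<in> bounded_borel \<Omega>" if "i \<ge> 1" for i
    unfolding b_def by (intro bounded_borel_H[OF predicted_square_bounded_borel[OF that s[OF that]]])
  have d: "increment (s i) i \<in> bounded_borel \<Omega>" if "i \<ge> 1" for i
    by (rule bounded_borel_H[OF increment_bounded_borel[OF that s[OF that]]])
  have a0: "a i \<omega> \<ge> 0" and b0: "b i \<omega> \<ge> 0" for i \<omega>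
    unfolding a_def b_def by (simp_all add: predicted_square_nonneg)
  have next_square: "(\<integral>\<omega>. exp_sqrt (b i \<omega>) \<partial>\<Omega>) \<le> (\<integral>\<omega>. exp_sqrt (a i \<omega>) \<partial>\<Omega>)" if i: "i \<ge> 1" for i
  proof -
    have F: "(\<lambda>(\<omega>, y). exp_sqrt ((s i \<omega> y)\<^sup>2)) \<in> bounded_borel (H i \<Otimes>\<^sub>M E)"
      using s[OF i] unfolding case_prod_beta' by (intro bounded_borel_exp_sqrt bounded_borel_power)
    have "(\<integral>\<omega>. exp_sqrt (b i \<omega>) \<partial>\<Omega>) \<le> (\<integral>\<omega>. T 1 (\<lambda>y. exp_sqrt ((s i \<omega> y)\<^sup>2)) (X i \<omega>) \<partial>\<Omega>)"
      unfolding b_def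
      by (intro integral_mono exp_sqrt_predicted_square_le[OF i s[OF i]]
          integrable_bounded_borel[OF bounded_borel_H[OF history_T_bounded_borel[OF i F]]]
          integrable_bounded_borel[OF bounded_borel_exp_sqrt[OF b[OF i, unfolded b_def]]])
    also have "\<dots> = (\<integral>\<omega>. exp_sqrt (a i \<omega>) \<partial>\<Omega>)"
      unfolding a_def by (rule markov_property[OF i F, symmetric])
    finally show ?thesis .
  qed
  let ?Q = "\<lambda>\<omega>. (\<Sum>i=1..<n. (increment (s i) i \<omega>)\<^sup>2 + b i \<omega>) / (5 * N)"
  have Q: "?Q \<in> bounded_borel \<Omega>"
    by (intro bounded_borel_intros d b) simp_all
  have "(\<integral>\<omega>. exp_sqrt (?Q \<omega>) \<partial>\<Omega>) \<le> (\<integral>\<omega>. (\<Sum>i=1..<n. w * (2 / 5 * exp_sqrt (a i \<omega>) + 3 / 5 * exp_sqrt (b i \<omega>))) \<partial>\<Omega>)"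
  proof (rule integral_mono)
    fix \<omega> assume \<omega>: "\<omega> \<in> space \<Omega>"
    \<comment> \<open>The increments satisfy \<open>D\<^sup>2 \<le> 2 a + 2 b\<close>, so that \<open>D\<^sup>2 + b\<close> is 5 times a convex combination.\<close>
    let ?c = "\<lambda>i. (1 - 3 / 5) *\<^sub>R a i \<omega> + (3 / 5) *\<^sub>R b i \<omega>"
    have "?Q \<omega> \<le> (\<Sum>i=1..<n. 5 * ?c i) / (5 * N)"
    proof (intro divide_right_mono sum_mono)
      fix i assume "i \<in> {1..<n}"
      then have i: "i \<ge> 1" by simp
      show "(increment (s i) i \<omega>)\<^sup>2 + b i \<omega> \<le> 5 * ?c i"
        using increment_square_le[OF i s[OF i] \<omega>] unfolding a_def b_def by simp
    qed (use N in simp)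
    also have "\<dots> = (\<Sum>i=1..<n. w *\<^sub>R ?c i)"
      unfolding sum_divide_distrib w_def using N by (intro sum.cong) (auto simp: field_simps)
    finally have "exp_sqrt (?Q \<omega>) \<le> exp_sqrt (\<Sum>i=1..<n. w *\<^sub>R ?c i)" unfolding exp_sqrt_def by simp
    also have "\<dots> \<le> (\<Sum>i=1..<n. w * exp_sqrt (?c i))"
    proof (rule convex_on_sum[OF _ _ exp_sqrt_convex])
      show "{1..<n} \<noteq> {}" using n by simp
      fix i
      have "0 \<le> ?c i" using a0 b0 by simp
      then show "?c i \<in> {-1<..}" by simp
    qed (use w(1) in \<open>simp_all only: w(2) finite_atLeastLessThan less_imp_le\<close>)
    also have "\<dots> \<le> (\<Sum>i=1..<n. w * (2 / 5 * exp_sqrt (a i \<omega>) + 3 / 5 * exp_sqrt (b i \<omega>)))"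
    proof (intro sum_mono mult_left_mono)
      fix i
      have "exp_sqrt (?c i) \<le> (1 - 3 / 5) * exp_sqrt (a i \<omega>) + 3 / 5 * exp_sqrt (b i \<omega>)"
        using a0[of i \<omega>] b0[of i \<omega>] by (intro convex_onD[OF exp_sqrt_convex]) auto
      then show "exp_sqrt (?c i) \<le> 2 / 5 * exp_sqrt (a i \<omega>) + 3 / 5 * exp_sqrt (b i \<omega>)" by simp
    qed (use w in simp)
    finally show "exp_sqrt (?Q \<omega>) \<le> (\<Sum>i=1..<n. w * (2 / 5 * exp_sqrt (a i \<omega>) + 3 / 5 * exp_sqrt (b i \<omega>)))" .
  next
    show "integrable \<Omega> (\<lambda>\<omega>. exp_sqrt (?Q \<omega>))" by (rule integrable_bounded_borel[OF bounded_borel_exp_sqrt[OF Q]])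
    show "integrable \<Omega> (\<lambda>\<omega>. \<Sum>i=1..<n. w * (2 / 5 * exp_sqrt (a i \<omega>) + 3 / 5 * exp_sqrt (b i \<omega>)))"
      by (intro integrable_bounded_borel bounded_borel_intros bounded_borel_exp_sqrt a b) simp_all
  qed
  also have "\<dots> = (\<Sum>i=1..<n. w * (2 / 5 * (\<integral>\<omega>. exp_sqrt (a i \<omega>) \<partial>\<Omega>) + 3 / 5 * (\<integral>\<omega>. exp_sqrt (b i \<omega>) \<partial>\<Omega>)))"
  proof -
    have int: "integrable \<Omega> (\<lambda>\<omega>. exp_sqrt (a i \<omega>))" "integrable \<Omega> (\<lambda>\<omega>. exp_sqrt (b i \<omega>))" if "i \<in> {1..<n}" for i
      using that integrable_bounded_borel[OF bounded_borel_exp_sqrt[OF a[of i]]]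
        integrable_bounded_borel[OF bounded_borel_exp_sqrt[OF b[of i]]] by simp_all
    then have "(\<integral>\<omega>. (\<Sum>i=1..<n. w * (2 / 5 * exp_sqrt (a i \<omega>) + 3 / 5 * exp_sqrt (b i \<omega>))) \<partial>\<Omega>) =
        (\<Sum>i=1..<n. \<integral>\<omega>. w * (2 / 5 * exp_sqrt (a i \<omega>) + 3 / 5 * exp_sqrt (b i \<omega>)) \<partial>\<Omega>)"
      by (intro Bochner_Integration.integral_sum integrable_mult_right Bochner_Integration.integrable_add)
    also have "\<dots> = (\<Sum>i=1..<n. w * (2 / 5 * (\<integral>\<omega>. exp_sqrt (a i \<omega>) \<partial>\<Omega>) + 3 / 5 * (\<integral>\<omega>. exp_sqrt (b i \<omega>) \<partial>\<Omega>)))"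
      by (intro sum.cong refl) (simp only: integral_mult_right_zero
          Bochner_Integration.integral_add[OF integrable_mult_right integrable_mult_right] int)
    finally show ?thesis .
  qed
  also have "\<dots> \<le> (\<Sum>i=1..<n. w * M)"
  proof (intro sum_mono mult_left_mono)
    fix i assume i: "i \<in> {1..<n}"
    then show "2 / 5 * (\<integral>\<omega>. exp_sqrt (a i \<omega>) \<partial>\<Omega>) + 3 / 5 * (\<integral>\<omega>. exp_sqrt (b i \<omega>) \<partial>\<Omega>) \<le> M"
      using M[OF i] next_square[of i] unfolding a_def by simp
  qed (use w in simp)
  also have "\<dots> = M" by (simp only: sum_distrib_right[symmetric] w(2) mult_1)
  finally show ?thesis unfolding b_def N_def by simp
qed

lemma prob_ge_le_of_integral_le:
  assumes f: "f \<in> bounded_borel \<Omega>" and nn: "\<And>\<omega>. f \<omega> \<ge> 0" and le: "(\<integral>\<omega>. f \<omega> \<partial>\<Omega>) \<le> M" and c: "c > 0"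
  shows "prob {\<omega> \<in> space \<Omega>. f \<omega> \<ge> c} \<le> M / c"
proof -
  have "prob {\<omega> \<in> space \<Omega>. f \<omega> \<ge> c} \<le> (\<integral>\<omega>. f \<omega> \<partial>\<Omega>) / c"
    by (rule integral_Markov_inequality_measure[OF integrable_bounded_borel[OF f], of "space \<Omega>"])
      (use nn c in auto)
  also have "\<dots> \<le> M / c" using le c by (intro divide_right_mono) auto
  finally show ?thesis .
qed

text \<open>Outside two events the supermartingale is at most \<open>exp u\<close> and the quadratic variation at most
  \<open>5 n w\<^sup>2\<close>; the deviation \<open>u / l + 5 n w\<^sup>2 l / 2\<close> that results is then balanced by the choice of \<open>l\<close>.\<close>

lemma martingale_tail:
  assumes s: "\<And>i. i \<ge> 1 \<Longrightarrow> (\<lambda>(\<omega>, y). s i \<omega> y) \<in> bounded_borel (H i \<Otimes>\<^sub>M E)" and n: "n \<ge> 2"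
    and M: "\<And>i. i \<in> {1..<n} \<Longrightarrow> (\<integral>\<omega>. exp_sqrt ((s i \<omega> (X (Suc i) \<omega>))\<^sup>2) \<partial>\<Omega>) \<le> M"
    and u: "u > 0" and w: "w > 0"
  obtains B where "B \<in> events" "prob B \<le> exp (- u) + M * exp (- w)"
    "\<And>\<omega>. \<omega> \<in> space \<Omega> - B \<Longrightarrow> (\<Sum>i=1..<n. increment (s i) i \<omega>) \<le> 4 * w * sqrt (n * u)"
proof -
  define l where "l = sqrt u / (w * sqrt n)"
  have l: "l > 0" using u w n by (simp add: l_def)
  define D where "D = (\<lambda>i. increment (s i) i)"
  define b where "b = (\<lambda>i. predicted_square (s i) i)"
  define Q where "Q = (\<lambda>\<omega>. \<Sum>i=1..<n. (D i \<omega>)\<^sup>2 + b i \<omega>)"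
  define f where "f = (\<lambda>\<omega>. exp (l * (\<Sum>i=1..<n. D i \<omega>) - l\<^sup>2 / 2 * Q \<omega>))"
  define g where "g = (\<lambda>\<omega>. exp_sqrt (Q \<omega> / (5 * (n - 1))))"
  have D: "D i \<in> bounded_borel \<Omega>" if "i \<ge> 1" for i
    unfolding D_def by (rule bounded_borel_H[OF increment_bounded_borel[OF that s[OF that]]])
  have b: "b i \<in> bounded_borel \<Omega>" if "i \<ge> 1" for i
    unfolding b_def by (rule bounded_borel_H[OF predicted_square_bounded_borel[OF that s[OF that]]])
  have Q: "Q \<in> bounded_borel \<Omega>" unfolding Q_def by (intro bounded_borel_intros D b) simp_all
  have f: "f \<in> bounded_borel \<Omega>" unfolding f_def by (intro bounded_borel_intros D Q) simp_all
  have g: "g \<in> bounded_borel \<Omega>" unfolding g_def by (intro bounded_borel_exp_sqrt bounded_borel_intros Q)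
  have "(\<integral>\<omega>. f \<omega> \<partial>\<Omega>) \<le> 1"
  proof -
    let ?s = "\<lambda>i \<omega> y. l * s i \<omega> y"
    have ls: "(\<lambda>(\<omega>, y). ?s i \<omega> y) \<in> bounded_borel (H i \<Otimes>\<^sub>M E)" if "i \<ge> 1" for i
      using s[OF that] unfolding case_prod_beta' by (intro bounded_borel_intros)
    have "increment (?s i) i \<omega> = l * D i \<omega>" for i \<omega>
      unfolding increment_def D_def T_cmult by (simp add: algebra_simps)
    moreover have "predicted_square (?s i) i \<omega> = l\<^sup>2 * b i \<omega>" for i \<omega>
      unfolding predicted_square_def b_def power_mult_distrib T_cmult ..
    ultimately have "(\<Sum>i=1..<n. increment (?s i) i \<omega> - (increment (?s i) i \<omega>)\<^sup>2 / 2 - predicted_square (?s i) i \<omega> / 2) =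
        (\<Sum>i=1..<n. l * D i \<omega> - l\<^sup>2 / 2 * ((D i \<omega>)\<^sup>2 + b i \<omega>))" for \<omega>
      by (intro sum.cong) (simp_all add: power_mult_distrib algebra_simps)
    also have "(\<Sum>i=1..<n. l * D i \<omega> - l\<^sup>2 / 2 * ((D i \<omega>)\<^sup>2 + b i \<omega>)) =
        l * (\<Sum>i=1..<n. D i \<omega>) - l\<^sup>2 / 2 * Q \<omega>" for \<omega>
      unfolding Q_def by (simp only: sum_subtractf sum_distrib_left)
    finally show ?thesis
      using exponential_supermartingale[of ?s n, OF ls] unfolding f_def by simp
  qed
  then have pf: "prob {\<omega> \<in> space \<Omega>. f \<omega> \<ge> exp u} \<le> 1 / exp u"
    by (intro prob_ge_le_of_integral_le[OF f]) (simp_all add: f_def)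
  have "(\<integral>\<omega>. g \<omega> \<partial>\<Omega>) \<le> M"
    unfolding g_def Q_def D_def b_def by (rule exp_sqrt_quadratic_variation[OF s n M])
  then have pg: "prob {\<omega> \<in> space \<Omega>. g \<omega> \<ge> exp w} \<le> M / exp w"
    by (intro prob_ge_le_of_integral_le[OF g]) (simp_all add: g_def exp_sqrt_def)
  define B where "B = {\<omega> \<in> space \<Omega>. f \<omega> \<ge> exp u} \<union> {\<omega> \<in> space \<Omega>. g \<omega> \<ge> exp w}"
  note [measurable] = bounded_borel_measurable[OF f] bounded_borel_measurable[OF g]
  have ev: "{\<omega> \<in> space \<Omega>. f \<omega> \<ge> exp u} \<in> events" "{\<omega> \<in> space \<Omega>. g \<omega> \<ge> exp w} \<in> events" by measurable
  show ?thesis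
  proof (rule that)
    show "B \<in> events" unfolding B_def using ev by blast
    have "prob B \<le> prob {\<omega> \<in> space \<Omega>. f \<omega> \<ge> exp u} + prob {\<omega> \<in> space \<Omega>. g \<omega> \<ge> exp w}"
      unfolding B_def by (rule measure_Un_le[OF ev])
    with pf pg show "prob B \<le> exp (- u) + M * exp (- w)" by (simp add: exp_minus divide_inverse)
    fix \<omega> assume \<omega>: "\<omega> \<in> space \<Omega> - B"
    then have f\<omega>: "f \<omega> < exp u" and g\<omega>: "g \<omega> < exp w" unfolding B_def by auto
    have Q0: "Q \<omega> \<ge> 0" unfolding Q_def b_def by (intro sum_nonneg add_nonneg_nonneg predicted_square_nonneg) simp
    have "sqrt (2 + Q \<omega> / (5 * (n - 1))) < w" using g\<omega> unfolding g_def exp_sqrt_def by simp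
    then have "(sqrt (2 + Q \<omega> / (5 * (n - 1))))\<^sup>2 < w\<^sup>2"
      using Q0 by (intro power_strict_mono) (auto intro: divide_nonneg_nonneg)
    moreover have "0 \<le> 2 + Q \<omega> / (5 * (n - 1))"
      using Q0 by (intro add_nonneg_nonneg divide_nonneg_nonneg) auto
    ultimately have "2 + Q \<omega> / (5 * (n - 1)) < w\<^sup>2" by (simp only: real_sqrt_pow2)
    then have "Q \<omega> / (5 * (n - 1)) \<le> w\<^sup>2" by simp
    then have "Q \<omega> \<le> w\<^sup>2 * (5 * (n - 1))" using n by (simp add: field_simps)
    also have "\<dots> \<le> w\<^sup>2 * (5 * n)" by (intro mult_left_mono) auto
    finally have Qw: "Q \<omega> \<le> 5 * n * w\<^sup>2" by (simp add: mult_ac)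
    have "l * (\<Sum>i=1..<n. D i \<omega>) \<le> u + l\<^sup>2 / 2 * Q \<omega>" using f\<omega> unfolding f_def by simp
    also have "\<dots> \<le> u + l\<^sup>2 / 2 * (5 * n * w\<^sup>2)" using Qw by (intro add_left_mono mult_left_mono) auto
    also have "l\<^sup>2 / 2 * (5 * n * w\<^sup>2) = 5 / 2 * u"
      unfolding l_def using u w n by (simp add: power_divide power_mult_distrib)
    also have "u + 5 / 2 * u \<le> l * (4 * w * sqrt (n * u))"
    proof -
      have "l * (4 * w * sqrt (n * u)) = 4 * (sqrt u * sqrt u)"
        unfolding l_def using w n by (simp add: real_sqrt_mult)
      then show ?thesis using u by simp
    qed
    finally show "(\<Sum>i=1..<n. increment (s i) i \<omega>) \<le> 4 * w * sqrt (n * u)"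
      using l unfolding D_def by simp
  qed
qed

end

section \<open>Sums over pairs of times\<close>

locale dominated_chain = doeblin_chain \<Omega> E P X \<pi> \<mu> \<delta> m
  for \<Omega> :: "'w measure" and E :: "'a measure" and P X \<pi> \<mu> \<delta> m +
  fixes \<nu> :: "'a measure" and \<delta>\<^sub>M :: real
  assumes \<nu>: "prob_measure_on E \<nu>" and \<delta>\<^sub>M: "\<delta>\<^sub>M > 0"
    and domination: "\<And>x D. x \<in> space E \<Longrightarrow> D \<in> sets E \<Longrightarrow> measure (P x) D \<le> \<delta>\<^sub>M * measure \<nu> D"
begin

sublocale \<nu>: prob_space \<nu>
  using \<nu> by (simp add: prob_measure_on_def)

lemma sets_\<nu>: "sets \<nu> = sets E"
  using \<nu> by (simp add: prob_measure_on_def)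

lemma space_\<nu>: "space \<nu> = space E"
  by (rule sets_eq_imp_space_eq[OF sets_\<nu>])

text \<open>The next state is not independent of the past, but its conditional law is dominated by a fixed one;
  the past and an independent state of law \<open>\<nu>\<close> therefore control every nonnegative function of both.\<close>

lemma decoupling:
  assumes i: "i \<ge> 1" and F: "(\<lambda>(\<omega>, y). F \<omega> y) \<in> bounded_borel (H i \<Otimes>\<^sub>M E)"
    and nn: "\<And>\<omega> y. F \<omega> y \<ge> 0" and le: "\<And>y. y \<in> space E \<Longrightarrow> (\<integral>\<omega>. F \<omega> y \<partial>\<Omega>) \<le> M"
  shows "(\<integral>\<omega>. F \<omega> (X (Suc i) \<omega>) \<partial>\<Omega>) \<le> \<delta>\<^sub>M * M"
proof -
  interpret Q: pair_prob_space \<Omega> \<nu> ..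
  have id: "(\<lambda>z. z) \<in> \<Omega> \<Otimes>\<^sub>M \<nu> \<rightarrow>\<^sub>M H i \<Otimes>\<^sub>M E"
  proof -
    have "fst \<in> \<Omega> \<Otimes>\<^sub>M \<nu> \<rightarrow>\<^sub>M H i"
      by (rule measurable_compose[OF measurable_fst measurable_from_subalg[OF subalgebra_H[of i], of "\<lambda>\<omega>. \<omega>"]]) simp
    moreover have "snd \<in> \<Omega> \<Otimes>\<^sub>M \<nu> \<rightarrow>\<^sub>M E"
      using measurable_snd[of \<Omega> \<nu>] by (simp only: measurable_cong_sets[OF refl sets_\<nu>])
    ultimately have "(\<lambda>z. (fst z, snd z)) \<in> \<Omega> \<Otimes>\<^sub>M \<nu> \<rightarrow>\<^sub>M H i \<Otimes>\<^sub>M E" by (rule measurable_Pair)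
    then show ?thesis by simp
  qed
  have F\<nu>: "(\<lambda>(\<omega>, y). F \<omega> y) \<in> bounded_borel (\<Omega> \<Otimes>\<^sub>M \<nu>)" by (rule bounded_borel_compose[OF F id])
  have int: "integrable (\<Omega> \<Otimes>\<^sub>M \<nu>) (\<lambda>(\<omega>, y). F \<omega> y)"
    by (rule Q.integrable_bounded_borel[OF F\<nu>])
  have "(\<integral>\<omega>. F \<omega> (X (Suc i) \<omega>) \<partial>\<Omega>) = (\<integral>\<omega>. T 1 (F \<omega>) (X i \<omega>) \<partial>\<Omega>)"
    by (rule markov_property[OF i F])
  also have "\<dots> \<le> (\<integral>\<omega>. \<delta>\<^sub>M * (\<integral>y. F \<omega> y \<partial>\<nu>) \<partial>\<Omega>)"
  proof (rule integral_mono)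
    show "integrable \<Omega> (\<lambda>\<omega>. T 1 (F \<omega>) (X i \<omega>))"
      by (rule integrable_bounded_borel[OF bounded_borel_H[OF history_T_bounded_borel[OF i F]]])
    show "integrable \<Omega> (\<lambda>\<omega>. \<delta>\<^sub>M * (\<integral>y. F \<omega> y \<partial>\<nu>))"
      by (rule integrable_mult_right[OF Q.integrable_fst[OF int]])
    fix \<omega> assume \<omega>: "\<omega> \<in> space \<Omega>"
    have x: "X i \<omega> \<in> space E" by (rule X_in_space[OF i \<omega>])
    have F\<omega>: "F \<omega> \<in> bounded_borel \<nu>"
      unfolding bounded_borel_cong_sets[OF sets_\<nu>] by (rule bounded_borel_section[OF F]) (simp add: \<omega>)
    have "prob_space (P (X i \<omega>))" "sets (P (X i \<omega>)) = sets E"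
      using kernel_powD[OF x, of 1] by (simp_all only: kernel_pow_1[OF x])
    then show "T 1 (F \<omega>) (X i \<omega>) \<le> \<delta>\<^sub>M * (\<integral>y. F \<omega> y \<partial>\<nu>)"
      unfolding T_1[OF x] using domination[OF x] \<delta>\<^sub>M nn F\<omega> \<nu>.finite_measure_axioms
      by (intro integral_le_of_measure_le) (auto simp: prob_space.finite_measure sets_\<nu>)
  qed
  also have "\<dots> = \<delta>\<^sub>M * (\<integral>y. \<integral>\<omega>. F \<omega> y \<partial>\<Omega> \<partial>\<nu>)"
    using Q.Fubini_integral[OF int] by simp
  also have "\<dots> \<le> \<delta>\<^sub>M * M"
  proof (intro mult_left_mono)
    show "(\<integral>y. \<integral>\<omega>. F \<omega> y \<partial>\<Omega> \<partial>\<nu>) \<le> M"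
      by (rule \<nu>.integral_le_const[OF Q.integrable_snd[OF int]]) (auto intro!: AE_I2 le simp: space_\<nu>)
  qed (use \<delta>\<^sub>M in simp)
  finally show ?thesis .
qed

text \<open>The column of the statistic at time \<open>k + 1\<close>, with the state at that time left as a variable \<open>y\<close>.\<close>

definition pair_sum :: "(nat \<Rightarrow> nat \<Rightarrow> 'a \<Rightarrow> 'a \<Rightarrow> real) \<Rightarrow> nat \<Rightarrow> 'w \<Rightarrow> 'a \<Rightarrow> real" where
  "pair_sum g k \<omega> y = (\<Sum>i=1..k. g i (Suc k) (X i \<omega>) y)"

lemma pair_sum_bounded_borel:
  assumes g: "\<And>i j. (\<lambda>(x, y). g i j x y) \<in> bounded_borel (E \<Otimes>\<^sub>M E)"
  shows "(\<lambda>(\<omega>, y). pair_sum g k \<omega> y) \<in> bounded_borel (H k \<Otimes>\<^sub>M E)"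
  unfolding pair_sum_def case_prod_beta'
proof (rule bounded_borel_sum)
  fix i assume "i \<in> {1..k}"
  then have i: "1 \<le> i" "i \<le> k" by auto
  have "(\<lambda>z. (X i (fst z), snd z)) \<in> H k \<Otimes>\<^sub>M E \<rightarrow>\<^sub>M E \<Otimes>\<^sub>M E"
    by (intro measurable_Pair measurable_compose[OF measurable_fst X_measurable_H[OF i]] measurable_snd)
  from bounded_borel_compose[OF g this]
  show "(\<lambda>z. g i (Suc k) (X i (fst z)) (snd z)) \<in> bounded_borel (H k \<Otimes>\<^sub>M E)" by simp
qed

text \<open>By \<open>decoupling\<close> it suffices to fix the second argument; the sum is then an additive functional of
  the chain, to which Bernstein's inequality applies with both signs.\<close>

lemma pair_sum_exponential_moment:
  assumes g: "\<And>i j. (\<lambda>(x, y). g i j x y) \<in> bounded_borel (E \<Otimes>\<^sub>M E)"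
    and small: "\<And>i j x y. x \<in> space E \<Longrightarrow> y \<in> space E \<Longrightarrow> \<bar>g i j x y\<bar> \<le> \<delta> / (8 * m)"
    and centred: "\<And>i j y. y \<in> space E \<Longrightarrow> (\<integral>x. g i j x y \<partial>\<pi>) = 0"
    and V: "\<And>y. y \<in> space E \<Longrightarrow> (\<Sum>i=1..k. \<integral>x. (g i (Suc k) x y)\<^sup>2 \<partial>\<pi>) \<le> V"
    and k: "k \<ge> 1"
  shows "(\<integral>\<omega>. exp_sqrt ((pair_sum g k \<omega> (X (Suc k) \<omega>))\<^sup>2) \<partial>\<Omega>) \<le> \<delta>\<^sub>M * (exp 2 * (2 * exp (K * m\<^sup>2 * V)))"
proof (rule decoupling[OF k])
  note s = pair_sum_bounded_borel[of g k, OF g]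
  show "(\<lambda>(\<omega>, y). exp_sqrt ((pair_sum g k \<omega> y)\<^sup>2)) \<in> bounded_borel (H k \<Otimes>\<^sub>M E)"
    using s unfolding case_prod_beta' by (intro bounded_borel_exp_sqrt bounded_borel_power)
  show "exp_sqrt ((pair_sum g k \<omega> y)\<^sup>2) \<ge> 0" for \<omega> y unfolding exp_sqrt_def by simp
  fix y assume y: "y \<in> space E"
  have sy: "(\<lambda>\<omega>. pair_sum g k \<omega> y) \<in> bounded_borel \<Omega>"
    by (rule bounded_borel_H[OF bounded_borel_section'[OF s y]])
  have moment: "(\<integral>\<omega>. exp (e * pair_sum g k \<omega> y) \<partial>\<Omega>) \<le> exp (K * m\<^sup>2 * V)" if e: "e = 1 \<or> e = -1" for e :: real
  proof -
    let ?g = "\<lambda>i x. e * g i (Suc k) x y"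
    have gy: "(\<lambda>x. g i (Suc k) x y) \<in> bounded_borel E" for i
      by (rule bounded_borel_section'[OF g y])
    have "(\<integral>\<omega>. exp (\<Sum>i=1..k. ?g i (X i \<omega>)) \<partial>\<Omega>) \<le> exp (K * m\<^sup>2 * (\<Sum>i=1..k. \<integral>x. (?g i x)\<^sup>2 \<partial>\<pi>))"
    proof (rule bernstein)
      show "?g i \<in> bounded_borel E" for i by (intro bounded_borel_intros gy)
      show "\<bar>?g i x\<bar> \<le> \<delta> / (8 * m)" if "x \<in> space E" for i x
        using small[OF that y, of i "Suc k"] e by (auto simp: abs_mult)
      show "(\<integral>x. ?g i x \<partial>\<pi>) = 0" for i by (simp only: integral_mult_right_zero centred[OF y] mult_zero_right)
    qed
    moreover have "(\<Sum>i=1..k. ?g i (X i \<omega>)) = e * pair_sum g k \<omega> y" for \<omega>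
      unfolding pair_sum_def by (simp only: sum_distrib_left)
    moreover have "(?g i x)\<^sup>2 = (g i (Suc k) x y)\<^sup>2" for i x using e by auto
    ultimately have "(\<integral>\<omega>. exp (e * pair_sum g k \<omega> y) \<partial>\<Omega>) \<le>
        exp (K * m\<^sup>2 * (\<Sum>i=1..k. \<integral>x. (g i (Suc k) x y)\<^sup>2 \<partial>\<pi>))" by (simp only:)
    also have "\<dots> \<le> exp (K * m\<^sup>2 * V)"
      using V[OF y] K_pos by (simp add: mult_left_mono)
    finally show ?thesis .
  qed
  have int: "integrable \<Omega> (\<lambda>\<omega>. exp (e * pair_sum g k \<omega> y))" for e
    by (intro integrable_bounded_borel bounded_borel_intros sy)
  have "(\<integral>\<omega>. exp_sqrt ((pair_sum g k \<omega> y)\<^sup>2) \<partial>\<Omega>) \<le>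
      (\<integral>\<omega>. exp 2 * (exp (1 * pair_sum g k \<omega> y) + exp (-1 * pair_sum g k \<omega> y)) \<partial>\<Omega>)"
  proof (rule integral_mono)
    show "integrable \<Omega> (\<lambda>\<omega>. exp_sqrt ((pair_sum g k \<omega> y)\<^sup>2))"
      by (intro integrable_bounded_borel bounded_borel_exp_sqrt bounded_borel_power sy)
    show "integrable \<Omega> (\<lambda>\<omega>. exp 2 * (exp (1 * pair_sum g k \<omega> y) + exp (-1 * pair_sum g k \<omega> y)))"
      by (intro integrable_mult_right Bochner_Integration.integrable_add int)
  qed (use exp_sqrt_square_le in simp)
  also have "\<dots> = exp 2 * ((\<integral>\<omega>. exp (1 * pair_sum g k \<omega> y) \<partial>\<Omega>) + (\<integral>\<omega>. exp (-1 * pair_sum g k \<omega> y) \<partial>\<Omega>))"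
    by (simp only: integral_mult_right_zero Bochner_Integration.integral_add[OF int int])
  also have "\<dots> \<le> exp 2 * (2 * exp (K * m\<^sup>2 * V))"
    using moment[of 1] moment[of "-1"] by (intro mult_left_mono) auto
  finally show "(\<integral>\<omega>. exp_sqrt ((pair_sum g k \<omega> y)\<^sup>2) \<partial>\<Omega>) \<le> exp 2 * (2 * exp (K * m\<^sup>2 * V))" .
qed

end

section \<open>The Poisson equation and the decomposition of the statistic\<close>

text \<open>Degenerate kernels \<open>p i j\<close>, extended by zero beyond time \<open>n\<close> so that the resolvent sums below need no
  range conditions.\<close>

locale degenerate_kernels = dominated_chain \<Omega> E P X \<pi> \<mu> \<delta> m \<nu> \<delta>\<^sub>M
  for \<Omega> :: "'w measure" and E :: "'a measure" and P X \<pi> \<mu> \<delta> m \<nu> \<delta>\<^sub>M +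
  fixes p :: "nat \<Rightarrow> nat \<Rightarrow> 'a \<Rightarrow> 'a \<Rightarrow> real" and n t :: nat and a :: real
  assumes p: "\<And>i j. (\<lambda>(x, y). p i j x y) \<in> bounded_borel (E \<Otimes>\<^sub>M E)"
    and p_bound: "\<And>i j x y. x \<in> space E \<Longrightarrow> y \<in> space E \<Longrightarrow> \<bar>p i j x y\<bar> \<le> a"
    and p_centred: "\<And>i j y. y \<in> space E \<Longrightarrow> (\<integral>x. p i j x y \<partial>\<pi>) = 0"
    and p_beyond: "\<And>i j x y. j > n \<Longrightarrow> p i j x y = 0"
    and n: "n \<ge> 2" and a: "a > 0"
begin

text \<open>\<open>G\<close> is the truncated resolvent: it solves the Poisson equation in the second argument up to \<open>T (Suc t) p\<close>.\<close>

definition G :: "nat \<Rightarrow> nat \<Rightarrow> 'a \<Rightarrow> 'a \<Rightarrow> real" where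
  "G i j x y = (\<Sum>k\<le>t. T k (p i (j + k) x) y)"

definition \<tau> :: real where "\<tau> = real (Suc t)"

lemma \<tau>_pos: "\<tau> > 0" by (simp add: \<tau>_def)

lemma p_section: "x \<in> space E \<Longrightarrow> p i j x \<in> bounded_borel E"
  by (rule bounded_borel_section[OF p])

lemma Tp: "(\<lambda>(x, y). T k (p i j x) y) \<in> bounded_borel (E \<Otimes>\<^sub>M E)"
proof -
  have "(\<lambda>z. (fst (fst z), snd z)) \<in> (E \<Otimes>\<^sub>M E) \<Otimes>\<^sub>M E \<rightarrow>\<^sub>M E \<Otimes>\<^sub>M E"
    by (intro measurable_Pair measurable_compose[OF measurable_fst measurable_fst] measurable_snd)
  from bounded_borel_compose[OF p[of i j] this]
  have "(\<lambda>(z, y). p i j (fst z) y) \<in> bounded_borel ((E \<Otimes>\<^sub>M E) \<Otimes>\<^sub>M E)" by (simp add: case_prod_beta')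
  from T_kernel_bounded_borel[OF this measurable_snd, of k] show ?thesis by (simp only: case_prod_beta')
qed

lemma G: "(\<lambda>(x, y). G i j x y) \<in> bounded_borel (E \<Otimes>\<^sub>M E)"
  using Tp unfolding G_def case_prod_beta' by (intro bounded_borel_sum)

lemma G_section: "x \<in> space E \<Longrightarrow> G i j x \<in> bounded_borel E"
  by (rule bounded_borel_section[OF G])

lemma G_bound:
  assumes "x \<in> space E" "y \<in> space E" shows "\<bar>G i j x y\<bar> \<le> \<tau> * a"
proof -
  have "\<bar>G i j x y\<bar> \<le> (\<Sum>k\<le>t. \<bar>T k (p i (j + k) x) y\<bar>)" unfolding G_def by (rule sum_abs)
  also have "\<dots> \<le> (\<Sum>k\<le>t. a)"
    by (intro sum_mono T_abs_le[OF assms(2) p_section[OF assms(1)]] p_bound[OF assms(1)])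
  finally show ?thesis by (simp add: \<tau>_def)
qed

text \<open>The kernel acts on the second argument and the centring is in the first one, so the two integrations commute.\<close>

lemma Tp_centred:
  assumes y: "y \<in> space E" shows "(\<integral>x. T k (p i j x) y \<partial>\<pi>) = 0"
proof -
  interpret K: prob_space "kernel_pow E P k y" by (rule kernel_powD(1)[OF y])
  interpret Q: pair_prob_space \<pi> "kernel_pow E P k y" ..
  have s: "sets (\<pi> \<Otimes>\<^sub>M kernel_pow E P k y) = sets (E \<Otimes>\<^sub>M E)"
    by (rule sets_pair_measure_cong[OF sets_\<pi> kernel_powD(2)[OF y]])
  have int: "integrable (\<pi> \<Otimes>\<^sub>M kernel_pow E P k y) (\<lambda>(x, z). p i j x z)"
    by (rule Q.integrable_bounded_borel) (simp only: bounded_borel_cong_sets[OF s] p)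
  have "(\<integral>x. T k (p i j x) y \<partial>\<pi>) = (\<integral>z. \<integral>x. p i j x z \<partial>\<pi> \<partial>kernel_pow E P k y)"
    unfolding T_def by (rule Q.Fubini_integral[OF int, symmetric])
  also have "\<dots> = (\<integral>z. 0 \<partial>kernel_pow E P k y)"
    by (intro Bochner_Integration.integral_cong refl) (simp only: p_centred kernel_powD(3)[OF y])
  finally show ?thesis by simp
qed

lemma integrable_Tp: "y \<in> space E \<Longrightarrow> integrable \<pi> (\<lambda>x. T k (p i j x) y)"
  by (rule integrable_\<pi>[OF bounded_borel_section'[OF Tp]])

lemma G_centred: "y \<in> space E \<Longrightarrow> (\<integral>x. G i j x y \<partial>\<pi>) = 0"
  unfolding G_def by (simp only: Bochner_Integration.integral_sum[OF integrable_Tp] Tp_centred sum.neutral_const)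

lemma poisson_equation:
  assumes x: "x \<in> space E" and y: "y \<in> space E"
  shows "p i j x y = G i j x y - T 1 (G i (Suc j) x) y + T (Suc t) (p i (j + Suc t) x) y"
proof -
  let ?f = "\<lambda>k. T k (p i (j + k) x) y"
  have "T 1 (G i (Suc j) x) y = (\<Sum>k\<le>t. T 1 (\<lambda>y. T k (p i (Suc j + k) x) y) y)"
    unfolding G_def by (rule T_sum[OF y]) (rule T_bounded_borel[OF p_section[OF x]])
  also have "\<dots> = (\<Sum>k\<le>t. ?f (Suc k))"
    by (intro sum.cong refl) (simp only: T_Suc'[OF y p_section[OF x]] add_Suc add_Suc_right)
  finally have "G i j x y - T 1 (G i (Suc j) x) y = (\<Sum>k\<le>t. ?f k - ?f (Suc k))"
    unfolding G_def by (simp only: sum_subtractf)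
  also have "\<dots> = ?f 0 - ?f (Suc t)" by (rule sum_telescope)
  finally show ?thesis using T_0[OF y p_section[OF x]] by simp
qed

text \<open>The Cauchy-Schwarz inequality over the \<open>t + 1\<close> terms of \<open>G\<close> costs one factor \<open>\<tau>\<close>, their number the
  other.\<close>

lemma G_square_integral_le:
  assumes V: "\<And>j k y. j \<le> n \<Longrightarrow> k \<le> t \<Longrightarrow> y \<in> space E \<Longrightarrow>
      (\<Sum>i=1..j - 1. \<integral>x. (T k (p i j x) y)\<^sup>2 \<partial>\<pi>) \<le> b\<^sup>2"
    and y: "y \<in> space E"
  shows "(\<Sum>i=1..k. \<integral>x. (G i (Suc k) x y)\<^sup>2 \<partial>\<pi>) \<le> \<tau>\<^sup>2 * b\<^sup>2"
proof -
  let ?q = "\<lambda>i l x. T l (p i (Suc k + l) x) y"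
  have int: "integrable \<pi> (\<lambda>x. (?q i l x)\<^sup>2)" for i l
    by (rule integrable_\<pi>[OF bounded_borel_power[OF bounded_borel_section'[OF Tp y]]])
  have "(\<Sum>i=1..k. \<integral>x. (G i (Suc k) x y)\<^sup>2 \<partial>\<pi>) \<le> (\<Sum>i=1..k. \<integral>x. \<tau> * (\<Sum>l\<le>t. (?q i l x)\<^sup>2) \<partial>\<pi>)"
  proof (intro sum_mono integral_mono)
    fix i x
    show "(G i (Suc k) x y)\<^sup>2 \<le> \<tau> * (\<Sum>l\<le>t. (?q i l x)\<^sup>2)"
      using sum_squared_le_sum_of_squares[of "\<lambda>l. ?q i l x" "{..t}"] by (simp add: G_def \<tau>_def mult.commute)
    show "integrable \<pi> (\<lambda>x. (G i (Suc k) x y)\<^sup>2)"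
      by (rule integrable_\<pi>[OF bounded_borel_power[OF bounded_borel_section'[OF G y]]])
    show "integrable \<pi> (\<lambda>x. \<tau> * (\<Sum>l\<le>t. (?q i l x)\<^sup>2))"
      by (intro integrable_mult_right Bochner_Integration.integrable_sum int)
  qed
  also have "\<dots> = \<tau> * (\<Sum>i=1..k. \<Sum>l\<le>t. \<integral>x. (?q i l x)\<^sup>2 \<partial>\<pi>)"
  proof -
    have "(\<integral>x. \<tau> * (\<Sum>l\<le>t. (?q i l x)\<^sup>2) \<partial>\<pi>) = \<tau> * (\<Sum>l\<le>t. \<integral>x. (?q i l x)\<^sup>2 \<partial>\<pi>)" for i
      by (simp only: integral_mult_right_zero Bochner_Integration.integral_sum[OF int])
    then show ?thesis by (simp only: sum_distrib_left)
  qed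
  also have "(\<Sum>i=1..k. \<Sum>l\<le>t. \<integral>x. (?q i l x)\<^sup>2 \<partial>\<pi>) = (\<Sum>l\<le>t. \<Sum>i=1..k. \<integral>x. (?q i l x)\<^sup>2 \<partial>\<pi>)"
    by (rule sum.swap)
  also have "\<tau> * \<dots> \<le> \<tau> * (\<Sum>l\<le>t. b\<^sup>2)"
  proof (intro mult_left_mono sum_mono)
    fix l assume "l \<in> {..t}"
    then have l: "l \<le> t" by simp
    show "(\<Sum>i=1..k. \<integral>x. (?q i l x)\<^sup>2 \<partial>\<pi>) \<le> b\<^sup>2"
    proof (cases "Suc k + l \<le> n")
      case True
      have "(\<Sum>i=1..k. \<integral>x. (?q i l x)\<^sup>2 \<partial>\<pi>) \<le> (\<Sum>i=1..Suc k + l - 1. \<integral>x. (?q i l x)\<^sup>2 \<partial>\<pi>)"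
        by (intro sum_mono2) auto
      also have "\<dots> \<le> b\<^sup>2" by (rule V[OF True l y])
      finally show ?thesis .
    next
      case False
      then have "p i (Suc k + l) x = (\<lambda>_. 0)" for i x using p_beyond by (intro ext) simp
      then show ?thesis by (simp add: T_def)
    qed
  qed (use \<tau>_pos in simp)
  finally show ?thesis by (simp add: \<tau>_def power2_eq_square mult.assoc)
qed

end

context degenerate_kernels
begin

definition U :: "'w \<Rightarrow> real" where
  "U \<omega> = (\<Sum>i=1..<n. \<Sum>k=i..<n. p i (Suc k) (X i \<omega>) (X (Suc k) \<omega>))"

definition diagonal :: "nat \<Rightarrow> 'a \<Rightarrow> real" where
  "diagonal i x = T 1 (G i (Suc i) x) x"

definition remainder :: "'w \<Rightarrow> real" where
  "remainder \<omega> = (\<Sum>i=1..<n. \<Sum>k=i..<n. T (Suc t) (p i (Suc k + Suc t) (X i \<omega>)) (X (Suc k) \<omega>))"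

definition martingale :: "'w \<Rightarrow> real" where
  "martingale \<omega> = (\<Sum>k=1..<n. increment (pair_sum G k) k \<omega>)"

lemma diagonal_bounded_borel: "diagonal i \<in> bounded_borel E"
  unfolding diagonal_def[abs_def] by (rule T_kernel_bounded_borel[OF G measurable_ident_sets[OF refl]])

lemma diagonal_bound: "x \<in> space E \<Longrightarrow> \<bar>diagonal i x\<bar> \<le> \<tau> * a"
  unfolding diagonal_def by (intro T_abs_le G_section G_bound)

text \<open>For fixed \<open>i\<close> the Poisson equation telescopes in the second time; the boundary term at \<open>j = i\<close> is a
  function of \<open>X i\<close> alone.\<close>

lemma decomposition:
  assumes \<omega>: "\<omega> \<in> space \<Omega>"
  shows "U \<omega> = martingale \<omega> + (\<Sum>i=1..<n. diagonal i (X i \<omega>)) + remainder \<omega>"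
proof -
  let ?x = "\<lambda>i. X i \<omega>"
  let ?d = "\<lambda>i k. G i (Suc k) (?x i) (?x (Suc k)) - T 1 (G i (Suc k) (?x i)) (?x k)"
  let ?r = "\<lambda>i k. T (Suc t) (p i (Suc k + Suc t) (?x i)) (?x (Suc k))"
  have row: "(\<Sum>k=i..<n. p i (Suc k) (?x i) (?x (Suc k))) =
      (\<Sum>k=i..<n. ?d i k) + diagonal i (?x i) + (\<Sum>k=i..<n. ?r i k)"
    if i: "i \<in> {1..<n}" for i
  proof -
    have xi: "?x i \<in> space E" using i \<omega> by (intro X_in_space) auto
    let ?\<phi> = "\<lambda>k. T 1 (G i (Suc k) (?x i)) (?x k)"
    have end_zero: "?\<phi> n = 0"
    proof -
      have "G i (Suc n) (?x i) = (\<lambda>_. 0)" unfolding G_def using p_beyond by (simp add: T_def)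
      then show ?thesis by (simp add: T_def)
    qed
    have "(\<Sum>k=i..<n. p i (Suc k) (?x i) (?x (Suc k))) =
        (\<Sum>k=i..<n. ?d i k - (?\<phi> (Suc k) - ?\<phi> k) + ?r i k)"
      by (intro sum.cong refl) (simp add: poisson_equation[OF xi X_in_space[OF _ \<omega>]])
    also have "\<dots> = (\<Sum>k=i..<n. ?d i k) - (\<Sum>k=i..<n. ?\<phi> (Suc k) - ?\<phi> k) + (\<Sum>k=i..<n. ?r i k)"
      by (simp only: sum.distrib sum_subtractf)
    also have "(\<Sum>k=i..<n. ?\<phi> (Suc k) - ?\<phi> k) = ?\<phi> n - ?\<phi> i"
      using i by (intro sum_Suc_diff') simp
    finally show ?thesis unfolding end_zero diagonal_def by simp
  qed
  have "U \<omega> = (\<Sum>i=1..<n. (\<Sum>k=i..<n. ?d i k) + diagonal i (?x i) + (\<Sum>k=i..<n. ?r i k))"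
    unfolding U_def by (intro sum.cong refl row)
  also have "\<dots> = (\<Sum>i=1..<n. \<Sum>k=i..<n. ?d i k) + (\<Sum>i=1..<n. diagonal i (?x i)) + remainder \<omega>"
    unfolding remainder_def by (simp only: sum.distrib)
  also have "(\<Sum>i=1..<n. \<Sum>k=i..<n. ?d i k) = (\<Sum>k=1..<n. \<Sum>i=1..k. ?d i k)"
  proof -
    have "(\<Sum>i=1..<n. \<Sum>k=i..<n. ?d i k) = (\<Sum>(i, k)\<in>(SIGMA i:{1..<n}. {i..<n}). ?d i k)"
      by (rule sum.Sigma) auto
    also have "\<dots> = (\<Sum>(k, i)\<in>(SIGMA k:{1..<n}. {1..k}). ?d i k)"
      by (rule sum.reindex_bij_witness[of _ "\<lambda>(k, i). (i, k)" "\<lambda>(i, k). (k, i)"]) auto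
    also have "\<dots> = (\<Sum>k=1..<n. \<Sum>i=1..k. ?d i k)"
      by (rule sum.Sigma[symmetric]) auto
    finally show ?thesis .
  qed
  also have "\<dots> = martingale \<omega>"
    unfolding martingale_def
  proof (intro sum.cong refl)
    fix k assume k: "k \<in> {1..<n}"
    then have x: "X k \<omega> \<in> space E" using \<omega> by (intro X_in_space) auto
    have "T 1 (pair_sum G k \<omega>) (X k \<omega>) = (\<Sum>i=1..k. T 1 (G i (Suc k) (?x i)) (X k \<omega>))"
      unfolding pair_sum_def[abs_def]
      by (rule T_sum[OF x]) (auto intro!: G_section X_in_space[OF _ \<omega>])
    then show "(\<Sum>i=1..k. ?d i k) = increment (pair_sum G k) k \<omega>"
      unfolding increment_def by (simp add: pair_sum_def sum_subtractf)
  qed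
  finally show ?thesis .
qed

lemma pair_sum_G_bounded_borel: "(\<lambda>(\<omega>, y). pair_sum G k \<omega> y) \<in> bounded_borel (H k \<Otimes>\<^sub>M E)"
  by (rule pair_sum_bounded_borel[OF G])

lemma martingale_bounded_borel: "martingale \<in> bounded_borel \<Omega>"
  unfolding martingale_def[abs_def]
proof (rule bounded_borel_sum)
  fix k assume "k \<in> {1..<n}"
  then have k: "k \<ge> 1" by simp
  show "increment (pair_sum G k) k \<in> bounded_borel \<Omega>"
    by (rule bounded_borel_H[OF increment_bounded_borel[OF k pair_sum_G_bounded_borel]])
qed

lemma bounded_borel_pair:
  assumes "(\<lambda>(x, y). f x y) \<in> bounded_borel (E \<Otimes>\<^sub>M E)" "i \<ge> 1" "j \<ge> 1"
  shows "(\<lambda>\<omega>. f (X i \<omega>) (X j \<omega>)) \<in> bounded_borel \<Omega>"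
  using bounded_borel_compose[OF assms(1) measurable_Pair[OF X_measurable[OF assms(2)] X_measurable[OF assms(3)]]]
  by simp

lemma U_bounded_borel: "U \<in> bounded_borel \<Omega>"
  unfolding U_def[abs_def] by (intro bounded_borel_sum bounded_borel_pair[OF p]) auto

lemma remainder_bounded_borel: "remainder \<in> bounded_borel \<Omega>"
  unfolding remainder_def[abs_def] by (intro bounded_borel_sum bounded_borel_pair[OF Tp]) auto

lemma integral_martingale: "(\<integral>\<omega>. martingale \<omega> \<partial>\<Omega>) = 0"
proof -
  have "(\<integral>\<omega>. martingale \<omega> \<partial>\<Omega>) = (\<Sum>k=1..<n. \<integral>\<omega>. increment (pair_sum G k) k \<omega> \<partial>\<Omega>)"
    unfolding martingale_def
  proof (rule Bochner_Integration.integral_sum)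
    fix k assume "k \<in> {1..<n}"
    then have k: "k \<ge> 1" by simp
    show "integrable \<Omega> (increment (pair_sum G k) k)"
      by (rule integrable_bounded_borel[OF bounded_borel_H[OF increment_bounded_borel[OF k pair_sum_G_bounded_borel]]])
  qed
  also have "\<dots> = (\<Sum>k=1..<n. 0)"
  proof (rule sum.cong[OF refl])
    fix k assume "k \<in> {1..<n}"
    then have k: "k \<ge> 1" by simp
    note s = pair_sum_G_bounded_borel[of k]
    show "(\<integral>\<omega>. increment (pair_sum G k) k \<omega> \<partial>\<Omega>) = 0"
      unfolding increment_def
      using markov_property[OF k s]
      by (subst Bochner_Integration.integral_diff)
        (auto intro: integrable_bounded_borel[OF bounded_borel_H[OF history_next_bounded_borel[OF k s]]]
          integrable_bounded_borel[OF bounded_borel_H[OF history_T_bounded_borel[OF k s]]])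
  qed
  finally show ?thesis by simp
qed

section \<open>Tails of the three parts\<close>

lemma diagonal_tail:
  fixes u :: real
  assumes u: "u > 0"
  obtains B where "B \<in> events" "prob B \<le> exp (- u)"
    "\<And>\<omega>. \<omega> \<in> space \<Omega> - B \<Longrightarrow> (\<Sum>i=1..<n. diagonal i (X i \<omega>) - (\<integral>x. diagonal i x \<partial>\<pi>)) \<le>
      (32 * m / \<delta>) * \<tau> * a * (u + sqrt (n * u))"
proof -
  \<comment> \<open>The centred functions are at most \<open>2 \<tau> a\<close>; dividing by \<open>c\<close> brings them into the range of Bernstein's
    inequality, and the factor \<open>1 + sqrt (n / u)\<close> keeps the sum of the variances of order \<open>u\<close>.\<close>
  define c where "c = 16 * m * \<tau> * a / \<delta>"
  define l where "l = 1 / (c * (1 + sqrt (n / u)))"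
  define f where "f = (\<lambda>i x. diagonal i x - (\<integral>x. diagonal i x \<partial>\<pi>))"
  define S where "S = (\<lambda>\<omega>. \<Sum>i=1..<n. f i (X i \<omega>))"
  have c: "c > 0" using m \<tau>_pos a \<delta> by (simp add: c_def)
  have nu: "sqrt (n / u) > 0" using u n by simp
  have l: "l > 0" unfolding l_def using c nu by (simp add: add_pos_pos)
  have f: "f i \<in> bounded_borel E" for i
    unfolding f_def by (intro bounded_borel_intros diagonal_bounded_borel)
  have mean: "\<bar>\<integral>x. diagonal i x \<partial>\<pi>\<bar> \<le> \<tau> * a" for i
  proof (rule \<pi>.abs_integral_le_bound)
    show "diagonal i \<in> borel_measurable \<pi>"
      by (rule bounded_borel_measurable) (simp add: diagonal_bounded_borel)
    show "AE x in \<pi>. \<bar>diagonal i x\<bar> \<le> \<tau> * a" by (intro AE_I2 diagonal_bound) simp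
  qed
  have fb: "\<bar>f i x\<bar> \<le> 2 * (\<tau> * a)" if "x \<in> space E" for i x
    using diagonal_bound[OF that, of i] mean[of i] unfolding f_def by linarith
  have lc: "l * c \<le> 1" "l * c * sqrt (n / u) \<le> 1"
  proof -
    have "l * c = 1 / (1 + sqrt (n / u))" unfolding l_def using c by simp
    moreover have "1 / (1 + q) \<le> 1 \<and> 1 / (1 + q) * q \<le> 1" if "q > 0" for q :: real
      using that by (simp add: field_simps)
    ultimately show "l * c \<le> 1" "l * c * sqrt (n / u) \<le> 1" using nu by (simp_all only:)
  qed
  have small: "\<bar>l * f i x\<bar> \<le> \<delta> / (8 * m)" if "x \<in> space E" for i x
  proof -
    have "\<bar>l * f i x\<bar> \<le> l * (2 * (\<tau> * a))" using fb[OF that] l by (simp add: abs_mult)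
    also have "\<dots> = (l * c) * (\<delta> / (8 * m))" unfolding c_def using \<delta> m by simp
    also have "\<dots> \<le> 1 * (\<delta> / (8 * m))" using lc \<delta> by (intro mult_right_mono) auto
    finally show ?thesis by simp
  qed
  have variance: "(\<Sum>i=1..n - 1. \<integral>x. (l * f i x)\<^sup>2 \<partial>\<pi>) \<le> u * (\<delta> / (8 * m))\<^sup>2"
  proof -
    have "(\<integral>x. (l * f i x)\<^sup>2 \<partial>\<pi>) \<le> (l * c)\<^sup>2 * (\<delta> / (8 * m))\<^sup>2" for i
    proof (rule \<pi>.integral_le_const)
      show "integrable \<pi> (\<lambda>x. (l * f i x)\<^sup>2)" by (intro integrable_\<pi> bounded_borel_intros f)
      have "(l * f i x)\<^sup>2 \<le> (l * c)\<^sup>2 * (\<delta> / (8 * m))\<^sup>2" if x: "x \<in> space E" for x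
      proof -
        have "\<bar>l * f i x\<bar> \<le> l * (2 * (\<tau> * a))" using fb[OF x] l by (simp add: abs_mult)
        also have "\<dots> = (l * c) * (\<delta> / (8 * m))" unfolding c_def using \<delta> m by simp
        finally have "\<bar>l * f i x\<bar>\<^sup>2 \<le> ((l * c) * (\<delta> / (8 * m)))\<^sup>2" by (rule power_mono) simp
        then show ?thesis by (simp only: power2_abs power_mult_distrib)
      qed
      then show "AE x in \<pi>. (l * f i x)\<^sup>2 \<le> (l * c)\<^sup>2 * (\<delta> / (8 * m))\<^sup>2" by (intro AE_I2) simp
    qed
    then have "(\<Sum>i=1..n - 1. \<integral>x. (l * f i x)\<^sup>2 \<partial>\<pi>) \<le> (\<Sum>i=1..n - 1. (l * c)\<^sup>2 * (\<delta> / (8 * m))\<^sup>2)"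
      by (intro sum_mono)
    also have "\<dots> = real (n - 1) * (l * c)\<^sup>2 * (\<delta> / (8 * m))\<^sup>2" by simp
    also have "\<dots> \<le> u * (\<delta> / (8 * m))\<^sup>2"
    proof (rule mult_right_mono)
      have "(l * c * sqrt (n / u))\<^sup>2 \<le> 1\<^sup>2" using lc(2) l c nu by (intro power_mono) auto
      then have "(l * c)\<^sup>2 * (n / u) \<le> 1" using u by (simp add: power_mult_distrib)
      then have "n * (l * c)\<^sup>2 \<le> u" using u by (simp add: field_simps)
      moreover have "real (n - 1) * (l * c)\<^sup>2 \<le> n * (l * c)\<^sup>2" by (intro mult_right_mono) auto
      ultimately show "real (n - 1) * (l * c)\<^sup>2 \<le> u" by linarith
    qed simp
    finally show ?thesis .
  qed
  have exponent: "K * m\<^sup>2 * (\<Sum>i=1..n - 1. \<integral>x. (l * f i x)\<^sup>2 \<partial>\<pi>) \<le> u"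
  proof -
    have "K * m\<^sup>2 * (\<Sum>i=1..n - 1. \<integral>x. (l * f i x)\<^sup>2 \<partial>\<pi>) \<le> K * m\<^sup>2 * (u * (\<delta> / (8 * m))\<^sup>2)"
      using variance K_pos by (intro mult_left_mono) auto
    also have "\<dots> = u * ((K * \<delta>) * \<delta> / 64)" using m by (simp add: power2_eq_square field_simps)
    also have "\<dots> \<le> u * 1"
    proof (rule mult_left_mono)
      have "K * \<delta> = 4 * \<delta> + 32" unfolding K_def using \<delta> by (simp add: field_simps)
      then have "(K * \<delta>) * \<delta> \<le> 36 * 1" using \<delta> by (intro mult_mono) auto
      then show "(K * \<delta>) * \<delta> / 64 \<le> 1" by simp
    qed (use u in simp)
    finally show ?thesis by simp
  qed
  have "(\<integral>\<omega>. exp (\<Sum>i=1..n - 1. l * f i (X i \<omega>)) \<partial>\<Omega>) \<le> exp (K * m\<^sup>2 * (\<Sum>i=1..n - 1. \<integral>x. (l * f i x)\<^sup>2 \<partial>\<pi>))"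
  proof (rule bernstein)
    show "(\<lambda>x. l * f i x) \<in> bounded_borel E" for i by (intro bounded_borel_intros f)
    show "(\<integral>x. l * f i x \<partial>\<pi>) = 0" for i
      unfolding f_def using integrable_\<pi>[OF diagonal_bounded_borel[of i]] by simp
  qed (use small in auto)
  also have "\<dots> \<le> exp u" using exponent by simp
  also have "(\<lambda>\<omega>. \<Sum>i=1..n - 1. l * f i (X i \<omega>)) = (\<lambda>\<omega>. l * S \<omega>)"
  proof -
    have "{1..n - 1} = {1..<n}" using n by auto
    then show ?thesis unfolding S_def by (simp only: sum_distrib_left)
  qed
  finally have moment: "(\<integral>\<omega>. exp (l * S \<omega>) \<partial>\<Omega>) \<le> exp u" .
  have S: "S \<in> bounded_borel \<Omega>"
    unfolding S_def
  proof (rule bounded_borel_sum)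
    fix i assume "i \<in> {1..<n}"
    then have "1 \<le> i" by simp
    then show "(\<lambda>\<omega>. f i (X i \<omega>)) \<in> bounded_borel \<Omega>" by (intro bounded_borel_H[OF bounded_borel_X[OF _ order_refl f]])
  qed
  have eS: "(\<lambda>\<omega>. exp (l * S \<omega>)) \<in> bounded_borel \<Omega>" by (intro bounded_borel_intros S)
  note [measurable] = bounded_borel_measurable[OF eS]
  let ?B = "{\<omega> \<in> space \<Omega>. exp (l * S \<omega>) \<ge> exp (2 * u)}"
  show ?thesis
  proof (rule that)
    show "?B \<in> events" by measurable
    have "prob ?B \<le> exp u / exp (2 * u)" by (rule prob_ge_le_of_integral_le[OF eS _ moment]) simp_all
    also have "\<dots> = exp (- u)" by (simp add: exp_diff[symmetric])
    finally show "prob ?B \<le> exp (- u)" .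
    fix \<omega> assume "\<omega> \<in> space \<Omega> - ?B"
    then have "l * S \<omega> < 2 * u" by auto
    then have "S \<omega> < 2 * u / l" using l by (simp add: field_simps)
    also have "2 * u / l = 2 * c * (u + u * sqrt (n / u))" unfolding l_def by (simp add: algebra_simps)
    also have "u * sqrt (n / u) = sqrt (n * u)"
    proof -
      have "s * s * (q / s) = q * s" if "s > 0" for q s :: real using that by simp
      from this[of "sqrt u" "sqrt n"] show ?thesis using u by (simp add: real_sqrt_divide real_sqrt_mult)
    qed
    also have "2 * c * (u + sqrt (n * u)) = (32 * m / \<delta>) * \<tau> * a * (u + sqrt (n * u))"
      unfolding c_def by simp
    finally show "(\<Sum>i=1..<n. diagonal i (X i \<omega>) - (\<integral>x. diagonal i x \<partial>\<pi>)) \<le>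
      (32 * m / \<delta>) * \<tau> * a * (u + sqrt (n * u))" unfolding S_def f_def by simp
  qed
qed

lemma martingale_part_tail:
  fixes b u :: real
  assumes V: "\<And>j k y. j \<le> n \<Longrightarrow> k \<le> t \<Longrightarrow> y \<in> space E \<Longrightarrow>
      (\<Sum>i=1..j - 1. \<integral>x. (T k (p i j x) y)\<^sup>2 \<partial>\<pi>) \<le> b\<^sup>2"
    and b: "b \<ge> 0" and u: "u > 0"
  obtains B where "B \<in> events" "prob B \<le> (1 + 2 * exp 2 * \<delta>\<^sub>M) * exp (- u)"
    "\<And>\<omega>. \<omega> \<in> space \<Omega> - B \<Longrightarrow>
      martingale \<omega> \<le> 4 * (K * m\<^sup>2 + 1) * \<tau> * (8 * m / \<delta> * a * sqrt n * (u * sqrt u) + b * sqrt n * u)"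
proof -
  \<comment> \<open>Dividing \<open>G\<close> by the first summand brings it into the range of Bernstein's inequality, dividing it by the
    second one makes the variance at most \<open>u\<close>; the sum does both.  With \<open>w\<close> as below, \<open>exp (- w)\<close> cancels the
    exponential moment up to \<open>exp (- u)\<close>.\<close>
  define q where "q = 8 * m / \<delta> * (\<tau> * a) + \<tau> * b / sqrt u"
  define l where "l = 1 / q"
  define w where "w = (K * m\<^sup>2 + 1) * u"
  have A0: "8 * m / \<delta> * (\<tau> * a) > 0" using m \<delta> \<tau>_pos a by simp
  have B0: "\<tau> * b / sqrt u \<ge> 0" using \<tau>_pos b u by simp
  have q: "q > 0" unfolding q_def using A0 B0 by linarith
  have l: "l > 0" using q by (simp add: l_def)
  have w: "w > 0" unfolding w_def using u K_pos by (intro mult_pos_pos add_nonneg_pos) auto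
  let ?g = "\<lambda>i j x y. l * G i j x y"
  have g: "(\<lambda>(x, y). ?g i j x y) \<in> bounded_borel (E \<Otimes>\<^sub>M E)" for i j
    using G[of i j] unfolding case_prod_beta' by (intro bounded_borel_intros)
  have scaled: "pair_sum ?g k \<omega> y = l * pair_sum G k \<omega> y" for k \<omega> y
    unfolding pair_sum_def by (simp only: sum_distrib_left)
  have lg: "\<bar>?g i j x y\<bar> \<le> \<delta> / (8 * m)" if "x \<in> space E" "y \<in> space E" for i j x y
  proof -
    have "\<bar>?g i j x y\<bar> \<le> l * (\<tau> * a)" using G_bound[OF that, of i j] l by (simp add: abs_mult)
    also have "\<dots> \<le> \<delta> / (8 * m)"
    proof -
      have "8 * m / \<delta> * (\<tau> * a) \<le> q" unfolding q_def using B0 by simp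
      then have "\<tau> * a \<le> q * (\<delta> / (8 * m))" using m \<delta> by (simp add: field_simps)
      then show ?thesis unfolding l_def using q by (simp add: field_simps)
    qed
    finally show ?thesis .
  qed
  have lV: "(\<Sum>i=1..k. \<integral>x. (?g i (Suc k) x y)\<^sup>2 \<partial>\<pi>) \<le> u" if y: "y \<in> space E" for k y
  proof -
    have "(\<Sum>i=1..k. \<integral>x. (?g i (Suc k) x y)\<^sup>2 \<partial>\<pi>) = l\<^sup>2 * (\<Sum>i=1..k. \<integral>x. (G i (Suc k) x y)\<^sup>2 \<partial>\<pi>)"
      by (simp only: power_mult_distrib integral_mult_right_zero sum_distrib_left)
    also have "\<dots> \<le> l\<^sup>2 * (\<tau>\<^sup>2 * b\<^sup>2)"
      using G_square_integral_le[OF V y] by (intro mult_left_mono) auto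
    also have "\<dots> = (l * (\<tau> * b))\<^sup>2" by (simp add: power_mult_distrib)
    also have "\<dots> \<le> (sqrt u)\<^sup>2"
    proof (rule power_mono)
      have "\<tau> * b / sqrt u \<le> q" unfolding q_def using A0 by simp
      then have "\<tau> * b \<le> q * sqrt u" using u by (simp add: field_simps)
      then show "l * (\<tau> * b) \<le> sqrt u" unfolding l_def using q by (simp add: field_simps)
      show "0 \<le> l * (\<tau> * b)" using l \<tau>_pos b by simp
    qed
    finally show ?thesis using u by simp
  qed
  have s: "(\<lambda>(\<omega>, y). pair_sum ?g i \<omega> y) \<in> bounded_borel (H i \<Otimes>\<^sub>M E)" for i
    by (rule pair_sum_bounded_borel[OF g])
  have M: "(\<integral>\<omega>. exp_sqrt ((pair_sum ?g i \<omega> (X (Suc i) \<omega>))\<^sup>2) \<partial>\<Omega>) \<le> \<delta>\<^sub>M * (exp 2 * (2 * exp (K * m\<^sup>2 * u)))"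
    if "i \<in> {1..<n}" for i
  proof (rule pair_sum_exponential_moment[where g = ?g and V = u and k = i, OF g lg _ lV])
    show "(\<integral>x. ?g i j x y \<partial>\<pi>) = 0" if "y \<in> space E" for i j y
      by (simp only: integral_mult_right_zero G_centred[OF that] mult_zero_right)
  qed (use that in auto)
  obtain B where B: "B \<in> events" "prob B \<le> exp (- u) + \<delta>\<^sub>M * (exp 2 * (2 * exp (K * m\<^sup>2 * u))) * exp (- w)"
    "\<And>\<omega>. \<omega> \<in> space \<Omega> - B \<Longrightarrow> (\<Sum>i=1..<n. increment (pair_sum ?g i) i \<omega>) \<le> 4 * w * sqrt (n * u)"
    using martingale_tail[OF s n M u w] by blast
  show ?thesis
  proof (rule that[OF B(1)])
    have "exp (K * m\<^sup>2 * u) * exp (- w) = exp (- u)"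
      unfolding w_def exp_add[symmetric] by (simp add: algebra_simps)
    then have "\<delta>\<^sub>M * (exp 2 * (2 * exp (K * m\<^sup>2 * u))) * exp (- w) = \<delta>\<^sub>M * exp 2 * 2 * exp (- u)"
      by (simp only: mult.assoc)
    then show "prob B \<le> (1 + 2 * exp 2 * \<delta>\<^sub>M) * exp (- u)"
    proof -
      have "prob B \<le> exp (- u) + \<delta>\<^sub>M * exp 2 * 2 * exp (- u)"
        using B(2) \<open>\<delta>\<^sub>M * (exp 2 * (2 * exp (K * m\<^sup>2 * u))) * exp (- w) = \<delta>\<^sub>M * exp 2 * 2 * exp (- u)\<close>
        by (simp only:)
      then show ?thesis by (simp add: algebra_simps)
    qed
    fix \<omega> assume \<omega>: "\<omega> \<in> space \<Omega> - B"
    have "increment (pair_sum ?g i) i \<omega> = l * increment (pair_sum G i) i \<omega>" for i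
      unfolding increment_def scaled T_cmult by (simp add: algebra_simps)
    then have "l * martingale \<omega> \<le> 4 * w * sqrt (n * u)"
      using B(3)[OF \<omega>] unfolding martingale_def by (simp add: sum_distrib_left)
    then have "martingale \<omega> \<le> q * (4 * w * sqrt (n * u))"
      unfolding l_def using q by (simp add: field_simps)
    also have "\<dots> = 4 * (K * m\<^sup>2 + 1) * (sqrt n * (u * (sqrt u * q)))"
      unfolding w_def by (simp add: real_sqrt_mult)
    also have "sqrt u * q = \<tau> * (8 * m / \<delta> * a * sqrt u + b)"
      unfolding q_def using u by (simp add: field_simps)
    also have "4 * (K * m\<^sup>2 + 1) * (sqrt n * (u * (\<tau> * (8 * m / \<delta> * a * sqrt u + b)))) =
        4 * (K * m\<^sup>2 + 1) * \<tau> * (8 * m / \<delta> * a * sqrt n * (u * sqrt u) + b * sqrt n * u)"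
      by (simp only: distrib_left mult_ac)
    finally show "martingale \<omega> \<le> 4 * (K * m\<^sup>2 + 1) * \<tau> * (8 * m / \<delta> * a * sqrt n * (u * sqrt u) + b * sqrt n * u)" .
  qed
qed

text \<open>An almost sure bound in the second argument suffices, since every \<open>X k\<close> has law \<open>\<pi>\<close>.\<close>

lemma remainder_AE_bound:
  fixes \<epsilon> :: real
  assumes R: "AE y in \<pi>. \<forall>i j. \<forall>x\<in>space E. \<bar>T (Suc t) (p i j x) y\<bar> \<le> \<epsilon>" and \<epsilon>: "\<epsilon> \<ge> 0"
  shows "AE \<omega> in \<Omega>. \<bar>remainder \<omega>\<bar> \<le> n\<^sup>2 * \<epsilon>"
proof -
  have "AE \<omega> in \<Omega>. \<forall>k. k \<ge> 1 \<longrightarrow> (\<forall>i j. \<forall>x\<in>space E. \<bar>T (Suc t) (p i j x) (X k \<omega>)\<bar> \<le> \<epsilon>)"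
    unfolding AE_all_countable
  proof
    fix k
    show "AE \<omega> in \<Omega>. k \<ge> 1 \<longrightarrow> (\<forall>i j. \<forall>x\<in>space E. \<bar>T (Suc t) (p i j x) (X k \<omega>)\<bar> \<le> \<epsilon>)"
      using AE_X[OF _ R, of k] by (cases "k \<ge> 1") auto
  qed
  then show ?thesis
  proof (rule AE_mp, intro AE_I2 impI)
    fix \<omega> assume \<omega>: "\<omega> \<in> space \<Omega>"
      and bound: "\<forall>k. k \<ge> 1 \<longrightarrow> (\<forall>i j. \<forall>x\<in>space E. \<bar>T (Suc t) (p i j x) (X k \<omega>)\<bar> \<le> \<epsilon>)"
    have "\<bar>remainder \<omega>\<bar> \<le> (\<Sum>i=1..<n. \<Sum>k=i..<n. \<bar>T (Suc t) (p i (Suc k + Suc t) (X i \<omega>)) (X (Suc k) \<omega>)\<bar>)"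
      unfolding remainder_def by (intro order_trans[OF sum_abs] sum_mono sum_abs)
    also have "\<dots> \<le> (\<Sum>i=1..<n. \<Sum>k=i..<n. \<epsilon>)"
      by (intro sum_mono) (auto intro!: bound[rule_format] X_in_space \<omega>)
    also have "\<dots> \<le> (\<Sum>i=1..<n. n * \<epsilon>)"
      using \<epsilon> by (intro sum_mono) (auto intro!: mult_right_mono)
    also have "\<dots> \<le> n * (n * \<epsilon>)"
      using \<epsilon> by (auto intro!: mult_right_mono mult_nonneg_nonneg)
    finally show "\<bar>remainder \<omega>\<bar> \<le> n\<^sup>2 * \<epsilon>" by (simp add: power2_eq_square)
  qed
qed

text \<open>The martingale has mean zero, so centring the statistic centres the two other parts; the
  remainder pays its bound once for itself and once for its mean.\<close>

lemma U_tail: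
  fixes b u \<epsilon> :: real
  assumes V: "\<And>j k y. j \<le> n \<Longrightarrow> k \<le> t \<Longrightarrow> y \<in> space E \<Longrightarrow>
      (\<Sum>i=1..j - 1. \<integral>x. (T k (p i j x) y)\<^sup>2 \<partial>\<pi>) \<le> b\<^sup>2"
    and b: "b \<ge> 0" and u: "u > 0"
    and R: "AE y in \<pi>. \<forall>i j. \<forall>x\<in>space E. \<bar>T (Suc t) (p i j x) y\<bar> \<le> \<epsilon>" and \<epsilon>: "\<epsilon> \<ge> 0"
  shows "prob {\<omega> \<in> space \<Omega>. U \<omega> - (\<integral>\<omega>. U \<omega> \<partial>\<Omega>) \<le>
      4 * (K * m\<^sup>2 + 1) * \<tau> * (8 * m / \<delta> * a * sqrt n * (u * sqrt u) + b * sqrt n * u) +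
      (32 * m / \<delta>) * \<tau> * a * (u + sqrt (n * u)) + 2 * (n\<^sup>2 * \<epsilon>)} \<ge> 1 - (2 + 2 * exp 2 * \<delta>\<^sub>M) * exp (- u)"
    (is "prob {\<omega> \<in> space \<Omega>. _ \<le> ?M + ?D + ?R} \<ge> _")
proof -
  obtain B1 where B1: "B1 \<in> events" "prob B1 \<le> (1 + 2 * exp 2 * \<delta>\<^sub>M) * exp (- u)"
    "\<And>\<omega>. \<omega> \<in> space \<Omega> - B1 \<Longrightarrow> martingale \<omega> \<le> ?M"
    using martingale_part_tail[OF V b u] by blast
  obtain B2 where B2: "B2 \<in> events" "prob B2 \<le> exp (- u)"
    "\<And>\<omega>. \<omega> \<in> space \<Omega> - B2 \<Longrightarrow> (\<Sum>i=1..<n. diagonal i (X i \<omega>) - (\<integral>x. diagonal i x \<partial>\<pi>)) \<le> ?D"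
    using diagonal_tail[OF u] by blast
  have AR: "AE \<omega> in \<Omega>. \<bar>remainder \<omega>\<bar> \<le> n\<^sup>2 * \<epsilon>" by (rule remainder_AE_bound[OF R \<epsilon>])
  have intR: "\<bar>\<integral>\<omega>. remainder \<omega> \<partial>\<Omega>\<bar> \<le> n\<^sup>2 * \<epsilon>"
    by (rule abs_integral_le_bound[OF bounded_borel_measurable[OF remainder_bounded_borel] AR])
  have diag: "integrable \<Omega> (\<lambda>\<omega>. diagonal i (X i \<omega>))" if "i \<in> {1..<n}" for i
  proof -
    have "1 \<le> i" using that by simp
    then show ?thesis
      by (intro integrable_bounded_borel bounded_borel_H[OF bounded_borel_X[OF _ order_refl diagonal_bounded_borel]])
  qed
  have mean: "(\<integral>\<omega>. U \<omega> \<partial>\<Omega>) = (\<Sum>i=1..<n. \<integral>x. diagonal i x \<partial>\<pi>) + (\<integral>\<omega>. remainder \<omega> \<partial>\<Omega>)"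
  proof -
    note ints = integrable_bounded_borel[OF martingale_bounded_borel] Bochner_Integration.integrable_sum[OF diag]
      integrable_bounded_borel[OF remainder_bounded_borel]
    have "(\<integral>\<omega>. U \<omega> \<partial>\<Omega>) = (\<integral>\<omega>. martingale \<omega> + (\<Sum>i=1..<n. diagonal i (X i \<omega>)) + remainder \<omega> \<partial>\<Omega>)"
      by (intro Bochner_Integration.integral_cong refl decomposition)
    also have "\<dots> = (\<integral>\<omega>. martingale \<omega> \<partial>\<Omega>) + (\<integral>\<omega>. (\<Sum>i=1..<n. diagonal i (X i \<omega>)) \<partial>\<Omega>) + (\<integral>\<omega>. remainder \<omega> \<partial>\<Omega>)"
      by (simp only: Bochner_Integration.integral_add[OF Bochner_Integration.integrable_add[OF ints(1) ints(2)] ints(3)]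
          Bochner_Integration.integral_add[OF ints(1) ints(2)])
    also have "(\<integral>\<omega>. (\<Sum>i=1..<n. diagonal i (X i \<omega>)) \<partial>\<Omega>) = (\<Sum>i=1..<n. \<integral>\<omega>. diagonal i (X i \<omega>) \<partial>\<Omega>)"
      by (rule Bochner_Integration.integral_sum[OF diag])
    also have "\<dots> = (\<Sum>i=1..<n. \<integral>x. diagonal i x \<partial>\<pi>)"
      by (intro sum.cong refl integral_X diagonal_bounded_borel) simp
    finally show ?thesis by (simp add: integral_martingale)
  qed
  note [measurable] = bounded_borel_measurable[OF remainder_bounded_borel] bounded_borel_measurable[OF U_bounded_borel]
  let ?B3 = "{\<omega> \<in> space \<Omega>. \<not> \<bar>remainder \<omega>\<bar> \<le> n\<^sup>2 * \<epsilon>}"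
  have B3: "?B3 \<in> events" by measurable
  have B30: "prob ?B3 = 0"
    using AR B3 by (simp add: AE_iff_measurable[OF B3] emeasure_eq_measure)
  let ?good = "{\<omega> \<in> space \<Omega>. U \<omega> - (\<integral>\<omega>. U \<omega> \<partial>\<Omega>) \<le> ?M + ?D + ?R}"
  have good: "?good \<in> events" by measurable
  have "space \<Omega> - ?good \<subseteq> B1 \<union> B2 \<union> ?B3"
  proof
    fix \<omega> assume \<omega>: "\<omega> \<in> space \<Omega> - ?good"
    show "\<omega> \<in> B1 \<union> B2 \<union> ?B3"
    proof (rule ccontr)
      assume "\<omega> \<notin> B1 \<union> B2 \<union> ?B3"
      then have o: "\<omega> \<in> space \<Omega> - B1" "\<omega> \<in> space \<Omega> - B2" "\<bar>remainder \<omega>\<bar> \<le> n\<^sup>2 * \<epsilon>" using \<omega> by auto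
      have "U \<omega> - (\<integral>\<omega>. U \<omega> \<partial>\<Omega>) = martingale \<omega> +
          (\<Sum>i=1..<n. diagonal i (X i \<omega>) - (\<integral>x. diagonal i x \<partial>\<pi>)) + (remainder \<omega> - (\<integral>\<omega>. remainder \<omega> \<partial>\<Omega>))"
        using decomposition[of \<omega>] \<omega> by (simp add: mean sum_subtractf)
      also have "\<dots> \<le> ?M + ?D + ?R"
        using B1(3)[OF o(1)] B2(3)[OF o(2)] o(3) intR by linarith
      finally show False using \<omega> by simp
    qed
  qed
  then have "prob (space \<Omega> - ?good) \<le> prob (B1 \<union> B2 \<union> ?B3)"
    using B1(1) B2(1) B3 by (intro finite_measure_mono) auto
  also have "\<dots> \<le> prob B1 + prob B2 + prob ?B3"
    using measure_Un_le[of "B1 \<union> B2" \<Omega> ?B3] measure_Un_le[of B1 \<Omega> B2] B1(1) B2(1) B3 by auto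
  also have "\<dots> \<le> (2 + 2 * exp 2 * \<delta>\<^sub>M) * exp (- u)"
    using B1(2) B2(2) B30 by (simp add: algebra_simps)
  finally show ?thesis using prob_compl[OF good] by linarith
qed

end

section \<open>Total variation and the parameters of the bound\<close>

lemma tv_dist_ge:
  assumes "prob_space M" "prob_space N" "D \<in> sets M"
  shows "\<bar>measure M D - measure N D\<bar> \<le> tv_dist M N"
  unfolding tv_dist_def
proof (rule cSUP_upper[OF assms(3)])
  show "bdd_above ((\<lambda>D. \<bar>measure M D - measure N D\<bar>) ` sets M)"
    using prob_space.prob_le_1[OF assms(1)] prob_space.prob_le_1[OF assms(2)]
    by (intro bdd_aboveI2[of _ _ 1]) (smt (verit) measure_nonneg)
qed

text \<open>A function with values in \<open>[0, 1]\<close> is, up to \<open>1 / N\<close>, an average of \<open>N\<close> indicators of its level sets.\<close>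

lemma level_average:
  fixes x :: real
  assumes "0 \<le> x" "x \<le> 1" and N: "N \<ge> 1"
  defines "s \<equiv> (\<Sum>k=1..N. if real k / N \<le> x then 1 else 0) / real N"
  shows "s \<le> x" "x \<le> s + 1 / N"
proof -
  define f where "f = nat \<lfloor>real N * x\<rfloor>"
  have f: "real f \<le> N * x" "N * x < real f + 1" using assms(1) N by (auto simp: f_def)
  have "real N * x \<le> real N * 1" using assms(2) by (intro mult_left_mono) auto
  then have "real f \<le> real N" using f(1) by linarith
  then have fN: "f \<le> N" by simp
  have iff: "real k / N \<le> x \<longleftrightarrow> k \<le> f" for k
  proof -
    have "real k / N \<le> x \<longleftrightarrow> real k \<le> N * x" using N by (simp add: field_simps)
    also have "\<dots> \<longleftrightarrow> k \<le> f"
    proof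
      assume "real k \<le> N * x"
      then have "real k < real f + 1" using f(2) by linarith
      then show "k \<le> f" by linarith
    next
      assume "k \<le> f"
      then have "real k \<le> real f" by simp
      then show "real k \<le> N * x" using f(1) by linarith
    qed
    finally show ?thesis .
  qed
  have "(\<Sum>k=1..N. if real k / N \<le> x then 1 else 0 :: real) = (\<Sum>k=1..f. 1)"
    unfolding iff using fN by (intro sum.mono_neutral_cong_right) auto
  then have s: "s = real f / N" unfolding s_def by simp
  have "real f / real N \<le> x" using f(1) N by (simp add: field_simps)
  then show "s \<le> x" unfolding s .
  have "x \<le> (real f + 1) / real N" using f(2) N by (simp add: pos_le_divide_eq mult.commute)
  then show "x \<le> s + 1 / real N" unfolding s add_divide_distrib .
qed

lemma integral_diff_le_tv_unit:
  fixes g :: "'a \<Rightarrow> real"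
  assumes M: "prob_space M" and N: "prob_space N" and s: "sets M = sets N"
    and g: "g \<in> bounded_borel M" and range: "\<And>x. x \<in> space M \<Longrightarrow> 0 \<le> g x \<and> g x \<le> 1"
  shows "\<bar>(\<integral>x. g x \<partial>M) - (\<integral>x. g x \<partial>N)\<bar> \<le> tv_dist M N"
proof (rule field_le_epsilon)
  fix e :: real assume e: "e > 0"
  interpret M: prob_space M by fact
  interpret N: prob_space N by fact
  have sp: "space N = space M" by (rule sets_eq_imp_space_eq[OF s[symmetric]])
  obtain n :: nat where n: "n \<ge> 1" "1 / n \<le> e"
  proof -
    obtain n where "inverse (real (Suc n)) < e" using reals_Archimedean[OF e] by blast
    then show ?thesis by (intro that[of "Suc n"]) (simp_all add: inverse_eq_divide)
  qed
  let ?D = "\<lambda>k. {x \<in> space M. real k / n \<le> g x}"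
  define f where "f = (\<lambda>x. (\<Sum>k=1..n. indicator (?D k) x) / real n :: real)"
  note [measurable] = bounded_borel_measurable[OF g]
  have D: "?D k \<in> sets M" for k by measurable
  then have DN: "?D k \<in> sets N" for k using s by simp
  have int: "integrable M (indicator (?D k) :: _ \<Rightarrow> real)" "integrable N (indicator (?D k) :: _ \<Rightarrow> real)" for k
    using D DN by (simp_all add: M.emeasure_finite N.emeasure_finite less_top[symmetric])
  have intf: "integrable M f" "integrable N f"
    unfolding f_def by (intro integrable_divide Bochner_Integration.integrable_sum int)+
  have intg: "integrable M g" "integrable N g"
    using g M.integrable_bounded_borel N.integrable_bounded_borel bounded_borel_cong_sets[OF s] by auto
  have near: "f x \<le> g x" "g x \<le> f x + 1 / n" if "x \<in> space M" for x
  proof -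
    have "f x = (\<Sum>k=1..n. if real k / real n \<le> g x then 1 else 0) / real n"
      unfolding f_def using that by (intro arg_cong[where f = "\<lambda>s. s / real n"] sum.cong) auto
    then show "f x \<le> g x" "g x \<le> f x + 1 / n"
      using level_average[of "g x" n] range[OF that] n(1) by (simp_all only:)
  qed
  have "(\<integral>x. f x \<partial>M) \<le> (\<integral>x. g x \<partial>M)"
    by (rule integral_mono[OF intf(1) intg(1)]) (rule near)
  moreover have "(\<integral>x. g x \<partial>M) \<le> (\<integral>x. f x + 1 / n \<partial>M)"
    by (rule integral_mono[OF intg(1)]) (use intf near in simp_all)
  moreover have "(\<integral>x. f x \<partial>N) \<le> (\<integral>x. g x \<partial>N)"
    by (rule integral_mono[OF intf(2) intg(2)]) (simp only: sp near)
  moreover have "(\<integral>x. g x \<partial>N) \<le> (\<integral>x. f x + 1 / n \<partial>N)"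
    by (rule integral_mono[OF intg(2)]) (use intf near sp in simp_all)
  moreover have "(\<integral>x. f x + 1 / n \<partial>M) = (\<integral>x. f x \<partial>M) + 1 / n" "(\<integral>x. f x + 1 / n \<partial>N) = (\<integral>x. f x \<partial>N) + 1 / n"
    using intf by (simp_all add: M.prob_space N.prob_space)
  moreover have "\<bar>(\<integral>x. f x \<partial>M) - (\<integral>x. f x \<partial>N)\<bar> \<le> tv_dist M N"
  proof -
    have "(\<integral>x. f x \<partial>M) = (\<Sum>k=1..n. measure M (?D k)) / n" "(\<integral>x. f x \<partial>N) = (\<Sum>k=1..n. measure N (?D k)) / n"
    proof -
      have iM: "integral\<^sup>L M (indicator (?D k) :: _ \<Rightarrow> real) = measure M (?D k)" for k
        using sets.Int_space_eq2[OF D[of k]] by simp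
      have iN: "integral\<^sup>L N (indicator (?D k) :: _ \<Rightarrow> real) = measure N (?D k)" for k
        using sets.Int_space_eq2[OF DN[of k]] by simp
      show "(\<integral>x. f x \<partial>M) = (\<Sum>k=1..n. measure M (?D k)) / n" "(\<integral>x. f x \<partial>N) = (\<Sum>k=1..n. measure N (?D k)) / n"
        unfolding f_def by (simp_all only: Bochner_Integration.integral_divide_zero
            Bochner_Integration.integral_sum[OF int(1)] Bochner_Integration.integral_sum[OF int(2)] iM iN)
    qed
    then have "\<bar>(\<integral>x. f x \<partial>M) - (\<integral>x. f x \<partial>N)\<bar> = \<bar>\<Sum>k=1..n. measure M (?D k) - measure N (?D k)\<bar> / n"
      by (simp add: sum_subtractf diff_divide_distrib[symmetric])
    also have "\<dots> \<le> (\<Sum>k=1..n. tv_dist M N) / n"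
      by (intro divide_right_mono order_trans[OF sum_abs] sum_mono tv_dist_ge[OF M N D]) simp
    also have "\<dots> = tv_dist M N" using n(1) by simp
    finally show ?thesis .
  qed
  ultimately show "\<bar>(\<integral>x. g x \<partial>M) - (\<integral>x. g x \<partial>N)\<bar> \<le> tv_dist M N + e"
    using n(2) by linarith
qed

text \<open>The factor \<open>2 a\<close> is the length of the interval that the affine change to \<open>[0, 1]\<close> rescales.\<close>

lemma integral_diff_le_tv:
  fixes f :: "'a \<Rightarrow> real"
  assumes M: "prob_space M" and N: "prob_space N" and s: "sets M = sets N"
    and f: "f \<in> bounded_borel M" and bound: "\<And>x. x \<in> space M \<Longrightarrow> \<bar>f x\<bar> \<le> a" and a: "a > 0"
  shows "\<bar>(\<integral>x. f x \<partial>M) - (\<integral>x. f x \<partial>N)\<bar> \<le> 2 * a * tv_dist M N"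
proof -
  interpret M: prob_space M by fact
  interpret N: prob_space N by fact
  let ?g = "\<lambda>x. (f x + a) / (2 * a)"
  have int: "integrable M f" "integrable N f"
    using f M.integrable_bounded_borel N.integrable_bounded_borel bounded_borel_cong_sets[OF s] by auto
  have "\<bar>(\<integral>x. ?g x \<partial>M) - (\<integral>x. ?g x \<partial>N)\<bar> \<le> tv_dist M N"
  proof (rule integral_diff_le_tv_unit[OF M N s])
    show "?g \<in> bounded_borel M" by (intro bounded_borel_intros f)
    fix x assume "x \<in> space M"
    then show "0 \<le> ?g x \<and> ?g x \<le> 1" using bound[of x] a by (auto simp: abs_le_iff field_simps)
  qed
  also have "(\<integral>x. ?g x \<partial>M) - (\<integral>x. ?g x \<partial>N) = ((\<integral>x. f x \<partial>M) - (\<integral>x. f x \<partial>N)) / (2 * a)"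
    using int by (simp add: M.prob_space N.prob_space diff_divide_distrib add_divide_distrib)
  finally show ?thesis using a by (simp add: abs_divide field_simps)
qed

lemma (in stationary_chain) T_near_mean:
  assumes y: "y \<in> space E" and f: "f \<in> bounded_borel E" "\<And>x. x \<in> space E \<Longrightarrow> \<bar>f x\<bar> \<le> a" "a > 0"
    and mean: "(\<integral>x. f x \<partial>\<pi>) = 0"
  shows "\<bar>T k f y\<bar> \<le> 2 * a * tv_dist (kernel_pow E P k y) \<pi>"
  using integral_diff_le_tv[OF kernel_powD(1)[OF y] \<pi>.prob_space_axioms, of k f a] f mean
  by (simp add: T_def kernel_powD[OF y])

lemma sup_norm_upper:
  assumes "bounded_kernel E g" "x \<in> space E" "y \<in> space E"
  shows "\<bar>g x y\<bar> \<le> sup_norm E g"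
proof -
  obtain b where b: "\<And>x y. x \<in> space E \<Longrightarrow> y \<in> space E \<Longrightarrow> \<bar>g x y\<bar> \<le> b"
    using assms(1) unfolding bounded_kernel_def by blast
  have "bdd_above ((\<lambda>(x, y). \<bar>g x y\<bar>) ` (space E \<times> space E))"
    by (rule bdd_aboveI[of _ b]) (auto intro: b)
  from cSUP_upper[OF _ this, of "(x, y)"] assms(2,3) show ?thesis unfolding sup_norm_def by simp
qed

lemma A_const_upper:
  assumes "i \<in> {1..n}" "j \<in> {1..n}" shows "2 * sup_norm E (h i j) \<le> A_const E h n"
proof -
  have "sup_norm E (h i j) \<le> (MAX (i, j)\<in>{1..n} \<times> {1..n}. sup_norm E (h i j))"
    by (rule Max_ge) (use assms in force)+
  then show ?thesis unfolding A_const_def by simp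
qed

context stationary_chain
begin

lemma canonical_mean:
  assumes "canonical E \<pi> g" and x: "x \<in> space E"
  shows "(\<integral>z. g z x \<partial>\<pi>) = canonical_mean E \<pi> g" "(\<integral>z. g x z \<partial>\<pi>) = canonical_mean E \<pi> g"
proof -
  let ?Q = "\<lambda>c. \<forall>x\<in>space E. (\<integral>z. g z x \<partial>\<pi>) = c \<and> (\<integral>z. g x z \<partial>\<pi>) = c"
  have Q: "?Q (\<integral>z. g z x \<partial>\<pi>)" using assms unfolding canonical_def by metis
  have "?Q (canonical_mean E \<pi> g)"
    unfolding canonical_mean_def by (rule theI[of ?Q, OF Q]) (use x in metis)
  then show "(\<integral>z. g z x \<partial>\<pi>) = canonical_mean E \<pi> g" "(\<integral>z. g x z \<partial>\<pi>) = canonical_mean E \<pi> g"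
    using x by auto
qed

lemma canonical_family_kernel:
  assumes h: "canonical_family E \<pi> n h" and ij: "i \<in> {1..n}" "j \<in> {1..n}"
  shows "(\<lambda>(x, y). h i j x y) \<in> bounded_borel (E \<Otimes>\<^sub>M E)" "bounded_kernel E (h i j)" "canonical E \<pi> (h i j)"
proof -
  show b: "bounded_kernel E (h i j)" "canonical E \<pi> (h i j)"
    using h ij unfolding canonical_family_def by auto
  have m: "(\<lambda>(x, y). h i j x y) \<in> borel_measurable (E \<Otimes>\<^sub>M E)"
    using h ij unfolding canonical_family_def by auto
  show "(\<lambda>(x, y). h i j x y) \<in> bounded_borel (E \<Otimes>\<^sub>M E)"
    using sup_norm_upper[OF b(1)] by (intro bounded_borelI[OF m]) (auto simp: space_pair_measure)
qed

lemma centred_kernel: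
  assumes h: "canonical_family E \<pi> n h" and ij: "i \<in> {1..n}" "j \<in> {1..n}"
  shows "(\<lambda>(x, y). centred E \<pi> h i j x y) \<in> bounded_borel (E \<Otimes>\<^sub>M E)"
    and "\<And>x y. x \<in> space E \<Longrightarrow> y \<in> space E \<Longrightarrow> \<bar>centred E \<pi> h i j x y\<bar> \<le> A_const E h n"
    and "\<And>y. y \<in> space E \<Longrightarrow> (\<integral>x. centred E \<pi> h i j x y \<partial>\<pi>) = 0"
    and "\<And>x. x \<in> space E \<Longrightarrow> (\<integral>y. centred E \<pi> h i j x y \<partial>\<pi>) = 0"
proof -
  note hb = canonical_family_kernel[OF h ij]
  let ?c = "canonical_mean E \<pi> (h i j)"
  show "(\<lambda>(x, y). centred E \<pi> h i j x y) \<in> bounded_borel (E \<Otimes>\<^sub>M E)"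
    using hb(1) unfolding centred_def case_prod_beta' by (intro bounded_borel_intros)
  have int: "integrable \<pi> (\<lambda>x. h i j x y)" "integrable \<pi> (h i j y)" if "y \<in> space E" for y
    using bounded_borel_section'[OF hb(1) that] bounded_borel_section[OF hb(1) that]
    by (simp_all add: \<pi>.integrable_bounded_borel)
  show "(\<integral>x. centred E \<pi> h i j x y \<partial>\<pi>) = 0" if "y \<in> space E" for y
    unfolding centred_def using int[OF that] canonical_mean(1)[OF hb(3) that] \<pi>.prob_space by simp
  show "(\<integral>y. centred E \<pi> h i j x y \<partial>\<pi>) = 0" if "x \<in> space E" for x
    unfolding centred_def using int[OF that] canonical_mean(2)[OF hb(3) that] \<pi>.prob_space by simp
  fix x y assume xy: "x \<in> space E" "y \<in> space E"
  have "\<bar>\<integral>z. h i j x z \<partial>\<pi>\<bar> \<le> sup_norm E (h i j)"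
    using int(2)[OF xy(1)] sup_norm_upper[OF hb(2) xy(1)]
    by (intro \<pi>.abs_integral_le_bound) (auto intro!: AE_I2)
  then have "\<bar>?c\<bar> \<le> sup_norm E (h i j)" by (simp only: canonical_mean(2)[OF hb(3) xy(1)])
  then show "\<bar>centred E \<pi> h i j x y\<bar> \<le> A_const E h n"
    unfolding centred_def using sup_norm_upper[OF hb(2) xy] A_const_upper[OF ij, of E h] by linarith
qed

lemma A_const_nonneg:
  assumes h: "canonical_family E \<pi> n h" and n: "n \<ge> 1" shows "A_const E h n \<ge> 0"
proof -
  obtain x where x: "x \<in> space E" using space_E_nonempty by blast
  have i: "1 \<in> {1..n}" using n by simp
  from centred_kernel(2)[OF h i i x x] show ?thesis by linarith
qed

text \<open>The suprema in the definition are finite because the kernels are bounded; the sums below enter through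
  the second maximum, and the overall maximum is nonnegative, so that squaring undoes the root.\<close>

lemma B_const_upper:
  assumes h: "canonical_family E \<pi> n h" and k: "k \<le> t_bound r n" and j: "j \<in> {1..n}" and y: "y \<in> space E"
  shows "(\<Sum>i=1..j - 1. \<integral>x. (T k (centred E \<pi> h i j x) y)\<^sup>2 \<partial>\<pi>) \<le> (B_const E P \<pi> \<nu> r h n)\<^sup>2"
    and "B_const E P \<pi> \<nu> r h n \<ge> 0"
proof -
  let ?A = "A_const E h n"
  define f where "f = (\<lambda>k j y. \<Sum>i=1..j - 1. \<integral>x. (T k (centred E \<pi> h i j x) y)\<^sup>2 \<partial>\<pi>)"
  define M where "M = (MAX k\<in>{0..t_bound r n}. MAX j\<in>{1..n}. SUP y\<in>space E. f k j y)"
  have bdd: "bdd_above ((\<lambda>y. f k j y) ` space E)" if j: "j \<in> {1..n}" for k j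
  proof (rule bdd_aboveI2)
    fix y assume y: "y \<in> space E"
    show "f k j y \<le> (\<Sum>i=1..j - 1. ?A\<^sup>2)"
      unfolding f_def
    proof (rule sum_mono)
      fix i assume "i \<in> {1..j - 1}"
      then have i: "i \<in> {1..n}" using j by auto
      note c = centred_kernel[OF h i j]
      have "\<bar>\<integral>x. (T k (centred E \<pi> h i j x) y)\<^sup>2 \<partial>\<pi>\<bar> \<le> ?A\<^sup>2"
      proof (rule \<pi>.abs_integral_le_bound)
        have "(\<lambda>x. T k (centred E \<pi> h i j x) y) \<in> bounded_borel E"
          using T_kernel_bounded_borel[OF c(1) measurable_const[OF y], of k] by simp
        then show "(\<lambda>x. (T k (centred E \<pi> h i j x) y)\<^sup>2) \<in> borel_measurable \<pi>"
          by (intro bounded_borel_measurable) (simp add: bounded_borel_power)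
        show "AE x in \<pi>. \<bar>(T k (centred E \<pi> h i j x) y)\<^sup>2\<bar> \<le> ?A\<^sup>2"
        proof (rule AE_I2)
          fix x assume "x \<in> space \<pi>"
          then have x: "x \<in> space E" by simp
          have "\<bar>T k (centred E \<pi> h i j x) y\<bar> \<le> ?A"
            by (rule T_abs_le[OF y bounded_borel_section[OF c(1) x] c(2)[OF x]])
          from power_mono[OF this, of 2] show "\<bar>(T k (centred E \<pi> h i j x) y)\<^sup>2\<bar> \<le> ?A\<^sup>2" by simp
        qed
      qed
      then show "(\<integral>x. (T k (centred E \<pi> h i j x) y)\<^sup>2 \<partial>\<pi>) \<le> ?A\<^sup>2" by linarith
    qed
  qed
  have le: "f k j y \<le> M" if "k \<le> t_bound r n" "j \<in> {1..n}" "y \<in> space E" for k j y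
  proof -
    have "f k j y \<le> (SUP y\<in>space E. f k j y)" by (rule cSUP_upper[OF that(3) bdd[OF that(2)]])
    also have "\<dots> \<le> (MAX j\<in>{1..n}. SUP y\<in>space E. f k j y)" by (rule Max_ge) (use that in auto)
    also have "\<dots> \<le> M" unfolding M_def by (rule Max_ge) (use that in auto)
    finally show ?thesis .
  qed
  have f0: "0 \<le> f k j y" unfolding f_def by (intro sum_nonneg Bochner_Integration.integral_nonneg) simp
  have M0: "0 \<le> M" using f0 le[OF k j y] by linarith
  have B: "B_const E P \<pi> \<nu> r h n = sqrt (max
      (MAX k\<in>{0..t_bound r n}. MAX i\<in>{1..n}. SUP x\<in>space E.
        \<Sum>j=i+1..n. \<integral>x'. (\<integral>z. centred E \<pi> h i j x z \<partial>kernel_pow E P k x')\<^sup>2 \<partial>\<nu>) M)"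
    unfolding B_const_def M_def f_def T_def ..
  show "B_const E P \<pi> \<nu> r h n \<ge> 0" unfolding B using M0 by simp
  have "(B_const E P \<pi> \<nu> r h n)\<^sup>2 \<ge> M" unfolding B using M0 by simp
  with le[OF k j y] show "(\<Sum>i=1..j - 1. \<integral>x. (T k (centred E \<pi> h i j x) y)\<^sup>2 \<partial>\<pi>) \<le> (B_const E P \<pi> \<nu> r h n)\<^sup>2"
    unfolding f_def by linarith
qed

end

section \<open>The concentration inequality\<close>

lemma U_stat_eq:
  assumes int: "\<And>i j. 1 \<le> i \<Longrightarrow> i < j \<Longrightarrow> j \<le> n \<Longrightarrow> integrable \<Omega> (\<lambda>\<omega>. q i j (X i \<omega>) (X j \<omega>))"
    and eq: "\<And>i j x y. 1 \<le> i \<Longrightarrow> i < j \<Longrightarrow> j \<le> n \<Longrightarrow> q i j x y = h i j x y - c i j"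
    and \<Omega>: "prob_space \<Omega>"
  shows "U_stat \<Omega> X h n \<omega> = (\<Sum>i=1..<n. \<Sum>k=i..<n. q i (Suc k) (X i \<omega>) (X (Suc k) \<omega>)) -
    (\<integral>\<omega>. (\<Sum>i=1..<n. \<Sum>k=i..<n. q i (Suc k) (X i \<omega>) (X (Suc k) \<omega>)) \<partial>\<Omega>)"
proof -
  interpret prob_space \<Omega> by fact
  let ?q = "\<lambda>i k \<omega>. q i (Suc k) (X i \<omega>) (X (Suc k) \<omega>)"
  have intk: "integrable \<Omega> (?q i k)" if "i \<in> {1..<n}" "k \<in> {i..<n}" for i k
    using that by (intro int) auto
  have mean: "(\<integral>\<omega>. (\<Sum>i=1..<n. \<Sum>k=i..<n. ?q i k \<omega>) \<partial>\<Omega>) = (\<Sum>i=1..<n. \<Sum>k=i..<n. \<integral>\<omega>. ?q i k \<omega> \<partial>\<Omega>)"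
  proof (subst Bochner_Integration.integral_sum)
    fix i assume "i \<in> {1..<n}"
    then show "integrable \<Omega> (\<lambda>\<omega>. \<Sum>k=i..<n. ?q i k \<omega>)"
      by (intro Bochner_Integration.integrable_sum intk)
  next
    show "(\<Sum>i=1..<n. \<integral>\<omega>. (\<Sum>k=i..<n. ?q i k \<omega>) \<partial>\<Omega>) = (\<Sum>i=1..<n. \<Sum>k=i..<n. \<integral>\<omega>. ?q i k \<omega> \<partial>\<Omega>)"
      by (intro sum.cong refl Bochner_Integration.integral_sum intk)
  qed
  have "U_stat \<Omega> X h n \<omega> = (\<Sum>(i, k)\<in>(SIGMA i:{1..<n}. {i..<n}). ?q i k \<omega> - (\<integral>\<omega>. ?q i k \<omega> \<partial>\<Omega>))"
    unfolding U_stat_def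
  proof (rule sum.reindex_bij_witness[of _ "\<lambda>(i, k). (i, Suc k)" "\<lambda>(i, j). (i, j - 1)"])
    fix z assume "z \<in> {(i, j). 1 \<le> i \<and> i < j \<and> j \<le> n}"
    then obtain i j where z: "z = (i, j)" and ij: "1 \<le> i" "i < j" "j \<le> n" by auto
    have hq: "h i j x y = q i j x y + c i j" for x y using eq[OF ij, of x y] by simp
    have "(\<integral>\<omega>. h i j (X i \<omega>) (X j \<omega>) \<partial>\<Omega>) = (\<integral>\<omega>. q i j (X i \<omega>) (X j \<omega>) \<partial>\<Omega>) + c i j"
      unfolding hq using int[OF ij] by (simp add: prob_space)
    then show "(case case z of (i, j) \<Rightarrow> (i, j - 1) of (i, k) \<Rightarrow> ?q i k \<omega> - (\<integral>\<omega>. ?q i k \<omega> \<partial>\<Omega>)) =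
        (case z of (i, j) \<Rightarrow> h i j (X i \<omega>) (X j \<omega>) - (\<integral>\<omega>'. h i j (X i \<omega>') (X j \<omega>') \<partial>\<Omega>))"
      using ij unfolding z by (simp add: hq)
  qed auto
  also have "\<dots> = (\<Sum>i=1..<n. \<Sum>k=i..<n. ?q i k \<omega> - (\<integral>\<omega>. ?q i k \<omega> \<partial>\<Omega>))"
    by (rule sum.Sigma[symmetric]) auto
  finally show ?thesis unfolding mean by (simp only: sum_subtractf)
qed

text \<open>The comparison of the bound with the right-hand side; \<open>l\<close> stands for \<open>ln n\<close>, \<open>s\<close> for the square root
  of \<open>n\<close> and \<open>v\<close> for that of \<open>u\<close>.\<close>

lemma bound_le_U_bound:
  fixes A B L c g l q s u v \<tau> :: real
  assumes nn: "A \<ge> 0" "B \<ge> 0" "L \<ge> 0" "c \<ge> 0" "g \<ge> 0" "q \<ge> 0" "s \<ge> 0" "u \<ge> 0" "v \<ge> 0"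
    and l: "1 / 2 \<le> l" and \<tau>: "\<tau> \<le> c * l"
  shows "4 * q * \<tau> * (g * A * s * (u * v) + B * s * u) + 4 * g * \<tau> * A * (u + s * v) + 4 * A * L \<le>
    (4 * q * c * (g + 1) + 8 * g * c + 16 * L) * l *
      ((0 + A * l * s) * v + (A + B * s) * u + 2 * A * s * (u * v) + A * (u\<^sup>2 + l))"
    (is "?L \<le> ?\<kappa> * l * ?R")
proof -
  have l0: "0 \<le> l" using l by simp
  define e1 where "e1 = A * s * (u * v)"
  define e2 where "e2 = B * s * u"
  define e3 where "e3 = A * u"
  define e4 where "e4 = A * l * s * v"
  define e5 where "e5 = A * l"
  have e: "0 \<le> e1" "0 \<le> e2" "0 \<le> e3" "0 \<le> e4" "0 \<le> e5"
    unfolding e1_def e2_def e3_def e4_def e5_def using nn l0 by simp_all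
  have \<kappa>: "4 * q * c * g \<le> ?\<kappa>" "4 * q * c \<le> ?\<kappa>" "4 * g * c \<le> ?\<kappa>" "8 * g * c \<le> ?\<kappa>" "16 * L \<le> ?\<kappa>" "0 \<le> ?\<kappa>"
  proof -
    have "0 \<le> q * c * g" "0 \<le> q * c" "0 \<le> g * c" using nn by simp_all
    then show "4 * q * c * g \<le> ?\<kappa>" "4 * q * c \<le> ?\<kappa>" "4 * g * c \<le> ?\<kappa>" "8 * g * c \<le> ?\<kappa>" "16 * L \<le> ?\<kappa>" "0 \<le> ?\<kappa>"
      using nn(3) by (simp_all add: distrib_left mult.commute mult.left_commute)
  qed
  have half: "A * s * v \<le> 2 * e4"
  proof -
    have "A * s * v * 1 \<le> A * s * v * (2 * l)" using nn l by (intro mult_left_mono) auto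
    then show ?thesis unfolding e4_def by (simp add: mult_ac)
  qed
  have quarter: "4 * A * L \<le> l * (16 * L * e5)"
  proof -
    have "1 / 2 * (1 / 2) \<le> l * l" using l by (intro mult_mono) auto
    then have "4 * A * L * 1 \<le> 4 * A * L * (4 * (l * l))" using nn by (intro mult_left_mono) auto
    then show ?thesis unfolding e5_def by (simp add: mult_ac)
  qed
  have "?L = \<tau> * (4 * q * g * e1 + 4 * q * e2 + 4 * g * e3 + 4 * g * (A * s * v)) + 4 * A * L"
    unfolding e1_def e2_def e3_def by (simp add: algebra_simps)
  also have "\<dots> \<le> (c * l) * (4 * q * g * e1 + 4 * q * e2 + 4 * g * e3 + 4 * g * (A * s * v)) + l * (16 * L * e5)"
    using nn e by (intro add_mono mult_right_mono \<tau> quarter) simp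
  also have "\<dots> \<le> (c * l) * (4 * q * g * e1 + 4 * q * e2 + 4 * g * e3 + 4 * g * (2 * e4)) + l * (16 * L * e5)"
    using nn l0 by (intro add_right_mono mult_left_mono add_left_mono half) auto
  also have "\<dots> = l * ((4 * q * c * g) * e1 + (4 * q * c) * e2 + (4 * g * c) * e3 + (8 * g * c) * e4 + (16 * L) * e5)"
    by (simp add: algebra_simps)
  also have "\<dots> \<le> l * (?\<kappa> * e1 + ?\<kappa> * e2 + ?\<kappa> * e3 + ?\<kappa> * e4 + ?\<kappa> * e5)"
    by (intro mult_left_mono[OF _ l0] add_mono mult_right_mono \<kappa> e)
  also have "\<dots> = ?\<kappa> * l * (e1 + e2 + e3 + e4 + e5)"
    by (simp only: distrib_left mult.assoc mult.left_commute)
  also have "\<dots> \<le> ?\<kappa> * l * ?R"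
  proof (rule mult_left_mono)
    have "?R = e4 + e3 + e2 + 2 * e1 + A * u\<^sup>2 + e5"
      unfolding e1_def e2_def e3_def e4_def e5_def by (simp add: algebra_simps)
    moreover have "0 \<le> A * u\<^sup>2" using nn by simp
    ultimately show "e1 + e2 + e3 + e4 + e5 \<le> ?R" using e by linarith
  qed (use \<kappa>(6) l0 in simp)
  finally show ?thesis .
qed

text \<open>The lower bound on \<open>r\<close> is what makes \<open>t_bound r n + 1\<close> steps of the chain mix to precision \<open>n\<^sup>-\<^sup>2\<close>, which
  the \<open>n\<^sup>2\<close> terms of the remainder require.\<close>

lemma t_bound_estimates:
  assumes n: "n \<ge> 2" and \<rho>: "0 < \<rho>" "\<rho> < 1" and r: "r > 2 * inverse (ln (1 / \<rho>))"
  shows "real (Suc (t_bound r n)) \<le> (r + 2) * ln (real n)"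
    and "(real n)\<^sup>2 * \<rho> ^ Suc (t_bound r n) \<le> 1" and "1 / 2 \<le> ln (real n)"
proof -
  have ln2: "1 / 2 \<le> ln (2 :: real)" using ln_ge_iff[of 2 "1 / 2"] exp_half_le2 by simp
  have "ln 2 \<le> ln (real n)" using n by simp
  then show half: "1 / 2 \<le> ln (real n)" using ln2 by linarith
  have ln\<rho>: "ln (1 / \<rho>) > 0" using \<rho> by simp
  have "0 < 2 * inverse (ln (1 / \<rho>))" using ln\<rho> by simp
  then have r0: "r > 0" using r by linarith
  have pos: "r * ln (real n) \<ge> 0" using r0 half by simp
  have t: "real (t_bound r n) \<le> r * ln (real n)" "r * ln (real n) \<le> real (Suc (t_bound r n))"
  proof -
    have "real (t_bound r n) = of_int \<lfloor>r * ln (real n)\<rfloor>" unfolding t_bound_def using pos by simp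
    then show "real (t_bound r n) \<le> r * ln (real n)" "r * ln (real n) \<le> real (Suc (t_bound r n))" by linarith+
  qed
  show "real (Suc (t_bound r n)) \<le> (r + 2) * ln (real n)"
    using t(1) half by (simp add: distrib_right)
  have "2 < r * ln (1 / \<rho>)" using r ln\<rho> by (simp add: field_simps)
  then have "2 * ln (real n) \<le> r * ln (1 / \<rho>) * ln (real n)" using half by (intro mult_right_mono) auto
  also have "\<dots> = (r * ln (real n)) * ln (1 / \<rho>)" by simp
  also have "\<dots> \<le> real (Suc (t_bound r n)) * ln (1 / \<rho>)" using t(2) ln\<rho> by (intro mult_right_mono) auto
  finally have le: "2 * ln (real n) \<le> - (real (Suc (t_bound r n)) * ln \<rho>)" using \<rho> by (simp add: ln_div)
  have "(real n)\<^sup>2 * \<rho> ^ Suc (t_bound r n) = exp (2 * ln (real n)) * exp (real (Suc (t_bound r n)) * ln \<rho>)"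
    using n \<rho> by (simp only: exp_of_nat_mult exp_ln) (simp add: exp_double)
  also have "\<dots> = exp (2 * ln (real n) + real (Suc (t_bound r n)) * ln \<rho>)" by (rule exp_add[symmetric])
  also have "\<dots> \<le> exp 0" using le by (intro exp_le_cancel_iff[THEN iffD2]) linarith
  finally show "(real n)\<^sup>2 * \<rho> ^ Suc (t_bound r n) \<le> 1" by simp
qed

context dominated_chain
begin

text \<open>The numbers of \<open>U_tail\<close> for the centred kernels: \<open>T_near_mean\<close> turns the centring in the second argument
  and ergodicity into the bound on the remainder, \<open>B_const_upper\<close> supplies the variances.\<close>

lemma U_stat_concentration:
  assumes ergodic: "0 < \<rho>" "\<rho> < 1" "L > 0" "\<And>k. AE x in \<pi>. tv_dist (kernel_pow E P k x) \<pi> \<le> L * \<rho> ^ k"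
    and r: "r > 2 * inverse (ln (1 / \<rho>))"
    and n: "n \<ge> 2" and h: "canonical_family E \<pi> n h" and u: "u > 0"
  defines "\<kappa> \<equiv> 4 * (K * m\<^sup>2 + 1) * (r + 2) * (8 * m / \<delta> + 1) + 8 * (8 * m / \<delta>) * (r + 2) + 16 * L"
  shows "prob {\<omega> \<in> space \<Omega>. U_stat \<Omega> X h n \<omega> \<le>
      \<kappa> * ln (real n) * U_bound (A_const E h n) (B_const E P \<pi> \<nu> r h n) 0 n u} \<ge>
    1 - (2 + 2 * exp 2 * \<delta>\<^sub>M) * exp (- u)"
proof -
  define A where "A = A_const E h n"
  define B where "B = B_const E P \<pi> \<nu> r h n"
  define t where "t = t_bound r n"
  define p where "p = (\<lambda>i j x y. if i \<in> {1..n} \<and> j \<in> {1..n} then centred E \<pi> h i j x y else 0)"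
  note est = t_bound_estimates[OF n ergodic(1,2) r]
  have one: "1 \<in> {1..n}" using n by simp
  obtain x0 where x0: "x0 \<in> space E" using space_E_nonempty by blast
  have A: "A \<ge> 0" unfolding A_def by (rule A_const_nonneg[OF h]) (use n in simp)
  have B: "B \<ge> 0" unfolding B_def by (rule B_const_upper(2)[OF h _ one x0, of 0]) simp
  have r0: "r + 2 \<ge> 0"
  proof -
    have "0 < 2 * inverse (ln (1 / \<rho>))" using ergodic by simp
    then show ?thesis using r by linarith
  qed
  have q0: "K * m\<^sup>2 + 1 \<ge> 0" using K_pos by (intro add_nonneg_nonneg mult_nonneg_nonneg) auto
  have g0: "8 * m / \<delta> \<ge> 0" using \<delta> by simp
  have p_in: "p i j = centred E \<pi> h i j" if "i \<in> {1..n}" "j \<in> {1..n}" for i j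
    using that unfolding p_def by (intro ext) simp
  have p_out: "p i j = (\<lambda>_ _. 0)" if "\<not> (i \<in> {1..n} \<and> j \<in> {1..n})" for i j
    using that unfolding p_def by (intro ext) (simp only: if_False)
  have p: "(\<lambda>(x, y). p i j x y) \<in> bounded_borel (E \<Otimes>\<^sub>M E)" for i j
  proof (cases "i \<in> {1..n} \<and> j \<in> {1..n}")
    case True
    then show ?thesis using centred_kernel(1)[OF h] by (simp only: p_in)
  next
    case False
    show ?thesis unfolding p_out[OF False] case_prod_beta' by (rule bounded_borel_const)
  qed
  have p_bound: "\<bar>p i j x y\<bar> \<le> A" if "x \<in> space E" "y \<in> space E" for i j x y
    using centred_kernel(2)[OF h _ _ that, of i j] A unfolding p_def A_def by auto
  have p_left: "(\<integral>x. p i j x y \<partial>\<pi>) = 0" if "y \<in> space E" for i j y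
  proof (cases "i \<in> {1..n} \<and> j \<in> {1..n}")
    case True
    then show ?thesis using centred_kernel(3)[OF h _ _ that, of i j] by (simp only: p_in)
  next
    case False
    show ?thesis unfolding p_out[OF False] by simp
  qed
  have p_right: "(\<integral>y. p i j x y \<partial>\<pi>) = 0" if "x \<in> space E" for i j x
  proof (cases "i \<in> {1..n} \<and> j \<in> {1..n}")
    case True
    then show ?thesis using centred_kernel(4)[OF h _ _ that, of i j] by (simp only: p_in)
  next
    case False
    show ?thesis unfolding p_out[OF False] by simp
  qed
  define S where "S = (\<lambda>\<omega>. \<Sum>i=1..<n. \<Sum>k=i..<n. p i (Suc k) (X i \<omega>) (X (Suc k) \<omega>))"
  have pX: "(\<lambda>\<omega>. p i j (X i \<omega>) (X j \<omega>)) \<in> bounded_borel \<Omega>" if "1 \<le> i" "1 \<le> j" for i j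
    using bounded_borel_compose[OF p measurable_Pair[OF X_measurable[OF that(1)] X_measurable[OF that(2)]]] by simp
  have S: "S \<in> bounded_borel \<Omega>" unfolding S_def by (intro bounded_borel_sum pX) auto
  have U: "U_stat \<Omega> X h n \<omega> = S \<omega> - (\<integral>\<omega>. S \<omega> \<partial>\<Omega>)" for \<omega>
    unfolding S_def
  proof (rule U_stat_eq[where c = "\<lambda>i j. canonical_mean E \<pi> (h i j)"])
    show "integrable \<Omega> (\<lambda>\<omega>. p i j (X i \<omega>) (X j \<omega>))" if "1 \<le> i" "i < j" "j \<le> n" for i j
      using that by (intro integrable_bounded_borel pX) auto
    show "p i j x y = h i j x y - canonical_mean E \<pi> (h i j)" if "1 \<le> i" "i < j" "j \<le> n" for i j x y
      using that unfolding p_def centred_def by simp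
  qed (rule prob_space_axioms)
  let ?v = "sqrt u" and ?s = "sqrt (real n)" and ?l = "ln (real n)"
  have rhs: "U_bound A B 0 n u =
      (0 + A * ?l * ?s) * ?v + (A + B * ?s) * u + 2 * A * ?s * (u * ?v) + A * (u\<^sup>2 + ?l)"
  proof -
    have "u powr (3 / 2) = u powr (1 + 1 / 2)" by simp
    also have "\<dots> = u powr 1 * u powr (1 / 2)" by (rule powr_add)
    also have "\<dots> = u * ?v" using u by (simp add: powr_half_sqrt)
    finally show ?thesis unfolding U_bound_def by simp
  qed
  have "prob {\<omega> \<in> space \<Omega>. S \<omega> - (\<integral>\<omega>. S \<omega> \<partial>\<Omega>) \<le> \<kappa> * ?l * U_bound A B 0 n u} \<ge>
      1 - (2 + 2 * exp 2 * \<delta>\<^sub>M) * exp (- u)"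
  proof (cases "A = 0")
    case True
    \<comment> \<open>All kernels vanish on the state space, and so does the statistic; only the sign of the bound matters.\<close>
    have S0: "S \<omega> = 0" if "\<omega> \<in> space \<Omega>" for \<omega>
      unfolding S_def
    proof (intro sum.neutral ballI)
      fix i k assume "i \<in> {1..<n}" "k \<in> {i..<n}"
      then have "X i \<omega> \<in> space E" "X (Suc k) \<omega> \<in> space E" using that by (auto intro!: X_in_space)
      then show "p i (Suc k) (X i \<omega>) (X (Suc k) \<omega>) = 0" using p_bound[of "X i \<omega>" "X (Suc k) \<omega>"] True by simp
    qed
    have mean0: "(\<integral>\<omega>. S \<omega> \<partial>\<Omega>) = 0"
      using Bochner_Integration.integral_cong[OF refl S0, of \<Omega>] by simp
    have "U_bound A B 0 n u \<ge> 0" unfolding rhs using A B u est(3) by simp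
    moreover have "\<kappa> \<ge> 0"
    proof -
      have "0 \<le> 4 * q * c * (g + 1) + 8 * g * c + 16 * L" if "q \<ge> 0" "c \<ge> 0" "g \<ge> 0" for q c g :: real
        using that ergodic(3) by simp
      from this[OF q0 r0 g0] show ?thesis unfolding \<kappa>_def .
    qed
    ultimately have "0 \<le> \<kappa> * ?l * U_bound A B 0 n u" using est(3) by simp
    then have "{\<omega> \<in> space \<Omega>. S \<omega> - (\<integral>\<omega>. S \<omega> \<partial>\<Omega>) \<le> \<kappa> * ?l * U_bound A B 0 n u} = space \<Omega>"
      by (auto simp: S0 mean0)
    then show ?thesis using prob_space \<delta>\<^sub>M by simp
  next
    case False
    then have A0: "A > 0" using A by simp
    interpret D: degenerate_kernels \<Omega> E P X \<pi> \<mu> \<delta> m \<nu> \<delta>\<^sub>M p n t A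
    proof
      show "p i j x y = 0" if "n < j" for i j x y using that unfolding p_def by simp
    qed (use p p_bound p_left n A0 in auto)
    define \<epsilon> where "\<epsilon> = 2 * A * (L * \<rho> ^ Suc t)"
    have \<epsilon>: "\<epsilon> \<ge> 0" unfolding \<epsilon>_def using A ergodic by simp
    have n\<epsilon>: "(real n)\<^sup>2 * \<epsilon> \<le> 2 * A * L"
    proof -
      have "(real n)\<^sup>2 * \<epsilon> = 2 * A * L * ((real n)\<^sup>2 * \<rho> ^ Suc t)" unfolding \<epsilon>_def by (simp only: mult_ac)
      also have "\<dots> \<le> 2 * A * L * 1" using est(2) A ergodic unfolding t_def by (intro mult_left_mono) auto
      finally show ?thesis by simp
    qed
    have R: "AE y in \<pi>. \<forall>i j. \<forall>x\<in>space E. \<bar>T (Suc t) (p i j x) y\<bar> \<le> \<epsilon>"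
    proof (rule AE_mp[OF ergodic(4)[of "Suc t"]], intro AE_I2 impI allI ballI)
      fix y i j x assume "y \<in> space \<pi>" and tv: "tv_dist (kernel_pow E P (Suc t) y) \<pi> \<le> L * \<rho> ^ Suc t"
        and x: "x \<in> space E"
      then have y: "y \<in> space E" by simp
      have "\<bar>T (Suc t) (p i j x) y\<bar> \<le> 2 * A * tv_dist (kernel_pow E P (Suc t) y) \<pi>"
        by (rule T_near_mean[OF y bounded_borel_section[OF p x] p_bound[OF x] A0 p_right[OF x]])
      also have "\<dots> \<le> \<epsilon>" unfolding \<epsilon>_def using tv A by (intro mult_left_mono) auto
      finally show "\<bar>T (Suc t) (p i j x) y\<bar> \<le> \<epsilon>" .
    qed
    have V: "(\<Sum>i=1..j - 1. \<integral>x. (T k (p i j x) y)\<^sup>2 \<partial>\<pi>) \<le> B\<^sup>2"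
      if "j \<le> n" "k \<le> t" "y \<in> space E" for j k y
    proof (cases "j = 0")
      case False
      then have j: "j \<in> {1..n}" using that by simp
      have "(\<Sum>i=1..j - 1. \<integral>x. (T k (p i j x) y)\<^sup>2 \<partial>\<pi>) = (\<Sum>i=1..j - 1. \<integral>x. (T k (centred E \<pi> h i j x) y)\<^sup>2 \<partial>\<pi>)"
      proof (rule sum.cong[OF refl])
        fix i assume "i \<in> {1..j - 1}"
        then have "i \<in> {1..n}" using j by auto
        from p_in[OF this j] show "(\<integral>x. (T k (p i j x) y)\<^sup>2 \<partial>\<pi>) = (\<integral>x. (T k (centred E \<pi> h i j x) y)\<^sup>2 \<partial>\<pi>)"
          by simp
      qed
      also have "\<dots> \<le> B\<^sup>2" unfolding B_def
        by (rule B_const_upper(1)[OF h _ j that(3)]) (use that in \<open>simp add: t_def\<close>)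
      finally show ?thesis .
    qed simp
    let ?b = "4 * (K * m\<^sup>2 + 1) * D.\<tau> * (8 * m / \<delta> * A * ?s * (u * ?v) + B * ?s * u) +
      (32 * m / \<delta>) * D.\<tau> * A * (u + sqrt (n * u)) + 2 * (n\<^sup>2 * \<epsilon>)"
    have tail: "prob {\<omega> \<in> space \<Omega>. S \<omega> - (\<integral>\<omega>. S \<omega> \<partial>\<Omega>) \<le> ?b} \<ge> 1 - (2 + 2 * exp 2 * \<delta>\<^sub>M) * exp (- u)"
      using D.U_tail[OF V B u R \<epsilon>] unfolding D.U_def S_def by simp
    have "?b \<le> 4 * (K * m\<^sup>2 + 1) * D.\<tau> * (8 * m / \<delta> * A * ?s * (u * ?v) + B * ?s * u) +
        4 * (8 * m / \<delta>) * D.\<tau> * A * (u + ?s * ?v) + 4 * A * L"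
    proof -
      have "sqrt (n * u) = ?s * ?v" by (rule real_sqrt_mult)
      moreover have "32 * m / \<delta> = 4 * (8 * m / \<delta>)" by simp
      moreover have "2 * (real (n\<^sup>2) * \<epsilon>) \<le> 4 * A * L"
        unfolding of_nat_power using n\<epsilon> by linarith
      ultimately show ?thesis by (simp only: add_left_mono)
    qed
    also have "\<dots> \<le> \<kappa> * ?l * U_bound A B 0 n u"
      unfolding rhs \<kappa>_def
    proof (rule bound_le_U_bound)
      show "D.\<tau> \<le> (r + 2) * ?l" unfolding D.\<tau>_def unfolding t_def by (rule est(1))
    qed (use A B ergodic(3) r0 g0 q0 u est(3) in simp_all)
    finally have b: "?b \<le> \<kappa> * ?l * U_bound A B 0 n u" .
    note [measurable] = bounded_borel_measurable[OF S]
    have "prob {\<omega> \<in> space \<Omega>. S \<omega> - (\<integral>\<omega>. S \<omega> \<partial>\<Omega>) \<le> ?b} \<le>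
        prob {\<omega> \<in> space \<Omega>. S \<omega> - (\<integral>\<omega>. S \<omega> \<partial>\<Omega>) \<le> \<kappa> * ?l * U_bound A B 0 n u}"
    proof (rule finite_measure_mono)
      show "{\<omega> \<in> space \<Omega>. S \<omega> - (\<integral>\<omega>. S \<omega> \<partial>\<Omega>) \<le> \<kappa> * ?l * U_bound A B 0 n u} \<in> events" by measurable
    qed (use b in auto)
    with tail show ?thesis by linarith
  qed
  then show ?thesis unfolding U A_def B_def .
qed

lemma U_stat_borel_measurable:
  assumes h: "canonical_family E \<pi> n h" shows "U_stat \<Omega> X h n \<in> borel_measurable \<Omega>"
  unfolding U_stat_def[abs_def] case_prod_beta'
proof (rule borel_measurable_sum)
  fix z assume "z \<in> {z. 1 \<le> fst z \<and> fst z < snd z \<and> snd z \<le> n}"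
  then have ij: "fst z \<in> {1..n}" "snd z \<in> {1..n}" by auto
  have "(\<lambda>\<omega>. h (fst z) (snd z) (X (fst z) \<omega>) (X (snd z) \<omega>)) \<in> bounded_borel \<Omega>"
    using bounded_borel_compose[OF canonical_family_kernel(1)[OF h ij] measurable_Pair[OF X_measurable X_measurable]] ij
    by simp
  from bounded_borel_measurable[OF this]
  show "(\<lambda>\<omega>. h (fst z) (snd z) (X (fst z) \<omega>) (X (snd z) \<omega>) -
      (\<integral>\<omega>'. h (fst z) (snd z) (X (fst z) \<omega>') (X (snd z) \<omega>') \<partial>\<Omega>)) \<in> borel_measurable \<Omega>" by measurable
qed

end

theorem theorem2:
  fixes \<Omega> :: "'w measure" and E :: "'a measure"
    and P :: "'a \<Rightarrow> 'a measure" and X :: "nat \<Rightarrow> 'w \<Rightarrow> 'a"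
    and \<psi> \<mu> \<nu> \<pi> :: "'a measure" and m :: nat and \<delta>\<^sub>m \<delta>\<^sub>M L \<rho> r :: real
  assumes chain: "markov_chain \<Omega> E P X"
    and irred: "maximal_irreducibility_measure E P \<psi>"
    and minor: "m \<ge> 1" "\<delta>\<^sub>m > 0" "prob_measure_on E \<mu>"
      "\<And>x D. x \<in> space E \<Longrightarrow> D \<in> sets E \<Longrightarrow>
         \<delta>\<^sub>m * measure \<mu> D \<le> measure (kernel_pow E P m x) D"
    and inv: "invariant_distribution E P \<pi>"
    and major: "\<delta>\<^sub>M > 0" "prob_measure_on E \<nu>"
      "\<And>x D. x \<in> space E \<Longrightarrow> D \<in> sets E \<Longrightarrow> measure (P x) D \<le> \<delta>\<^sub>M * measure \<nu> D"
    and stationary: "distr \<Omega> E (X 1) = \<pi>"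
    and ergodic: "0 < \<rho>" "\<rho> < 1" "L > 0"
      "\<And>k. AE x in \<pi>. tv_dist (kernel_pow E P k x) \<pi> \<le> L * \<rho> ^ k"
    and r: "r > 2 * inverse (ln (1 / \<rho>))"
  shows "\<exists>\<beta>>0. \<exists>\<kappa>>0. \<forall>n\<ge>2. \<forall>h. canonical_family E \<pi> n h \<longrightarrow> (\<forall>u>0.
     measure \<Omega> {\<omega> \<in> space \<Omega>. U_stat \<Omega> X h n \<omega> \<le>
         \<kappa> * ln (real n) *
           U_bound (A_const E h n) (B_const E P \<pi> \<nu> r h n) (C_const \<Omega> E X \<pi> \<nu> h n) n u}
       \<ge> 1 - \<beta> * exp (- u) * ln (real n) \<and>
     ((\<forall>i\<in>{1..n}. \<forall>j\<in>{1..n}. \<forall>x\<in>space E. \<forall>y\<in>space E. h i j x y = h 1 j x y) \<longrightarrow>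
       measure \<Omega> {\<omega> \<in> space \<Omega>. U_stat \<Omega> X h n \<omega> \<le>
           \<kappa> * ln (real n) *
             U_bound (A_const E h n) (B_const E P \<pi> \<nu> r h n) 0 n u}
         \<ge> 1 - \<beta> * exp (- u) * ln (real n)))"
proof -
  \<comment> \<open>A smaller minorization constant, so that it is below 1.\<close>
  define \<delta> where "\<delta> = min \<delta>\<^sub>m (1 / 2)"
  have \<delta>: "0 < \<delta>" "\<delta> < 1" "\<delta> \<le> \<delta>\<^sub>m" using minor(2) by (auto simp: \<delta>_def)
  interpret dominated_chain \<Omega> E P X \<pi> \<mu> \<delta> m \<nu> \<delta>\<^sub>M
  proof
    show "\<delta> * measure \<mu> D \<le> measure (kernel_pow E P m x) D" if "x \<in> space E" "D \<in> sets E" for x D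
      using minor(4)[OF that] mult_right_mono[OF \<delta>(3), of "measure \<mu> D"] by simp
  qed (use chain inv stationary minor(1,3) major \<delta> in auto)
  define \<kappa> where "\<kappa> = 4 * (K * m\<^sup>2 + 1) * (r + 2) * (8 * m / \<delta> + 1) + 8 * (8 * m / \<delta>) * (r + 2) + 16 * L"
  \<comment> \<open>The factor 2 makes up for \<open>ln n\<close>, which is at least 1/2.\<close>
  define \<beta> where "\<beta> = 2 * (2 + 2 * exp 2 * \<delta>\<^sub>M)"
  have r0: "r > 0"
  proof -
    have "0 < 2 * inverse (ln (1 / \<rho>))" using ergodic by simp
    then show ?thesis using r by linarith
  qed
  have \<kappa>: "\<kappa> > 0"
    unfolding \<kappa>_def using K_pos r0 \<delta> ergodic(3) by (intro add_nonneg_pos add_nonneg_nonneg mult_nonneg_nonneg) auto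
  have \<beta>: "\<beta> > 0" unfolding \<beta>_def using \<delta>\<^sub>M by (simp add: add_pos_pos)
  have main: "measure \<Omega> {\<omega> \<in> space \<Omega>. U_stat \<Omega> X h n \<omega> \<le>
      \<kappa> * ln (real n) * U_bound (A_const E h n) (B_const E P \<pi> \<nu> r h n) 0 n u}
    \<ge> 1 - \<beta> * exp (- u) * ln (real n)"
    if "n \<ge> 2" "canonical_family E \<pi> n h" "u > 0" for n h u
  proof -
    have "(2 + 2 * exp 2 * \<delta>\<^sub>M) * exp (- u) * 1 \<le> (2 + 2 * exp 2 * \<delta>\<^sub>M) * exp (- u) * (2 * ln (real n))"
      using t_bound_estimates(3)[OF that(1) ergodic(1,2) r] \<delta>\<^sub>M by (intro mult_left_mono) auto
    also have "\<dots> = \<beta> * exp (- u) * ln (real n)" unfolding \<beta>_def by simp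
    finally have "(2 + 2 * exp 2 * \<delta>\<^sub>M) * exp (- u) \<le> \<beta> * exp (- u) * ln (real n)" by simp
    then show ?thesis
      using U_stat_concentration[OF ergodic r that] unfolding \<kappa>_def by linarith
  qed
  have "measure \<Omega> {\<omega> \<in> space \<Omega>. U_stat \<Omega> X h n \<omega> \<le>
      \<kappa> * ln (real n) * U_bound (A_const E h n) (B_const E P \<pi> \<nu> r h n) (C_const \<Omega> E X \<pi> \<nu> h n) n u}
    \<ge> 1 - \<beta> * exp (- u) * ln (real n)"
    if that': "n \<ge> 2" "canonical_family E \<pi> n h" "u > 0" for n h u
  proof -
    have l: "0 \<le> ln (real n)" using that(1) by simp
    have "C_const \<Omega> E X \<pi> \<nu> h n \<ge> 0"
      unfolding C_const_def by (intro real_sqrt_ge_zero sum_nonneg Bochner_Integration.integral_nonneg) simp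
    then have "U_bound (A_const E h n) (B_const E P \<pi> \<nu> r h n) 0 n u \<le>
        U_bound (A_const E h n) (B_const E P \<pi> \<nu> r h n) (C_const \<Omega> E X \<pi> \<nu> h n) n u"
      unfolding U_bound_def using that(3) by (intro add_right_mono mult_right_mono) auto
    then have le: "\<kappa> * ln (real n) * U_bound (A_const E h n) (B_const E P \<pi> \<nu> r h n) 0 n u \<le>
        \<kappa> * ln (real n) * U_bound (A_const E h n) (B_const E P \<pi> \<nu> r h n) (C_const \<Omega> E X \<pi> \<nu> h n) n u"
      using \<kappa> l by (intro mult_left_mono) auto
    note [measurable] = U_stat_borel_measurable[OF that(2)]
    have "prob {\<omega> \<in> space \<Omega>. U_stat \<Omega> X h n \<omega> \<le>
        \<kappa> * ln (real n) * U_bound (A_const E h n) (B_const E P \<pi> \<nu> r h n) 0 n u} \<le>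
      prob {\<omega> \<in> space \<Omega>. U_stat \<Omega> X h n \<omega> \<le>
        \<kappa> * ln (real n) * U_bound (A_const E h n) (B_const E P \<pi> \<nu> r h n) (C_const \<Omega> E X \<pi> \<nu> h n) n u}"
    proof (rule finite_measure_mono)
      show "{\<omega> \<in> space \<Omega>. U_stat \<Omega> X h n \<omega> \<le> \<kappa> * ln (real n) *
          U_bound (A_const E h n) (B_const E P \<pi> \<nu> r h n) (C_const \<Omega> E X \<pi> \<nu> h n) n u} \<in> events" by measurable
    qed (use le in \<open>auto intro: order_trans\<close>)
    with main[OF that'] show ?thesis by linarith
  qed
  with main \<kappa> \<beta> show ?thesis by blast
qed

end
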